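(* Let $A$ generate a quasi-contractive $C_0$-semigroup $S(t)$ of type $\omega$ on the real Hilbert space $\mathcal{H}$ (i.e. $\langle Ax,x\rangle\le\omega\|x\|^2$ for all $x\in D(A)$), and let $B:\mathcal{H}\to\mathcal{H}$ be a bounded linear self-adjoint positive operator. Let $\mathcal{W}=\{x\in\mathcal{H}: BS(t)x=0\ \forall t\ge 0\}$, let $P$ be the orthogonal projection of $\mathcal{H}$ onto $\mathcal{W}^{\perp}$ (along $\mathcal{W}$), and let $S_2(t)$ be the restriction of $S(t)$ to $\mathcal{W}$. Assume that: (i) $\mathcal{W}^{\perp}$ is invariant under $S(t)$ for all $t\ge0$; (ii) there is a function $\varphi:\mathcal{W}^{\perp}\cap D(A)\to\mathbb{R}^{+}$ such that $\langle Ay,By\rangle\le\varphi(y)\|By\|^2$ for all $y\in\mathcal{W}^{\perp}\cap D(A)$, and such that the mapping $\Upsilon:\mathcal{W}^{\perp}\cap D(A)\to\mathcal{H}$, $\Upsilon(y)=\varphi(y)By$, can be extended to a globally Lipschitz function on $\mathcal{W}^{\perp}$; (iii) there exists $\gamma>0$ such that $\gamma\langle Bx,x\rangle\le\|Bx\|^2$ for all $x\in\mathcal{W}^{\perp}$; (iv) $S_2(t)$ is nilpotent: there exists $\delta\ge0$ such that $S_2(t)=0$ for all $t\ge\delta$. Let $0<\mu<\frac12$. Then the closed-loop system $$\frac{d}{dt}y(t)=Ay(t)-F(y(t)),\quad t>0,\qquad y(0)=y_0,$$ where $$F(y)=\begin{cases}\langle BPy,Py\rangle^{-\mu}By+\varphi(Py)By,&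 BPy\ne0,\\ 0,& BPy=0,\end{cases}$$ is globally finite-time stable. Furthermore, writing $y_{01}=Py_0$, the settling time admits the estimate $$T^{*}\le\max\left(\frac{\langle By_{01},y_{01}\rangle^{\mu}}{2\gamma\mu},\ \delta\right).$$
   Context: $\mathcal{H}$ is a real Hilbert space with scalar product $\langle\cdot,\cdot\rangle$ and norm $\|\cdot\|$. "Positive" means $\langle Bx,x\rangle\ge0$ for all $x\in\mathcal{H}$. The set $\mathcal{W}$ is a closed $S(t)$-invariant subspace; by (i), $P$ commutes with $S(t)$ and maps $D(A)$ into $D(A)\cap\mathcal{W}^\perp$, so $F(y)$ makes sense for $y\in D(A)$. The closed-loop system arises from $\frac{d}{dt}y=Ay+u(t)By$ with the feedback $u(t)=-\big(\langle BPy(t),Py(t)\rangle^{-\mu}+\varphi(Py(t))\big)\mathbf 1_{\{BPy(t)\neq0\}}$. Solutions are weak solutions: for $f\in L^1(0,T;\mathcal{H})$, a strong solution of $\frac{d}{dt}y=Ay-F(y)+f$ on $[0,T]$ is a $y\in C([0,T],\mathcal{H})$, absolutely continuous on compact subsets of $(0,T)$, with $y(t)\in D(A)$ and the equation satisfied for a.e. $t\in(0,T)$; a weak solution of the closed-loop system is a continuous $y:[0,\infty)\to\mathcal{H}$ with $y(0)=y_0$ which on each $[0,T]$ is the uniform limit of strong solutions $y_n$ of $\frac{d}{dt}y_n=Ay_n-F(y_n)+f_n$ with $f_n\to0$ in $L^1(0,T;\mathcal{H})$. Globally finite-time stable means: the closed-loop system is Lyapunov stable (at the origin) and, for every $y_0\in\mathcal{H}$,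 there is a finite time $T(y_0)$ such that the solution satisfies $y(t)=0$ for all $t\ge T(y_0)$. The settling time is $T^*=T^*(y_0)=\inf\{T\ge0: y(t)=0\ \forall t\ge T\}$. *)

theory Defs
  imports "HOL-Analysis.Analysis"
begin

section \<open>Semigroups and generators\<close>

text \<open>Only the values \<open>S t\<close> with \<open>t \<ge> 0\<close> matter.\<close>

definition C0_semigroup :: "(real \<Rightarrow> 'a \<Rightarrow> 'a::real_normed_vector) \<Rightarrow> bool" where
  "C0_semigroup S \<longleftrightarrow>
     (\<forall>t\<ge>0. bounded_linear (S t)) \<and>
     (\<forall>x. S 0 x = x) \<and>
     (\<forall>s\<ge>0. \<forall>t\<ge>0. \<forall>x. S (s + t) x = S s (S t x)) \<and>
     (\<forall>x. ((\<lambda>t. S t x) \<longlongrightarrow> x) (at_right 0))"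

text \<open>The unbounded operator \<open>A\<close> with domain \<open>D\<close> is the infinitesimal generator of \<open>S\<close>.
  The values of \<open>A\<close> outside \<open>D\<close> are irrelevant.\<close>

definition generates ::
    "'a set \<Rightarrow> ('a \<Rightarrow> 'a) \<Rightarrow> (real \<Rightarrow> 'a \<Rightarrow> 'a::real_normed_vector) \<Rightarrow> bool" where
  "generates D A S \<longleftrightarrow>
     C0_semigroup S \<and>
     D = {x. \<exists>z. ((\<lambda>h. (S h x - x) /\<^sub>R h) \<longlongrightarrow> z) (at_right 0)} \<and>
     (\<forall>x\<in>D. ((\<lambda>h. (S h x - x) /\<^sub>R h) \<longlongrightarrow> A x) (at_right 0))"

section \<open>Orthogonal projection\<close>

text \<open>Meaningful when \<open>M\<close> is a closed subspace of a Hilbert space; the projection is then along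
  the orthogonal complement of \<open>M\<close>.\<close>

definition orth_proj :: "'a::real_inner set \<Rightarrow> 'a \<Rightarrow> 'a" where
  "orth_proj M x = (THE p. p \<in> M \<and> x - p \<in> M\<^sup>\<bottom>)"

section \<open>Absolute continuity and the space $L^1$\<close>

text \<open>A pair \<open>(a, b)\<close> in \<open>I\<close> stands for the interval with end points \<open>a\<close> and \<open>b\<close>.\<close>

definition abs_continuous_on :: "real set \<Rightarrow> (real \<Rightarrow> 'a::real_normed_vector) \<Rightarrow> bool" where
  "abs_continuous_on K y \<longleftrightarrow>
     (\<forall>\<epsilon>>0. \<exists>\<delta>>0. \<forall>I :: (real \<times> real) set.
        finite I \<and>
        (\<forall>(a, b)\<in>I. a \<in> K \<and> b \<in> K \<and> a < b) \<and>
        disjoint_family_on (\<lambda>(a, b). {a<..<b}) I \<and>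
        (\<Sum>(a, b)\<in>I. b - a) < \<delta>
        \<longrightarrow> (\<Sum>(a, b)\<in>I. norm (y b - y a)) < \<epsilon>)"

definition L1_norm :: "real \<Rightarrow> (real \<Rightarrow> 'a::real_normed_vector) \<Rightarrow> ennreal" where
  "L1_norm T f = (\<integral>\<^sup>+ t \<in> {0<..<T}. ennreal (norm (f t)) \<partial>lebesgue)"

text \<open>Bochner integrability on \<open>(0, T)\<close>: strong measurability (almost everywhere limit of simple
  functions) and finite norm.  The library predicate \<open>integrable\<close> is only available for second
  countable target spaces, whereas the Hilbert space here need not be separable.\<close>

definition L1_fun :: "real \<Rightarrow> (real \<Rightarrow> 'a::real_normed_vector) \<Rightarrow> bool" where
  "L1_fun T f \<longleftrightarrow>
     (\<exists>s. (\<forall>n. simple_function lebesgue (s n)) \<and>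
          (AE t in lebesgue. t \<in> {0<..<T} \<longrightarrow> (\<lambda>n::nat. s n t) \<longlonglongrightarrow> f t)) \<and>
     L1_norm T f < \<infinity>"

section \<open>The closed-loop system\<close>

definition feedback_term ::
    "('a \<Rightarrow> 'a) \<Rightarrow> ('a \<Rightarrow> 'a) \<Rightarrow> ('a \<Rightarrow> real) \<Rightarrow> real \<Rightarrow> 'a \<Rightarrow> 'a::real_inner" where
  "feedback_term B P \<phi> \<mu> y =
     (if B (P y) \<noteq> 0
      then (inner (B (P y)) (P y) powr (-\<mu>)) *\<^sub>R B y + \<phi> (P y) *\<^sub>R B y
      else 0)"

text \<open>Strong solutions on \<open>[0, T]\<close> of \<open>y' = A y - F y + f\<close>, where \<open>A\<close> has domain \<open>D\<close>.\<close>

definition strong_solution ::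
    "'a set \<Rightarrow> ('a \<Rightarrow> 'a) \<Rightarrow> ('a \<Rightarrow> 'a) \<Rightarrow> real \<Rightarrow> (real \<Rightarrow> 'a) \<Rightarrow>
     (real \<Rightarrow> 'a::real_normed_vector) \<Rightarrow> bool" where
  "strong_solution D A F T f y \<longleftrightarrow>
     continuous_on {0..T} y \<and>
     (\<forall>K. compact K \<and> K \<subseteq> {0<..<T} \<longrightarrow> abs_continuous_on K y) \<and>
     (AE t in lebesgue. t \<in> {0<..<T} \<longrightarrow>
        y t \<in> D \<and> (y has_vector_derivative (A (y t) - F (y t) + f t)) (at t))"

text \<open>Weak solutions of \<open>y' = A y - F y\<close>, \<open>y 0 = y0\<close>.  Only the values \<open>y t\<close> with
  \<open>t \<ge> 0\<close> matter.\<close>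

definition weak_solution ::
    "'a set \<Rightarrow> ('a \<Rightarrow> 'a) \<Rightarrow> ('a \<Rightarrow> 'a) \<Rightarrow> 'a \<Rightarrow> (real \<Rightarrow> 'a::real_normed_vector) \<Rightarrow> bool" where
  "weak_solution D A F y0 y \<longleftrightarrow>
     continuous_on {0..} y \<and> y 0 = y0 \<and>
     (\<forall>T>0. \<exists>(yn :: nat \<Rightarrow> real \<Rightarrow> 'a) fn.
        (\<forall>n. L1_fun T (fn n) \<and> strong_solution D A F T (fn n) (yn n)) \<and>
        (\<lambda>n. L1_norm T (fn n)) \<longlonglongrightarrow> 0 \<and>
        uniform_limit {0..T} yn y sequentially)"

section \<open>Stability\<close>

text \<open>In this section \<open>Sol y0 y\<close> means that \<open>y\<close> is a solution with initial state \<open>y0\<close>.\<close>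

definition globally_well_posed :: "('a \<Rightarrow> (real \<Rightarrow> 'a) \<Rightarrow> bool) \<Rightarrow> bool" where
  "globally_well_posed Sol \<longleftrightarrow>
     (\<forall>y0. \<exists>y. Sol y0 y \<and> (\<forall>z. Sol y0 z \<longrightarrow> (\<forall>t\<ge>0. z t = y t)))"

definition lyapunov_stable :: "('a::real_normed_vector \<Rightarrow> (real \<Rightarrow> 'a) \<Rightarrow> bool) \<Rightarrow> bool" where
  "lyapunov_stable Sol \<longleftrightarrow>
     (\<forall>\<epsilon>>0. \<exists>\<eta>>0. \<forall>y0 y. norm y0 < \<eta> \<and> Sol y0 y \<longrightarrow> (\<forall>t\<ge>0. norm (y t) < \<epsilon>))"

definition globally_finite_time_stable ::
    "('a::real_normed_vector \<Rightarrow> (real \<Rightarrow> 'a) \<Rightarrow> bool) \<Rightarrow> bool" where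
  "globally_finite_time_stable Sol \<longleftrightarrow>
     lyapunov_stable Sol \<and>
     (\<forall>y0. \<exists>T\<ge>0. \<forall>y. Sol y0 y \<longrightarrow> (\<forall>t\<ge>T. y t = 0))"

definition settling_time :: "(real \<Rightarrow> 'a::zero) \<Rightarrow> real" where
  "settling_time y = Inf {T. T \<ge> 0 \<and> (\<forall>t\<ge>T. y t = 0)}"

end

theory Submission
  imports Defs
begin

text \<open>
  Since \<open>B\<close> vanishes on \<open>W\<close>, the feedback only sees \<open>P y\<close> and equals \<open>G y + Y (P y)\<close> on the
  domain of \<open>A\<close>. The map \<open>G y = \<langle>B y, y\<rangle> powr (-\<mu>) *\<^sub>R B y\<close> is the gradient of a convex function,
  hence monotone, and it is a uniform limit of Lipschitz maps because \<open>\<mu> < 1/2\<close>; \<open>Y\<close> is Lipschitz.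
  So the generator minus the feedback is quasi-dissipative: the distance of two approximate
  solutions grows at most exponentially. This gives uniqueness, and also existence, because an
  exponential Euler scheme for a Lipschitz regularisation of the feedback yields strong solutions
  with arbitrarily small right-hand side, which form a Cauchy sequence.

  The function \<open>V y = \<langle>B y, y\<rangle>\<close> satisfies \<open>V' \<le> -2 \<gamma> V powr (1 - \<mu>)\<close>, so \<open>V powr \<mu>\<close> decreases with
  speed at least \<open>2 \<gamma> \<mu>\<close> and \<open>B y\<close> vanishes from the time \<open>V y0 powr \<mu> / (2 \<gamma> \<mu>)\<close> on.
  From then on the feedback vanishes, so \<open>y\<close> follows the linear semigroup inside the kernel of \<open>B\<close>,
  that is, \<open>y\<close> lies in \<open>W\<close>. The component of \<open>y\<close> in \<open>W\<close> follows the semigroup from the start and is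
  \<open>0\<close> after time \<open>\<delta>\<close>.
\<close>

section \<open>Absolutely continuous functions\<close>

text \<open>Approximating solutions satisfy their equation only almost everywhere, so estimates are
  first derived for strong solutions, from a one-sided fundamental theorem for absolutely continuous
  functions, and then passed to uniform limits. A weak solution need not stay in \<open>D\<close>,
  and off \<open>D\<close> nothing is assumed about \<open>\<phi>\<close>; limit arguments therefore
  use the everywhere defined, uniformly continuous map \<open>F\<close>, which agrees with the
  feedback on \<open>D\<close>. The settling constant comes from
  \<open>\<mu> * V powr (\<mu> - 1)\<close> times \<open>-2 * \<gamma> * V powr (1 - \<mu>)\<close>:
  the powers cancel and leave \<open>-2 * \<gamma> * \<mu>\<close>. Since
  \<open>r powr \<mu>\<close> is not differentiable at 0, this is integrated only where
  \<open>V\<close> stays away from 0; monotonicity of \<open>V\<close> reduces that condition to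
  positivity at the final time. The settling bound is a maximum rather than a sum because the
  semigroup acts on the \<open>W\<close> component from time 0 on, whenever \<open>B y\<close>
  happens to vanish.\<close>

lemma abs_continuous_on_FTC_le:
  fixes h g :: "real \<Rightarrow> real"
  assumes ab: "a \<le> b" and ac: "abs_continuous_on {a..b} h" and N: "negligible N"
    and der: "\<And>t. t \<in> {a..b} - N \<Longrightarrow> \<exists>d. (h has_real_derivative d) (at t within {a..b}) \<and> d \<le> g t"
    and g: "g integrable_on {a..b}"
  shows "h b - h a \<le> integral {a..b} g"
\<comment> \<open>Henstock's argument: a fine tagged division is split by its tags. At a tag outside
  \<open>N\<close> the derivative bounds the increment over the cell; the cells tagged in
  \<open>N\<close> lie in an open set of measure below \<open>\<delta>\<close>, so absolute
  continuity bounds their total increment.\<close>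
proof (rule field_le_epsilon)
  fix e :: real assume "e > 0"
  \<comment> \<open>The error budget: \<open>e' * (b - a)\<close> from linearising at the good tags,
    \<open>e'\<close> from the cells tagged in \<open>N\<close>, \<open>e'\<close> from the Riemann
    sum.\<close>
  define e' where "e' = e / (b - a + 2)"
  have e': "e' > 0" "e' * (b - a) + e' + e' = e"
  proof -
    show "e' > 0" using ab \<open>e > 0\<close> by (simp add: e'_def)
    have "e' * (b - a + 2) = e" using ab by (simp add: e'_def)
    then show "e' * (b - a) + e' + e' = e" by (simp add: algebra_simps)
  qed
  \<comment> \<open>On \<open>N\<close> the values of \<open>g\<close> are arbitrary; setting them
    to 0 keeps the integral and removes the bad tags from the Riemann sum.\<close>
  define g' where "g' = (\<lambda>t. if t \<in> N then 0 else g t)"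
  have int: "(g' has_integral integral {a..b} g) (cbox a b)"
    by (rule has_integral_spike[OF N, of _ _ g]) (use g in \<open>auto simp: g'_def\<close>)
  obtain \<gamma>1 where \<gamma>1: "gauge \<gamma>1"
    "\<And>p. p tagged_division_of {a..b} \<Longrightarrow> \<gamma>1 fine p \<Longrightarrow>
       \<bar>(\<Sum>(x,k)\<in>p. measure lborel k *\<^sub>R g' x) - integral {a..b} g\<bar> < e'"
  proof -
    obtain \<gamma> where "gauge \<gamma>"
      "\<forall>p. p tagged_division_of cbox a b \<and> \<gamma> fine p \<longrightarrow>
         norm ((\<Sum>(x,k)\<in>p. measure lborel k *\<^sub>R g' x) - integral {a..b} g) < e'"
      using int[unfolded has_integral, rule_format, OF e'(1)] by auto
    then show thesis by (intro that[of \<gamma>]) auto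
  qed
  obtain \<delta> where \<delta>: "\<delta> > 0" "\<And>I. finite I \<Longrightarrow> (\<forall>(s, t)\<in>I. s \<in> {a..b} \<and> t \<in> {a..b} \<and> s < t) \<Longrightarrow>
        disjoint_family_on (\<lambda>(s, t). {s<..<t}) I \<Longrightarrow>
        (\<Sum>(s, t)\<in>I. t - s) < \<delta> \<Longrightarrow> (\<Sum>(s, t)\<in>I. norm (h t - h s)) < e'"
    using ac e'(1) unfolding abs_continuous_on_def by meson
  have N': "N \<in> sets lebesgue" "N \<in> null_sets lebesgue"
    using N by (auto simp: negligible_iff_null_sets)
  obtain U where U: "open U" "N \<subseteq> U" "U - N \<in> lmeasurable" "emeasure lebesgue (U - N) < ennreal \<delta>"
    using sets_lebesgue_outer_open[OF N'(1) \<delta>(1)] by blast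
  have U': "U \<in> lmeasurable" "measure lebesgue U < \<delta>"
  proof -
    have "U = (U - N) \<union> N" using U(2) by blast
    then show "U \<in> lmeasurable"
      using U(3) N'(2) by (metis fmeasurable.Un null_sets_def fmeasurableI_null_sets)
    have "measure lebesgue U = measure lebesgue (U - N)"
      using N'(2) U(1) by (simp add: measure_Diff_null_set)
    moreover have "measure lebesgue (U - N) < \<delta>"
      using U(4) U(3) by (simp add: emeasure_eq_measure2 ennreal_less_iff)
    ultimately show "measure lebesgue U < \<delta>" by simp
  qed
  \<comment> \<open>Straddle estimate: splitting the cell at its tag turns differentiability at that
    single point into a bound for the whole increment.\<close>
  have "\<exists>r>0. x \<in> {a..b} - N \<longrightarrow>
      (\<forall>u v. u \<in> {a..b} \<longrightarrow> v \<in> {a..b} \<longrightarrow> u \<le> x \<longrightarrow> x \<le> v \<longrightarrow> \<bar>u - x\<bar> < r \<longrightarrow> \<bar>v - x\<bar> < r \<longrightarrow>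
        h v - h u \<le> (g' x + e') * (v - u))" for x
  proof (cases "x \<in> {a..b} - N")
    case True
    then obtain d where d: "(h has_real_derivative d) (at x within {a..b})" "d \<le> g x"
      using der by blast
    have "(h has_derivative (\<lambda>y. y * d)) (at x within {a..b})"
      using d(1) by (simp add: has_field_derivative_def mult_commute_abs)
    then obtain r where r: "r > 0"
      "\<And>y. y \<in> {a..b} \<Longrightarrow> \<bar>y - x\<bar> < r \<Longrightarrow> \<bar>h y - h x - (y - x) * d\<bar> \<le> e' * \<bar>y - x\<bar>"
      using e'(1) unfolding has_derivative_within_alt real_norm_def by blast
    have "h v - h u \<le> (g' x + e') * (v - u)"
      if "u \<in> {a..b}" "v \<in> {a..b}" "u \<le> x" "x \<le> v" "\<bar>u - x\<bar> < r" "\<bar>v - x\<bar> < r" for u v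
    proof -
      have "h v - h x \<le> (v - x) * d + e' * (v - x)"
        using r(2)[of v] that by (auto simp: abs_le_iff)
      moreover have "h x - h u \<le> (x - u) * d + e' * (x - u)"
        using r(2)[of u] that by (auto simp: abs_le_iff algebra_simps)
      ultimately have "h v - h u \<le> (v - u) * d + e' * (v - u)"
        by (simp add: algebra_simps)
      also have "\<dots> \<le> (v - u) * g' x + e' * (v - u)"
        using that d(2) True by (auto simp: g'_def intro!: mult_left_mono)
      finally show ?thesis by (simp add: algebra_simps)
    qed
    with r(1) show ?thesis by blast
  qed (auto intro: zero_less_one)
  then obtain r where r: "\<And>x. r x > 0"
      "\<And>x u v. x \<in> {a..b} - N \<Longrightarrow> u \<in> {a..b} \<Longrightarrow> v \<in> {a..b} \<Longrightarrow> u \<le> x \<Longrightarrow> x \<le> v \<Longrightarrow>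
        \<bar>u - x\<bar> < r x \<Longrightarrow> \<bar>v - x\<bar> < r x \<Longrightarrow> h v - h u \<le> (g' x + e') * (v - u)"
    by metis
  define \<gamma> where "\<gamma> = (\<lambda>x. \<gamma>1 x \<inter> (if x \<in> N then U else ball x (r x)))"
  have "gauge \<gamma>"
    using \<gamma>1(1) U r(1) by (auto simp: gauge_def \<gamma>_def)
  then obtain p where p: "p tagged_division_of {a..b}" "\<gamma> fine p"
    using fine_division_exists_real by blast
  have p1: "\<gamma>1 fine p"
    using p(2) by (auto simp: fine_def \<gamma>_def)
  have fin: "finite p" using p(1) by blast
  have cell: "\<exists>u v. k = {u..v} \<and> u \<le> x \<and> x \<le> v \<and> a \<le> u \<and> v \<le> b \<and> Inf k = u \<and> Sup k = v \<and> measure lborel k = v - u"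
    if "(x, k) \<in> p" for x k
  proof -
    obtain u v where "k = cbox u v" "x \<in> k" "k \<subseteq> {a..b}"
      using tagged_division_ofD(2-4)[OF p(1) \<open>(x, k) \<in> p\<close>] by blast
    then show ?thesis by auto
  qed
  \<comment> \<open>Degenerate cells contribute no increment and are excluded: absolute continuity
    speaks of proper intervals, and only for these do the end points determine the tagged
    cell.\<close>
  define bad where "bad = {(x, k) \<in> p. x \<in> N \<and> Inf k < Sup k}"
  define I where "I = (\<lambda>(x, k). (Inf k, Sup k)) ` bad"
  have disj: "{Inf k<..<Sup k} \<inter> {Inf k'<..<Sup k'} = {}"
    if "(x, k) \<in> p" "(x', k') \<in> p" "(x, k) \<noteq> (x', k')" for x k x' k'
    using tagged_division_ofD(5)[OF p(1) that] cell[OF that(1)] cell[OF that(2)]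
    by (metis interior_atLeastAtMost_real)
  have inj: "inj_on (\<lambda>(x, k). (Inf k, Sup k)) bad"
  proof (rule inj_onI, clarify)
    fix x k x' k' assume *: "(x, k) \<in> bad" "(x', k') \<in> bad" "Inf k = Inf k'" "Sup k = Sup k'"
    have "{Inf k<..<Sup k} \<noteq> {}" using *(1) by (simp add: bad_def)
    with *(3,4) have "{Inf k<..<Sup k} \<inter> {Inf k'<..<Sup k'} \<noteq> {}" by simp
    then show "x = x' \<and> k = k'"
      using disj[of x k x' k'] *(1,2) unfolding bad_def by auto
  qed
  have I_disj: "disjoint_family_on (\<lambda>(s, t). {s<..<t}) I"
    unfolding disjoint_family_on_def I_def
  proof (intro ballI impI)
    fix i j assume ij: "i \<in> (\<lambda>(x, k). (Inf k, Sup k)) ` bad" "j \<in> (\<lambda>(x, k). (Inf k, Sup k)) ` bad" "i \<noteq> j"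
    then obtain x k x' k' where *: "(x, k) \<in> bad" "(x', k') \<in> bad"
      "i = (Inf k, Sup k)" "j = (Inf k', Sup k')" by (elim imageE) (auto split: prod.splits)
    with ij(3) have "(x, k) \<noteq> (x', k')" by auto
    then have "{Inf k<..<Sup k} \<inter> {Inf k'<..<Sup k'} = {}"
      by (intro disj[of x k x' k']) (use * in \<open>auto simp: bad_def\<close>)
    then show "(\<lambda>(s, t). {s<..<t}) i \<inter> (\<lambda>(s, t). {s<..<t}) j = {}"
      using * by simp
  qed
  have finI: "finite I" "finite bad"
    using fin finite_subset[of bad p] by (auto simp: I_def bad_def)
  have I_cell: "s \<in> {a..b} \<and> t \<in> {a..b} \<and> s < t \<and> {s<..<t} \<subseteq> U" if "(s, t) \<in> I" for s t
  proof -
    obtain x k where xk: "(x, k) \<in> p" "x \<in> N" "Inf k < Sup k" "s = Inf k" "t = Sup k"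
      using \<open>(s, t) \<in> I\<close> by (auto simp: I_def bad_def)
    have "k \<subseteq> \<gamma> x" using p(2) xk(1) by (auto simp: fine_def)
    then have "k \<subseteq> U" using xk(2) by (simp add: \<gamma>_def)
    then show ?thesis using cell[OF xk(1)] xk by fastforce
  qed
  have "(\<Sum>(s, t)\<in>I. t - s) = (\<Sum>i\<in>I. measure lebesgue ((\<lambda>(s, t). {s<..<t}) i))"
    by (rule sum.cong) (use I_cell in fastforce)+
  also have "\<dots> = measure lebesgue (\<Union>i\<in>I. (\<lambda>(s, t). {s<..<t}) i)"
    by (rule measure_finite_Union[symmetric]) (use finI I_disj in \<open>auto dest!: I_cell\<close>)
  also have "\<dots> \<le> measure lebesgue U"
    by (rule measure_mono_fmeasurable) (use U' finI in \<open>auto dest: I_cell\<close>)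
  finally have "(\<Sum>(s, t)\<in>I. t - s) < \<delta>" using U'(2) by simp
  then have bad_sum: "(\<Sum>(s, t)\<in>I. norm (h t - h s)) < e'"
    using \<delta>(2)[of I] finI I_disj I_cell by blast
  have "h b - h a = (\<Sum>(x, k)\<in>p. h (Sup k) - h (Inf k))"
    using additive_tagged_division_1[OF ab p(1), of h] by simp
  also have "\<dots> \<le> (\<Sum>(x, k)\<in>p. measure lborel k *\<^sub>R g' x + e' * measure lborel k
                 + (if (x, k) \<in> bad then norm (h (Sup k) - h (Inf k)) else 0))"
  proof (rule sum_mono, clarify)
    fix x k assume xk: "(x, k) \<in> p"
    obtain u v where uv: "k = {u..v}" "u \<le> x" "x \<le> v" "a \<le> u" "v \<le> b" "Inf k = u" "Sup k = v"
      "measure lborel k = v - u" using cell[OF xk] by blast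
    show "h (Sup k) - h (Inf k) \<le> measure lborel k *\<^sub>R g' x + e' * measure lborel k
                 + (if (x, k) \<in> bad then norm (h (Sup k) - h (Inf k)) else 0)"
    proof (cases "x \<in> N")
      case True
      have "0 \<le> e' * (v - u)" using uv e'(1) by simp
      moreover have "h v - h u \<le> 0" if "\<not> u < v"
      proof -
        have "u = v" using that uv(2,3) by linarith
        then show ?thesis by simp
      qed
      ultimately show ?thesis using uv True xk
        by (cases "u < v") (auto simp: bad_def g'_def intro: order_trans[OF abs_ge_self])
    next
      case False
      have "k \<subseteq> \<gamma> x" using p(2) xk(1) by (auto simp: fine_def)
      then have "k \<subseteq> ball x (r x)" using False by (simp add: \<gamma>_def)
      moreover have "u \<in> k" "v \<in> k" using uv by auto
      ultimately have "u \<in> ball x (r x)" "v \<in> ball x (r x)" by blast+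
      then have "\<bar>u - x\<bar> < r x" "\<bar>v - x\<bar> < r x"
        by (auto simp: dist_real_def abs_minus_commute)
      then have "h v - h u \<le> (g' x + e') * (v - u)"
        using r(2)[of x u v] uv False by auto
      then show ?thesis using uv False by (simp add: bad_def algebra_simps)
    qed
  qed
  also have "\<dots> = (\<Sum>(x, k)\<in>p. measure lborel k *\<^sub>R g' x) + e' * (\<Sum>(x, k)\<in>p. measure lborel k)
      + (\<Sum>(x, k)\<in>p. if (x, k) \<in> bad then norm (h (Sup k) - h (Inf k)) else 0)"
    by (simp add: sum.distrib split_beta sum_distrib_left)
  also have "(\<Sum>(x, k)\<in>p. measure lborel k) = b - a"
    using additive_content_tagged_division[of p a b] p(1) ab by (simp add: cbox_interval)
  also have "(\<Sum>(x, k)\<in>p. if (x, k) \<in> bad then norm (h (Sup k) - h (Inf k)) else 0)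
      = (\<Sum>(x, k)\<in>bad. norm (h (Sup k) - h (Inf k)))"
    by (rule sum.mono_neutral_cong_right) (use fin in \<open>auto simp: bad_def split: if_splits\<close>)
  also have "\<dots> = (\<Sum>(s, t)\<in>I. norm (h t - h s))"
    unfolding I_def by (subst sum.reindex[OF inj]) (simp add: split_beta)
  finally have "h b - h a \<le> (\<Sum>(x, k)\<in>p. measure lborel k *\<^sub>R g' x) + e' * (b - a) + e'"
    using bad_sum by linarith
  then show "h b - h a \<le> integral {a..b} g + e"
    using \<gamma>1(2)[OF p(1) p1] e'(2) by linarith
qed

lemma abs_continuous_on_subset:
  "abs_continuous_on K y \<Longrightarrow> K' \<subseteq> K \<Longrightarrow> abs_continuous_on K' y"
  unfolding abs_continuous_on_def by (smt (verit, best) case_prodD case_prodI2 subsetD)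

lemma lipschitz_imp_abs_continuous_on:
  assumes "L-lipschitz_on K y"
  shows "abs_continuous_on K y"
  unfolding abs_continuous_on_def
proof (intro allI impI)
  fix e :: real assume "e > 0"
  have L: "L \<ge> 0" using assms lipschitz_on_nonneg by blast
  show "\<exists>\<delta>>0. \<forall>I. finite I \<and> (\<forall>(a, b)\<in>I. a \<in> K \<and> b \<in> K \<and> a < b) \<and>
      disjoint_family_on (\<lambda>(a, b). {a<..<b}) I \<and> (\<Sum>(a, b)\<in>I. b - a) < \<delta> \<longrightarrow>
      (\<Sum>(a, b)\<in>I. norm (y b - y a)) < e"
  proof (intro exI[of _ "e / (L + 1)"] conjI allI impI; (elim conjE)?)
    show "e / (L + 1) > 0" using \<open>e > 0\<close> L by simp
    fix I :: "(real \<times> real) set"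
    assume I: "\<forall>(a, b)\<in>I. a \<in> K \<and> b \<in> K \<and> a < b" "(\<Sum>(a, b)\<in>I. b - a) < e / (L + 1)"
    have pos: "0 \<le> (\<Sum>(a, b)\<in>I. b - a)"
      by (rule sum_nonneg) (use I(1) in fastforce)
    have "(\<Sum>(a, b)\<in>I. norm (y b - y a)) \<le> (\<Sum>(a, b)\<in>I. L * (b - a))"
    proof (rule sum_mono, clarify)
      fix a b assume "(a, b) \<in> I"
      then have "a \<in> K" "b \<in> K" "a < b" using I(1) by auto
      then show "norm (y b - y a) \<le> L * (b - a)"
        using lipschitz_onD[OF assms, of b a] by (simp add: dist_norm)
    qed
    also have "\<dots> = L * (\<Sum>(a, b)\<in>I. b - a)"
      by (simp add: sum_distrib_left split_beta)
    also have "\<dots> \<le> (L + 1) * (\<Sum>(a, b)\<in>I. b - a)"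
      using pos by (intro mult_right_mono) auto
    also have "\<dots> < e"
      using I(2) L by (simp add: field_simps)
    finally show "(\<Sum>(a, b)\<in>I. norm (y b - y a)) < e" .
  qed
qed

text \<open>Serves every composite below: increments of an energy, of a difference of curves or of
  \<open>V\<close> along a solution are controlled by increments of two curves already known to be
  absolutely continuous. Replacing \<open>L\<close> by \<open>max L 1\<close> removes any concern
  about its sign.\<close>

lemma abs_continuous_on_dominated:
  assumes y: "abs_continuous_on K y" and z: "abs_continuous_on K z"
    and h: "\<And>s t. s \<in> K \<Longrightarrow> t \<in> K \<Longrightarrow> norm (h t - h s) \<le> L * (norm (y t - y s) + norm (z t - z s))"
  shows "abs_continuous_on K h"
  unfolding abs_continuous_on_def
proof (intro allI impI)
  fix e :: real assume e: "e > 0"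
  define L' where "L' = max L 1"
  have L': "L' > 0" "L \<le> L'" by (auto simp: L'_def)
  have e': "e / (2 * L') > 0" using e L' by simp
  obtain \<delta>1 where \<delta>1: "\<delta>1 > 0" "\<And>I. finite I \<and> (\<forall>(a, b)\<in>I. a \<in> K \<and> b \<in> K \<and> a < b) \<and>
      disjoint_family_on (\<lambda>(a, b). {a<..<b}) I \<and> (\<Sum>(a, b)\<in>I. b - a) < \<delta>1 \<Longrightarrow>
      (\<Sum>(a, b)\<in>I. norm (y b - y a)) < e / (2 * L')"
    using y e' unfolding abs_continuous_on_def by meson
  obtain \<delta>2 where \<delta>2: "\<delta>2 > 0" "\<And>I. finite I \<and> (\<forall>(a, b)\<in>I. a \<in> K \<and> b \<in> K \<and> a < b) \<and>
      disjoint_family_on (\<lambda>(a, b). {a<..<b}) I \<and> (\<Sum>(a, b)\<in>I. b - a) < \<delta>2 \<Longrightarrow>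
      (\<Sum>(a, b)\<in>I. norm (z b - z a)) < e / (2 * L')"
    using z e' unfolding abs_continuous_on_def by meson
  show "\<exists>\<delta>>0. \<forall>I. finite I \<and> (\<forall>(a, b)\<in>I. a \<in> K \<and> b \<in> K \<and> a < b) \<and>
      disjoint_family_on (\<lambda>(a, b). {a<..<b}) I \<and> (\<Sum>(a, b)\<in>I. b - a) < \<delta> \<longrightarrow>
      (\<Sum>(a, b)\<in>I. norm (h b - h a)) < e"
  proof (intro exI[of _ "min \<delta>1 \<delta>2"] conjI allI impI; (elim conjE)?)
    show "min \<delta>1 \<delta>2 > 0" using \<delta>1 \<delta>2 by simp
    fix I :: "(real \<times> real) set"
    assume I: "finite I" "\<forall>(a, b)\<in>I. a \<in> K \<and> b \<in> K \<and> a < b"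
      "disjoint_family_on (\<lambda>(a, b). {a<..<b}) I" "(\<Sum>(a, b)\<in>I. b - a) < min \<delta>1 \<delta>2"
    have "(\<Sum>(a, b)\<in>I. norm (h b - h a))
        \<le> (\<Sum>(a, b)\<in>I. L' * (norm (y b - y a) + norm (z b - z a)))"
    proof (rule sum_mono, clarify)
      fix a b assume "(a, b) \<in> I"
      then have "a \<in> K" "b \<in> K" using I(2) by auto
      then have "norm (h b - h a) \<le> L * (norm (y b - y a) + norm (z b - z a))"
        by (rule h)
      also have "\<dots> \<le> L' * (norm (y b - y a) + norm (z b - z a))"
        using L'(2) by (intro mult_right_mono) auto
      finally show "norm (h b - h a) \<le> L' * (norm (y b - y a) + norm (z b - z a))" .
    qed
    also have "\<dots> = L' * ((\<Sum>(a, b)\<in>I. norm (y b - y a)) + (\<Sum>(a, b)\<in>I. norm (z b - z a)))"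
      by (simp add: sum.distrib split_beta flip: sum_distrib_left)
    also have "\<dots> < L' * (e / (2 * L') + e / (2 * L'))"
      using \<delta>1(2)[of I] \<delta>2(2)[of I] I L'(1) by (intro mult_strict_left_mono add_strict_mono) auto
    also have "\<dots> = e" using L'(1) by simp
    finally show "(\<Sum>(a, b)\<in>I. norm (h b - h a)) < e" .
  qed
qed

section \<open>Hilbert and Banach spaces\<close>

text \<open>A minimising sequence for the distance is Cauchy by the parallelogram law, since
  midpoints stay in \<open>M\<close>. Its limit is optimal, and perturbing it inside
  \<open>M\<close> yields orthogonality.\<close>

lemma closed_subspace_projection:
  fixes M :: "'a::{real_inner, complete_space} set"
  assumes M: "subspace M" "closed M"
  obtains w where "w \<in> M" "\<And>m. m \<in> M \<Longrightarrow> inner (x - w) m = 0"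
proof -
  define d where "d = Inf ((\<lambda>m. (norm (x - m))\<^sup>2) ` M)"
  have bdd: "bdd_below ((\<lambda>m. (norm (x - m))\<^sup>2) ` M)"
    by (rule bdd_belowI[of _ 0]) auto
  have d_le: "d \<le> (norm (x - m))\<^sup>2" if "m \<in> M" for m
    unfolding d_def by (rule cInf_lower[OF _ bdd]) (use that in auto)
  have ne: "(\<lambda>m. (norm (x - m))\<^sup>2) ` M \<noteq> {}" using subspace_0[OF M(1)] by blast
  have "\<exists>m. m \<in> M \<and> (norm (x - m))\<^sup>2 < d + inverse (real (Suc n))" for n
  proof -
    have "d < d + inverse (real (Suc n))" by simp
    then obtain y where "y \<in> (\<lambda>m. (norm (x - m))\<^sup>2) ` M" "y < d + inverse (real (Suc n))"
      using cInf_less_iff[OF ne bdd] unfolding d_def by blast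
    then show ?thesis by blast
  qed
  then obtain m where m: "\<And>n. m n \<in> M" "\<And>n. (norm (x - m n))\<^sup>2 < d + inverse (real (Suc n))"
    by metis
  have dm: "(norm (m n - m k))\<^sup>2 \<le> 2 * inverse (real (Suc n)) + 2 * inverse (real (Suc k))" for n k
  proof -
    have "(1/2) *\<^sub>R (m n + m k) \<in> M"
      using m(1) M(1) by (simp add: subspace_add subspace_mul)
    from d_le[OF this] have "4 * d \<le> (norm ((x - m n) + (x - m k)))\<^sup>2"
    proof -
      have "(x - m n) + (x - m k) = 2 *\<^sub>R (x - (1/2) *\<^sub>R (m n + m k))"
        by (simp add: algebra_simps scaleR_2)
      then have "(norm ((x - m n) + (x - m k)))\<^sup>2 = 4 * (norm (x - (1/2) *\<^sub>R (m n + m k)))\<^sup>2"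
        by (simp add: power_mult_distrib)
      with \<open>d \<le> _\<close> show ?thesis by linarith
    qed
    moreover have "(norm (m n - m k))\<^sup>2 + (norm ((x - m n) + (x - m k)))\<^sup>2
        = 2 * (norm (x - m n))\<^sup>2 + 2 * (norm (x - m k))\<^sup>2"
      by (simp add: power2_norm_eq_inner inner_simps inner_commute)
    ultimately show ?thesis using m(2)[of n] m(2)[of k] by linarith
  qed
  have "Cauchy m"
    unfolding Cauchy_def
  proof (intro allI impI)
    fix e :: real assume "e > 0"
    obtain N where N: "inverse (real (Suc N)) < e\<^sup>2 / 4"
      using reals_Archimedean[of "e\<^sup>2 / 4"] \<open>e > 0\<close> by auto
    have "dist (m n) (m k) < e" if "n \<ge> N" "k \<ge> N" for n k
    proof -
      have "inverse (real (Suc n)) \<le> inverse (real (Suc N))" "inverse (real (Suc k)) \<le> inverse (real (Suc N))"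
        using that by (auto intro!: le_imp_inverse_le)
      then have "(norm (m n - m k))\<^sup>2 < e\<^sup>2" using dm[of n k] N by linarith
      then show ?thesis using \<open>e > 0\<close> by (simp add: dist_norm power2_less_imp_less)
    qed
    then show "\<exists>M. \<forall>n\<ge>M. \<forall>k\<ge>M. dist (m n) (m k) < e" by blast
  qed
  then obtain w where w: "m \<longlonglongrightarrow> w"
    using Cauchy_convergent_iff convergent_def by blast
  have "w \<in> M" using closed_sequentially[OF M(2)] m(1) w by blast
  have wd: "(norm (x - w))\<^sup>2 \<le> d"
  proof (rule LIMSEQ_le)
    show "(\<lambda>n. (norm (x - m n))\<^sup>2) \<longlonglongrightarrow> (norm (x - w))\<^sup>2"
      by (intro tendsto_intros w)
    show "(\<lambda>n. d + inverse (real (Suc n))) \<longlonglongrightarrow> d"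
      using LIMSEQ_inverse_real_of_nat_add[of d] by simp
    show "\<exists>N. \<forall>n\<ge>N. (norm (x - m n))\<^sup>2 \<le> d + inverse (real (Suc n))"
      using m(2) less_imp_le by blast
  qed
  have "inner (x - w) u = 0" if u: "u \<in> M" for u
  proof (cases "u = 0")
    case False
    \<comment> \<open>The minimiser of the quadratic \<open>norm (x - w - t *\<^sub>R u)\<close>
      squared in \<open>t\<close>; optimality of \<open>w\<close> forces it to be 0.\<close>
    define t where "t = inner (x - w) u / (norm u)\<^sup>2"
    have "w + t *\<^sub>R u \<in> M" using \<open>w \<in> M\<close> u M(1) by (simp add: subspace_add subspace_mul)
    from d_le[OF this] wd have "(norm (x - w))\<^sup>2 \<le> (norm (x - w - t *\<^sub>R u))\<^sup>2"
      by (metis diff_diff_eq order_trans)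
    also have "\<dots> = (norm (x - w))\<^sup>2 - 2 * t * inner (x - w) u + t\<^sup>2 * (norm u)\<^sup>2"
      unfolding power2_norm_eq_inner
      by (simp add: inner_diff_left inner_diff_right inner_commute power2_eq_square algebra_simps)
    also have "t\<^sup>2 * (norm u)\<^sup>2 = t * inner (x - w) u"
      using False by (simp add: t_def power2_eq_square)
    finally have "t * inner (x - w) u \<le> 0" by linarith
    then have "(inner (x - w) u)\<^sup>2 \<le> 0"
      using False by (simp add: t_def power2_eq_square divide_le_0_iff zero_less_mult_iff)
        (metis norm_eq_zero zero_less_norm_iff mult_pos_pos not_less)
    then show ?thesis by simp
  qed auto
  then show thesis using \<open>w \<in> M\<close> that by blast
qed

text \<open>The representing vector is a multiple of \<open>u\<close>, the component of
  \<open>x0\<close> orthogonal to the kernel of \<open>l\<close>: every \<open>x\<close> differs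
  from a multiple of \<open>u\<close> by an element of that kernel.\<close>

lemma riesz_representation:
  fixes l :: "'a::{real_inner, complete_space} \<Rightarrow> real"
  assumes "bounded_linear l"
  obtains z where "\<And>x. l x = inner z x"
proof (cases "\<exists>x0. l x0 \<noteq> 0")
  case True
  then obtain x0 where x0: "l x0 \<noteq> 0" by blast
  interpret bounded_linear l by fact
  define M where "M = {y. l y = 0}"
  have "subspace M" by (auto simp: subspace_def M_def add scaleR zero)
  moreover have "closed M"
    unfolding M_def by (intro closed_Collect_eq continuous_intros continuous_on continuous_on_id)
  ultimately obtain w where w: "w \<in> M" "\<And>m. m \<in> M \<Longrightarrow> inner (x0 - w) m = 0"
    using closed_subspace_projection by metis
  define u where "u = x0 - w"
  have lu: "l u \<noteq> 0" using x0 w(1) by (simp add: u_def diff M_def)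
  then have u0: "u \<noteq> 0" using zero by auto
  have "l x = inner ((l u / (norm u)\<^sup>2) *\<^sub>R u) x" for x
  proof -
    have "x - (l x / l u) *\<^sub>R u \<in> M" using lu by (simp add: M_def diff scaleR)
    from w(2)[OF this] have "inner u x = (l x / l u) * (norm u)\<^sup>2"
      by (simp add: u_def[symmetric] inner_simps power2_norm_eq_inner)
    then show ?thesis using lu u0 by simp
  qed
  then show thesis by (rule that)
next
  case False
  then show thesis using that[of 0] by simp
qed

text \<open>The type of the Hilbert space is not an instance of class \<^class>\<open>banach\<close>, so the library
  integral is not available for functions with values in it. By Riesz representation we
  integrate in the dual space instead.\<close>

lemma antiderivative_exists:
  fixes f :: "real \<Rightarrow> 'a::{real_inner, complete_space}"
  assumes f: "continuous_on {0..} f"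
  obtains F where "F 0 = 0" "\<And>t. t \<ge> 0 \<Longrightarrow> (F has_vector_derivative f t) (at t within {0..})"
proof -
  have "\<forall>l. \<exists>z. \<forall>x. blinfun_apply (l :: 'a \<Rightarrow>\<^sub>L real) x = inner z x"
    using riesz_representation[OF blinfun.bounded_linear_right] by metis
  then obtain r :: "('a \<Rightarrow>\<^sub>L real) \<Rightarrow> 'a" where r: "\<And>l x. blinfun_apply l x = inner (r l) x"
    by metis
  have r_eqI: "r l = z" if "\<And>x. blinfun_apply l x = inner z x" for l z
    using that r by (metis vector_eq_rdot)
  have bl: "bounded_linear r"
  proof (rule bounded_linear_intro[of _ 1])
    show "r (l + l') = r l + r l'" for l l'
      by (rule r_eqI) (simp add: blinfun.add_left inner_add_left flip: r)
    show "r (c *\<^sub>R l) = c *\<^sub>R r l" for c l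
      by (rule r_eqI) (simp add: blinfun.scaleR_left flip: r)
    show "norm (r l) \<le> norm l * 1" for l
    proof (cases "r l = 0")
      case False
      have "(norm (r l))\<^sup>2 = blinfun_apply l (r l)" by (simp add: r power2_norm_eq_inner)
      also have "\<dots> \<le> norm l * norm (r l)"
        using norm_blinfun[of l "r l"] by simp
      finally show ?thesis using False by (simp add: power2_eq_square)
    qed simp
  qed
  define j where "j = (\<lambda>x::'a. blinfun_inner_right x)"
  have rj: "r (j x) = x" for x
    by (rule r_eqI) (simp add: j_def blinfun_inner_right.rep_eq)
  have jf: "continuous_on {0..T} (\<lambda>s. j (f s))" for T
    unfolding j_def
    by (intro bounded_linear.continuous_on[OF bounded_linear_blinfun_inner_right]
        continuous_on_subset[OF f]) auto
  define F where "F = (\<lambda>t. r (integral {0..t} (\<lambda>s. j (f s))))"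
  have "(F has_vector_derivative f t) (at t within {0..})" if "t \<ge> 0" for t
  proof -
    have "((\<lambda>u. integral {0..u} (\<lambda>s. j (f s))) has_vector_derivative j (f t)) (at t within {0..t+1})"
      by (rule integral_has_vector_derivative[OF jf]) (use that in auto)
    from bounded_linear.has_vector_derivative[OF bl this]
    have "(F has_vector_derivative f t) (at t within {0..t+1})"
      by (simp add: F_def rj)
    moreover have "at t within {0..} = at t within {0..t+1}"
      by (rule at_within_nhd[of _ "{t-1<..<t+1}"]) auto
    ultimately show ?thesis by simp
  qed
  moreover have "F 0 = 0"
    using bounded_linear.linear[OF bl] by (simp add: F_def linear_0)
  ultimately show thesis using that by blast
qed

text \<open>A gliding hump. Along a subsequence the norms exceed \<open>4 ^ k\<close>; a series with
  steps of length \<open>(1/3) ^ k\<close> is built so that the \<open>k\<close>-th operator is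
  large after its own step and the later steps are too short to undo this.\<close>

lemma uniform_boundedness_sequence:
  fixes T :: "nat \<Rightarrow> 'a::{real_normed_vector, complete_space} \<Rightarrow> 'b::real_normed_vector"
  assumes T: "\<And>n. bounded_linear (T n)" and bdd: "\<And>x. bounded (range (\<lambda>n. T n x))"
  obtains M where "\<And>n. onorm (T n) \<le> M"
proof (rule ccontr)
  assume "\<not> thesis"
  then have "\<forall>k::nat. \<exists>n. onorm (T n) > 4 ^ k" using that not_le by metis
  then obtain n where n: "\<And>k::nat. onorm (T (n k)) > 4 ^ k" by metis
  define \<tau> where "\<tau> = (\<lambda>k. T (n k))"
  have \<tau>: "bounded_linear (\<tau> k)" for k using T by (simp add: \<tau>_def)
  have on: "onorm (\<tau> k) > 4 ^ k" for k using n by (simp add: \<tau>_def)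
  have pos: "onorm (\<tau> k) > 0" for k using on[of k] less_trans[of 0 "4 ^ k :: real"] by simp
  have "\<exists>u. norm u = (1/3) ^ k \<and> norm (\<tau> k u) \<ge> 2/3 * onorm (\<tau> k) * (1/3) ^ k" for k
  proof -
    interpret bounded_linear "\<tau> k" by (rule \<tau>)
    have "\<exists>x. norm (\<tau> k x) > 2/3 * onorm (\<tau> k) * norm x"
    proof (rule ccontr)
      assume "\<not> ?thesis"
      then have "onorm (\<tau> k) \<le> 2/3 * onorm (\<tau> k)"
        using pos[of k] by (intro onorm_bound) (auto simp: not_less)
      then show False using pos[of k] by simp
    qed
    then obtain x where x: "norm (\<tau> k x) > 2/3 * onorm (\<tau> k) * norm x" by blast
    then have "x \<noteq> 0" using zero by auto
    define u where "u = ((1/3) ^ k / norm x) *\<^sub>R x"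
    have "norm (\<tau> k u) = (1/3) ^ k / norm x * norm (\<tau> k x)"
      by (simp add: u_def scaleR)
    also have "\<dots> \<ge> (1/3) ^ k / norm x * (2/3 * onorm (\<tau> k) * norm x)"
      using x by (intro mult_left_mono) auto
    also have "(1/3) ^ k / norm x * (2/3 * onorm (\<tau> k) * norm x) = 2/3 * onorm (\<tau> k) * (1/3) ^ k"
      using \<open>x \<noteq> 0\<close> by simp
    finally show ?thesis using \<open>x \<noteq> 0\<close> by (intro exI[of _ u]) (simp add: u_def)
  qed
  then obtain u where u: "\<And>k. norm (u k) = (1/3) ^ k"
     "\<And>k. norm (\<tau> k (u k)) \<ge> 2/3 * onorm (\<tau> k) * (1/3) ^ k" by metis
  \<comment> \<open>The images of \<open>x + u k\<close> and \<open>x - u k\<close> differ by twice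
    the image of \<open>u k\<close>, so at least one of the two signs gives an image as long as that
    of \<open>u k\<close>.\<close>
  define step where "step = (\<lambda>k x. if norm (\<tau> k (x + u k)) \<ge> norm (\<tau> k (u k)) then x + u k else x - u k)"
  have step1: "norm (\<tau> k (step k x)) \<ge> norm (\<tau> k (u k))" for k x
  proof (cases "norm (\<tau> k (x + u k)) \<ge> norm (\<tau> k (u k))")
    case False
    interpret bounded_linear "\<tau> k" by (rule \<tau>)
    have "2 * norm (\<tau> k (u k)) = norm (\<tau> k (x + u k) - \<tau> k (x - u k))"
      by (simp add: diff[symmetric] scaleR_2[symmetric] scaleR)
    also have "\<dots> \<le> norm (\<tau> k (x + u k)) + norm (\<tau> k (x - u k))"
      by (rule norm_triangle_ineq4)
    finally show ?thesis using False by (simp add: step_def)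
  qed (simp add: step_def)
  have step2: "norm (step k x - x) = (1/3) ^ k" for k x
    by (auto simp: step_def u)
  define x where "x = rec_nat 0 step"
  have x_Suc: "x (Suc k) = step k (x k)" for k by (simp add: x_def)
  have diff: "norm (x (k + m) - x k) \<le> 3/2 * (1/3) ^ k - 3/2 * (1/3) ^ (k + m)" for k m
  proof (induction m)
    case (Suc m)
    have "norm (x (k + Suc m) - x k) \<le> norm (x (k + m) - x k) + norm (x (Suc (k + m)) - x (k + m))"
      using norm_triangle_ineq[of "x (k + m) - x k" "x (Suc (k + m)) - x (k + m)"] by simp
    also have "norm (x (Suc (k + m)) - x (k + m)) = (1/3) ^ (k + m)"
      by (simp add: x_Suc step2)
    finally show ?case using Suc by simp
  qed simp
  have diff': "norm (x l - x k) \<le> 3/2 * (1/3) ^ k" if "k \<le> l" for k l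
  proof -
    have "0 \<le> (1/3::real) ^ l" by simp
    moreover have "norm (x l - x k) \<le> 3/2 * (1/3) ^ k - 3/2 * (1/3) ^ l"
      using diff[of k "l - k"] that by simp
    ultimately show ?thesis by linarith
  qed
  have "Cauchy x"
    unfolding Cauchy_altdef
  proof (intro allI impI)
    fix e :: real assume "e > 0"
    then obtain k where "(1/3) ^ k < e / (3/2)"
      using real_arch_pow_inv[of "e / (3/2)" "1/3"] by auto
    then have k: "3/2 * (1/3) ^ k < e" by (simp add: field_simps)
    have "dist (x p) (x l) < e" if "p \<ge> k" "l > p" for p l
    proof -
      have "dist (x p) (x l) \<le> 3/2 * (1/3) ^ p" 
        using diff'[of p l] that by (simp add: dist_norm norm_minus_commute)
      also have "\<dots> \<le> 3/2 * (1/3) ^ k"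
        using that by (simp add: power_decreasing)
      finally show ?thesis using k by simp
    qed
    then show "\<exists>M. \<forall>m\<ge>M. \<forall>n>m. dist (x m) (x n) < e" by blast
  qed
  then obtain z where z: "x \<longlonglongrightarrow> z"
    using Cauchy_convergent_iff convergent_def by blast
  have zk: "norm (z - x k) \<le> 3/2 * (1/3) ^ k" for k
  proof (rule LIMSEQ_le_const2)
    show "(\<lambda>l. norm (x l - x k)) \<longlonglongrightarrow> norm (z - x k)" by (intro tendsto_intros z)
    show "\<exists>N. \<forall>l\<ge>N. norm (x l - x k) \<le> 3/2 * (1/3) ^ k" using diff' by blast
  qed
  \<comment> \<open>The moves after step \<open>k\<close> add up to at most half of
    \<open>(1/3) ^ k\<close>, so of the share \<open>2/3\<close> gained in that step at least
    \<open>2/3 - 1/2 = 1/6\<close> survives, and \<open>4 ^ k\<close> beats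
    \<open>3 ^ k\<close>.\<close>
  have big: "norm (\<tau> k z) \<ge> (4/3) ^ k / 6" for k
  proof -
    interpret bounded_linear "\<tau> k" by (rule \<tau>)
    have "2/3 * onorm (\<tau> k) * (1/3) ^ k \<le> norm (\<tau> k (x (Suc k)))"
      using u(2)[of k] step1[of k "x k"] by (simp add: x_Suc)
    also have "\<dots> = norm (\<tau> k z - \<tau> k (z - x (Suc k)))" by (simp add: diff[symmetric])
    also have "\<dots> \<le> norm (\<tau> k z) + norm (\<tau> k (z - x (Suc k)))" by (rule norm_triangle_ineq4)
    also have "norm (\<tau> k (z - x (Suc k))) \<le> onorm (\<tau> k) * norm (z - x (Suc k))"
      by (rule onorm[OF \<tau>])
    also have "\<dots> \<le> onorm (\<tau> k) * (3/2 * (1/3) ^ Suc k)"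
      using pos[of k] zk[of "Suc k"] by (intro mult_left_mono) auto
    finally have "onorm (\<tau> k) * (1/3) ^ k / 6 \<le> norm (\<tau> k z)" by simp
    moreover have "4 ^ k * (1/3) ^ k / 6 \<le> onorm (\<tau> k) * (1/3) ^ k / (6::real)"
      using on[of k] by (intro divide_right_mono mult_right_mono) auto
    ultimately show ?thesis by (simp add: power_divide)
  qed
  obtain C where C: "\<And>k. norm (T k z) \<le> C"
    using bdd[of z] by (auto simp: bounded_iff)
  obtain k where "(4/3) ^ k > 6 * C" using real_arch_pow[of "4/3" "6 * C"] by auto
  with big[of k] C[of "n k"] show False by (simp add: \<tau>_def)
qed

section \<open>Quasi-contractive semigroups\<close>

lemma vector_derivative_bound_imp_lipschitz:
  fixes f :: "real \<Rightarrow> 'a::real_normed_vector"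
  assumes "\<And>t. t \<in> K \<Longrightarrow> (f has_vector_derivative f' t) (at t within K)" "convex K"
    and "\<And>t. t \<in> K \<Longrightarrow> norm (f' t) \<le> M" "M \<ge> 0"
  shows "M-lipschitz_on K f"
proof (rule bounded_derivative_imp_lipschitz)
  show "(f has_derivative (\<lambda>h. h *\<^sub>R f' t)) (at t within K)" if "t \<in> K" for t
    using assms(1)[OF that] by (simp add: has_vector_derivative_def)
  show "onorm (\<lambda>h. h *\<^sub>R f' t) \<le> M" if "t \<in> K" for t
  proof (rule onorm_bound)
    show "norm (x *\<^sub>R f' t) \<le> M * norm x" for x
      using assms(3)[OF that] by (simp add: mult.commute[of M] mult_left_mono)
  qed fact
qed fact+

lemma vector_derivative_right_limit:
  assumes "(F has_vector_derivative d) (at t within {0..})" "t \<ge> 0"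
  shows "((\<lambda>h. (F (t + h) - F t) /\<^sub>R h) \<longlongrightarrow> d) (at_right 0)"
proof (rule tendstoI)
  fix e :: real assume "e > 0"
  then obtain r where r: "r > 0"
    "\<And>s. s \<ge> 0 \<Longrightarrow> \<bar>s - t\<bar> < r \<Longrightarrow> norm (F s - F t - (s - t) *\<^sub>R d) \<le> e / 2 * \<bar>s - t\<bar>"
    using assms(1) unfolding has_vector_derivative_def has_derivative_within_alt real_norm_def
    by (meson atLeast_iff half_gt_zero)
  have "dist ((F (t + h) - F t) /\<^sub>R h) d < e" if "0 < h" "h < r" for h
  proof -
    have "(F (t + h) - F t) /\<^sub>R h - d = (F (t + h) - F t - h *\<^sub>R d) /\<^sub>R h"
      using that by (simp add: scaleR_diff_right)
    then have "dist ((F (t + h) - F t) /\<^sub>R h) d = norm (F (t + h) - F t - h *\<^sub>R d) / h"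
      using that by (simp add: dist_norm divide_inverse_commute)
    also have "\<dots> \<le> (e / 2 * h) / h"
      using r(2)[of "t + h"] that assms(2) by (intro divide_right_mono) auto
    also have "\<dots> < e" using that \<open>e > 0\<close> by simp
    finally show ?thesis .
  qed
  then show "\<forall>\<^sub>F h in at_right 0. dist ((F (t + h) - F t) /\<^sub>R h) d < e"
    using r(1) by (auto simp: eventually_at_right_field)
qed

lemma vector_derivative_shift:
  assumes "(F has_vector_derivative d) (at (t + h) within {0..})" "t \<ge> 0"
  shows "((\<lambda>s. F (t + s)) has_vector_derivative d) (at h within {0..})"
proof -
  have "((\<lambda>s. t + s) has_vector_derivative 1) (at h within {0..})"
    by (auto intro!: derivative_eq_intros)
  moreover have "(F has_vector_derivative d) (at (t + h) within (\<lambda>s. t + s) ` {0..})"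
    by (rule has_vector_derivative_within_subset[OF assms(1)]) (use assms(2) in auto)
  ultimately show ?thesis
    using vector_diff_chain_within[of "\<lambda>s. t + s" 1 h "{0..}" F d] by (simp add: o_def)
qed

lemma vector_derivative_unique_primitive:
  fixes F G :: "real \<Rightarrow> 'a::real_normed_vector"
  assumes "\<And>t. t \<ge> 0 \<Longrightarrow> (F has_vector_derivative f t) (at t within {0..})"
    and "\<And>t. t \<ge> 0 \<Longrightarrow> (G has_vector_derivative f t) (at t within {0..})"
    and "F 0 = G 0" "t \<ge> 0"
  shows "F t = G t"
proof -
  have "0-lipschitz_on {0..} (\<lambda>t. F t - G t)"
  proof (rule vector_derivative_bound_imp_lipschitz)
    show "((\<lambda>t. F t - G t) has_vector_derivative 0) (at s within {0..})" if "s \<in> {0..}" for s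
      using has_vector_derivative_diff[OF assms(1)[of s] assms(2)[of s]] that by simp
  qed auto
  from lipschitz_onD[OF this, of t 0] assms(3,4) show ?thesis by simp
qed

text \<open>\<open>\<omega> \<ge> 0\<close> is a normalisation: a growth rate may be enlarged to
  \<open>max \<omega> 0\<close>, and then \<open>exp (\<omega> * t)\<close> never decreases in
  \<open>t\<close>.\<close>

locale quasi_contractive_semigroup =
  fixes D :: "'a::{real_inner, complete_space} set" and A :: "'a \<Rightarrow> 'a"
    and S :: "real \<Rightarrow> 'a \<Rightarrow> 'a" and \<omega> :: real
  assumes generator: "generates D A S"
    and quasi_contractive: "x \<in> D \<Longrightarrow> inner (A x) x \<le> \<omega> * (norm x)\<^sup>2"
    and \<omega>_nonneg: "\<omega> \<ge> 0"
begin

section \<open>The generator as a linear operator\<close>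

lemma S_bounded_linear: "t \<ge> 0 \<Longrightarrow> bounded_linear (S t)"
  and S_0: "S 0 x = x"
  and S_add: "s \<ge> 0 \<Longrightarrow> t \<ge> 0 \<Longrightarrow> S (s + t) x = S s (S t x)"
  and S_right_continuous: "((\<lambda>t. S t x) \<longlongrightarrow> x) (at_right 0)"
  and D_eq: "D = {x. \<exists>z. ((\<lambda>h. (S h x - x) /\<^sub>R h) \<longlongrightarrow> z) (at_right 0)}"
  and A_limit: "x \<in> D \<Longrightarrow> ((\<lambda>h. (S h x - x) /\<^sub>R h) \<longlongrightarrow> A x) (at_right 0)"
  using generator by (auto simp: generates_def C0_semigroup_def)

lemma S_linear: "t \<ge> 0 \<Longrightarrow> linear (S t)"
  using S_bounded_linear bounded_linear.linear by blast

lemma A_eqI: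
  assumes "((\<lambda>h. (S h x - x) /\<^sub>R h) \<longlongrightarrow> z) (at_right 0)"
  shows "x \<in> D" "A x = z"
proof -
  show "x \<in> D" using assms by (auto simp: D_eq)
  then show "A x = z" using tendsto_unique[OF _ A_limit assms] by simp
qed

lemma eventually_at_right_nonneg: "\<forall>\<^sub>F h in at_right (0::real). h \<ge> 0"
  by (auto simp: eventually_at_right_field intro: exI[of _ 1])

text \<open>Difference quotients pass through \<open>T\<close>. It is applied to scalar multiples,
  to \<open>S t\<close> itself, to \<open>P\<close>, and to the maps \<open>R\<close> whose images
  of a solution evolve linearly.\<close>

lemma generator_bounded_linear_image:
  assumes T: "bounded_linear T" and comm: "\<And>t. t \<ge> 0 \<Longrightarrow> S t (T x) = T (S t x)" and x: "x \<in> D"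
  shows "T x \<in> D" "A (T x) = T (A x)"
proof -
  interpret bounded_linear T by fact
  have "((\<lambda>h. T ((S h x - x) /\<^sub>R h)) \<longlongrightarrow> T (A x)) (at_right 0)"
    by (intro tendsto A_limit x)
  moreover have "\<forall>\<^sub>F h in at_right 0. T ((S h x - x) /\<^sub>R h) = (S h (T x) - T x) /\<^sub>R h"
    by (rule eventually_mono[OF eventually_at_right_nonneg]) (simp add: comm scaleR diff)
  ultimately have "((\<lambda>h. (S h (T x) - T x) /\<^sub>R h) \<longlongrightarrow> T (A x)) (at_right 0)"
    by (rule Lim_transform_eventually)
  from A_eqI[OF this] show "T x \<in> D" "A (T x) = T (A x)" by auto
qed

lemma D_scaleR:
  assumes "x \<in> D"
  shows "c *\<^sub>R x \<in> D" "A (c *\<^sub>R x) = c *\<^sub>R A x"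
  using generator_bounded_linear_image[OF bounded_linear_scaleR_right[of c], of x] assms
    linear_scale[OF S_linear] by auto

lemma D_add:
  assumes "x \<in> D" "y \<in> D"
  shows "x + y \<in> D" "A (x + y) = A x + A y"
proof -
  have "((\<lambda>h. (S h x - x) /\<^sub>R h + (S h y - y) /\<^sub>R h) \<longlongrightarrow> A x + A y) (at_right 0)"
    by (intro tendsto_add A_limit assms)
  moreover have "\<forall>\<^sub>F h in at_right 0. (S h x - x) /\<^sub>R h + (S h y - y) /\<^sub>R h
      = (S h (x + y) - (x + y)) /\<^sub>R h"
    by (rule eventually_mono[OF eventually_at_right_nonneg])
      (simp add: linear_add[OF S_linear] algebra_simps)
  ultimately have "((\<lambda>h. (S h (x + y) - (x + y)) /\<^sub>R h) \<longlongrightarrow> A x + A y) (at_right 0)"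
    by (rule Lim_transform_eventually)
  from A_eqI[OF this] show "x + y \<in> D" "A (x + y) = A x + A y" by auto
qed

lemma D_diff:
  assumes "x \<in> D" "y \<in> D"
  shows "x - y \<in> D" "A (x - y) = A x - A y"
  using D_add[OF assms(1) D_scaleR(1)[OF assms(2), of "-1"]] D_scaleR[OF assms(2), of "-1"] by auto

section \<open>Strong continuity and integrated orbits\<close>

lemma S_locally_bounded: "\<exists>M \<ge> 1. \<exists>\<delta> > 0. \<forall>t \<in> {0..\<delta>}. \<forall>x. norm (S t x) \<le> M * norm x"
\<comment> \<open>Failure gives times \<open>t n\<close> tending to 0 with unbounded operator norms,
  while continuity at 0 keeps every sequence \<open>S (t n) x\<close> bounded; uniform boundedness
  excludes this.\<close>
proof (rule ccontr)
  assume contr: "\<not> ?thesis"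
  have "\<exists>t. t \<ge> 0 \<and> t \<le> inverse (real (Suc n)) \<and> (\<exists>x. norm (S t x) > real (Suc n) * norm x)" for n
  proof -
    have "real (Suc n) \<ge> 1" "inverse (real (Suc n)) > 0" by auto
    with contr obtain t x where "t \<in> {0..inverse (real (Suc n))}" "\<not> norm (S t x) \<le> real (Suc n) * norm x"
      by meson
    then show ?thesis by (auto simp: not_le)
  qed
  then obtain t where t: "\<And>n. t n \<ge> 0" "\<And>n. t n \<le> inverse (real (Suc n))"
    "\<And>n. \<exists>x. norm (S (t n) x) > real (Suc n) * norm x" by metis
  \<comment> \<open>\<open>S 0\<close> is the identity and the factor \<open>real (Suc n)\<close> is
    at least 1, so the offending times are positive and approach 0 from the right, where continuity
    is assumed.\<close>
  have tpos: "t n > 0" for n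
  proof -
    obtain x where "norm (S (t n) x) > real (Suc n) * norm x" using t(3) by blast
    moreover have "real (Suc n) * norm x \<ge> norm x" by (simp add: mult_le_cancel_right1)
    ultimately have "t n \<noteq> 0" using S_0[of x] by auto
    then show ?thesis using t(1)[of n] by simp
  qed
  have "t \<longlonglongrightarrow> 0"
    by (rule tendsto_sandwich[OF _ _ tendsto_const LIMSEQ_inverse_real_of_nat]) (use t in auto)
  then have lim: "filterlim t (at_right 0) sequentially"
    using tpos by (intro tendsto_imp_filterlim_at_right) auto
  have "bounded (range (\<lambda>n. S (t n) x))" for x
  proof -
    have "(\<lambda>n. S (t n) x) \<longlonglongrightarrow> x"
      by (rule filterlim_compose[OF S_right_continuous lim])
    then show ?thesis using convergent_imp_bounded by blast
  qed
  then obtain M where M: "\<And>n. onorm (S (t n)) \<le> M"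
    using uniform_boundedness_sequence[of "\<lambda>n. S (t n)"] S_bounded_linear t(1) by metis
  obtain n where n: "real n \<ge> M" using real_arch_simple by blast
  obtain x where x: "norm (S (t n) x) > real (Suc n) * norm x" using t(3) by blast
  have "norm (S (t n) x) \<le> onorm (S (t n)) * norm x"
    by (rule onorm) (use S_bounded_linear t(1) in auto)
  also have "\<dots> \<le> real (Suc n) * norm x"
    using M[of n] n by (intro mult_right_mono) auto
  finally show False using x by simp
qed

lemma S_bounded_on_interval: "\<exists>M \<ge> 1. \<forall>t \<in> {0..T}. \<forall>x. norm (S t x) \<le> M * norm x"
proof -
  obtain M \<delta> where M: "M \<ge> 1" "\<delta> > 0" "\<And>t x. 0 \<le> t \<Longrightarrow> t \<le> \<delta> \<Longrightarrow> norm (S t x) \<le> M * norm x"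
    using S_locally_bounded by auto
  have *: "norm (S t x) \<le> M ^ n * norm x" if "0 \<le> t" "t \<le> real n * \<delta>" for n t x
    using that
  proof (induction n arbitrary: t x)
    case 0
    then show ?case using S_0 by simp
  next
    case (Suc n)
    show ?case
    proof (cases "t \<le> \<delta>")
      case True
      have "norm (S t x) \<le> M * norm x" using M(3) Suc(2) True by blast
      also have "\<dots> \<le> M ^ Suc n * norm x"
        using M(1) by (intro mult_right_mono self_le_power) auto
      finally show ?thesis .
    next
      case False
      have "S t x = S \<delta> (S (t - \<delta>) x)" using S_add[of \<delta> "t - \<delta>" x] False M(2) by simp
      also have "norm \<dots> \<le> M * norm (S (t - \<delta>) x)" using M(2,3) by simp
      also have "\<dots> \<le> M * (M ^ n * norm x)"
        using Suc False M(1) by (intro mult_left_mono Suc.IH) (auto simp: algebra_simps)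
      finally show ?thesis by simp
    qed
  qed
  obtain n where "real n > T / \<delta>" using reals_Archimedean2 by blast
  then have "T \<le> real n * \<delta>" using M(2) by (simp add: field_simps)
  then have "\<forall>t \<in> {0..T}. \<forall>x. norm (S t x) \<le> M ^ n * norm x" using * by auto
  then show ?thesis using M(1) one_le_power by blast
qed

lemma S_continuous: "continuous_on {0..} (\<lambda>t. S t x)"
proof -
  have "\<exists>d>0. \<forall>s\<in>{0..}. dist s t < d \<longrightarrow> dist (S s x) (S t x) < e" if "t \<ge> 0" "e > 0" for t e
  proof -
    obtain M where M: "M \<ge> 1" "\<And>s y. 0 \<le> s \<Longrightarrow> s \<le> t + 1 \<Longrightarrow> norm (S s y) \<le> M * norm y"
      using S_bounded_on_interval[of "t + 1"] by auto
    have "\<forall>\<^sub>F h in at_right 0. dist (S h x) x < e / M"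
      using S_right_continuous that(2) M(1) by (intro tendstoD) auto
    then obtain d where d: "d > 0" "\<And>h. 0 < h \<Longrightarrow> h < d \<Longrightarrow> dist (S h x) x < e / M"
      by (auto simp: eventually_at_right_field)
    \<comment> \<open>The increment is factored at the earlier of the two times. Only a bound on
      \<open>S u\<close> and smallness of \<open>v - u\<close> enter, so right continuity at 0
      yields continuity from both sides.\<close>
    have key: "dist (S v x) (S u x) < e" if "0 \<le> u" "u \<le> v" "u \<le> t + 1" "v - u < d" for u v
    proof (cases "u = v")
      case False
      have "S v x - S u x = S u (S (v - u) x - x)"
        using S_add[of u "v - u" x] linear_diff[OF S_linear] that by simp
      then have "dist (S v x) (S u x) \<le> M * dist (S (v - u) x) x"
        using M(2)[OF that(1,3)] by (simp add: dist_norm)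
      also have "\<dots> < M * (e / M)"
        using M(1) d(2)[of "v - u"] that False by (intro mult_strict_left_mono) auto
      finally show ?thesis using M(1) by simp
    qed (use \<open>e > 0\<close> in simp)
    have "dist (S s x) (S t x) < e" if "s \<ge> 0" "dist s t < min d 1" for s
      using key[of s t] key[of t s] that \<open>t \<ge> 0\<close> by (cases "s \<le> t") (auto simp: dist_real_def dist_commute)
    then show ?thesis using d(1) by (intro exI[of _ "min d 1"]) auto
  qed
  then show ?thesis by (auto simp: continuous_on_iff)
qed

text \<open>\<open>J t x\<close> is the integral of \<open>S s x\<close> over \<open>0 \<le> s \<le> t\<close>.\<close>

definition J :: "real \<Rightarrow> 'a \<Rightarrow> 'a" where
  "J t x = (SOME F. F 0 = 0 \<and> (\<forall>t\<ge>0. (F has_vector_derivative S t x) (at t within {0..}))) t"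

lemma J_0: "J 0 x = 0"
  and J_deriv: "t \<ge> 0 \<Longrightarrow> ((\<lambda>t. J t x) has_vector_derivative S t x) (at t within {0..})"
proof -
  define Q where "Q = (\<lambda>F. F 0 = 0 \<and> (\<forall>t\<ge>0. (F has_vector_derivative S t x) (at t within {0..})))"
  obtain F where "Q F"
    using antiderivative_exists[OF S_continuous[of x]] unfolding Q_def by metis
  then have "Q (Eps Q)" by (rule someI[of Q])
  moreover have "(\<lambda>t. J t x) = Eps Q" by (simp add: J_def Q_def)
  ultimately have "Q (\<lambda>t. J t x)" by simp
  then show "J 0 x = 0" "t \<ge> 0 \<Longrightarrow> ((\<lambda>t. J t x) has_vector_derivative S t x) (at t within {0..})"
    unfolding Q_def by blast+
qed

text \<open>As functions of \<open>h\<close>, all three expressions vanish at 0 and are primitives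
  of \<open>S (t + h) x\<close>.\<close>

lemma J_shift:
  assumes "t \<ge> 0" "h \<ge> 0"
  shows "S t (J h x) = J (t + h) x - J t x" "J h (S t x) = J (t + h) x - J t x"
proof -
  have 1: "((\<lambda>s. J (t + s) x - J t x) has_vector_derivative S (t + r) x) (at r within {0..})"
    if "r \<ge> 0" for r
    using has_vector_derivative_diff_const[of "\<lambda>s. J (t + s) x" "J t x"]
      vector_derivative_shift[OF J_deriv assms(1), of r x] that assms(1) by simp
  have 2: "((\<lambda>s. S t (J s x)) has_vector_derivative S (t + r) x) (at r within {0..})" if "r \<ge> 0" for r
    using bounded_linear.has_vector_derivative[OF S_bounded_linear[OF assms(1)] J_deriv[OF that]]
      S_add[OF assms(1) that] by simp
  have 3: "((\<lambda>s. J s (S t x)) has_vector_derivative S (t + r) x) (at r within {0..})" if "r \<ge> 0" for r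
    using J_deriv[OF that, of "S t x"] S_add[OF that assms(1)] by (simp add: add.commute)
  show "S t (J h x) = J (t + h) x - J t x"
    by (rule vector_derivative_unique_primitive[OF 2 1 _ assms(2)])
      (simp_all add: J_0 linear_0[OF S_linear[OF assms(1)]])
  show "J h (S t x) = J (t + h) x - J t x"
    by (rule vector_derivative_unique_primitive[OF 3 1 _ assms(2)]) (simp_all add: J_0)
qed

text \<open>By \<open>J_shift\<close>, \<open>S h (J t x) - J t x\<close> is the increment of the
  primitive at \<open>t\<close> minus its increment at 0; dividing by \<open>h\<close> leaves two
  ordinary right derivatives.\<close>

lemma J_in_D:
  assumes "t \<ge> 0"
  shows "J t x \<in> D" "A (J t x) = S t x - x"
proof -
  have "((\<lambda>h. (J (t + h) x - J t x) /\<^sub>R h - (J (0 + h) x - J 0 x) /\<^sub>R h) \<longlongrightarrow> S t x - S 0 x) (at_right 0)"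
    by (intro tendsto_diff vector_derivative_right_limit J_deriv assms order_refl)
  moreover have "\<forall>\<^sub>F h in at_right 0. (J (t + h) x - J t x) /\<^sub>R h - (J (0 + h) x - J 0 x) /\<^sub>R h
     = (S h (J t x) - J t x) /\<^sub>R h"
    by (rule eventually_mono[OF eventually_at_right_nonneg])
      (simp add: J_shift(1)[OF _ assms] J_0 add.commute scaleR_diff_right)
  ultimately have "((\<lambda>h. (S h (J t x) - J t x) /\<^sub>R h) \<longlongrightarrow> S t x - S 0 x) (at_right 0)"
    by (rule Lim_transform_eventually)
  from A_eqI[OF this] show "J t x \<in> D" "A (J t x) = S t x - x" by (auto simp: S_0)
qed

text \<open>Orbit averages over \<open>[0, h]\<close>. They replace \<open>D\<close> as the dense
  set of regular initial states because their orbits are explicit in \<open>J\<close>.\<close>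

definition smooth_vectors :: "'a set" where
  "smooth_vectors = {z. \<exists>h>0. \<exists>x. z = J h x /\<^sub>R h}"

lemma smooth_vectors_dense: "e > 0 \<Longrightarrow> \<exists>z\<in>smooth_vectors. norm (z - x) < e"
proof -
  assume "e > 0"
  have "((\<lambda>h. (J (0 + h) x - J 0 x) /\<^sub>R h) \<longlongrightarrow> S 0 x) (at_right 0)"
    by (intro vector_derivative_right_limit J_deriv order_refl)
  then have "((\<lambda>h. J h x /\<^sub>R h) \<longlongrightarrow> x) (at_right 0)"
    by (simp add: J_0 S_0)
  then have "\<forall>\<^sub>F h in at_right 0. dist (J h x /\<^sub>R h) x < e"
    using \<open>e > 0\<close> by (rule tendstoD)
  then obtain d where "d > 0" "\<And>h. 0 < h \<Longrightarrow> h < d \<Longrightarrow> dist (J h x /\<^sub>R h) x < e"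
    by (auto simp: eventually_at_right_field)
  from this(2)[of "d/2"] this(1) have "d/2 > 0" "norm (J (d/2) x /\<^sub>R (d/2) - x) < e"
    by (auto simp: dist_norm)
  then show ?thesis unfolding smooth_vectors_def by blast
qed

lemma smooth_vectors_dense_sequence: "\<exists>z. (\<forall>n. z n \<in> smooth_vectors) \<and> z \<longlonglongrightarrow> x"
proof -
  have "\<exists>z. z \<in> smooth_vectors \<and> norm (z - x) < inverse (real (Suc n))" for n
    using smooth_vectors_dense[of "inverse (real (Suc n))" x] by auto
  then obtain z where z: "\<And>n. z n \<in> smooth_vectors" "\<And>n. norm (z n - x) < inverse (real (Suc n))"
    by metis
  have "(\<lambda>n. z n - x) \<longlonglongrightarrow> 0"
    by (rule Lim_null_comparison[OF _ LIMSEQ_inverse_real_of_nat])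
      (intro always_eventually allI less_imp_le z(2))
  then have "z \<longlonglongrightarrow> x" by (rule LIM_zero_cancel)
  then show ?thesis using z(1) by blast
qed

text \<open>The orbit has two descriptions: as a difference of values of \<open>J\<close> at fixed
  \<open>x\<close> it can be differentiated in \<open>t\<close>, and as \<open>J h (S t x)\<close>
  up to scaling it lies in \<open>D\<close> with a known image under \<open>A\<close>.\<close>

lemma smooth_orbit:
  assumes "z \<in> smooth_vectors" "t \<ge> 0"
  shows "S t z \<in> D" "((\<lambda>t. S t z) has_vector_derivative A (S t z)) (at t within {0..})"
proof -
  obtain h x where hx: "h > 0" "z = J h x /\<^sub>R h" using assms(1) by (auto simp: smooth_vectors_def)
  have Sz: "S s z = (J (h + s) x - J s x) /\<^sub>R h" if "s \<ge> 0" for s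
    using J_shift(1)[OF that, of h x] hx linear_scale[OF S_linear[OF that]] by (simp add: add.commute)
  have SzJ: "S t z = J h (S t x) /\<^sub>R h"
    using J_shift[OF assms(2), of h x] hx Sz[OF assms(2)] by (simp add: add.commute)
  show "S t z \<in> D" unfolding SzJ by (intro D_scaleR J_in_D) (use hx in simp)
  have "A (S t z) = (S h (S t x) - S t x) /\<^sub>R h"
    unfolding SzJ using D_scaleR(2)[OF J_in_D(1)] J_in_D(2) hx by simp
  then have Az: "A (S t z) = (S (h + t) x - S t x) /\<^sub>R h"
    using S_add[of h t x] hx assms(2) by simp
  have "((\<lambda>s. (J (h + s) x - J s x) /\<^sub>R h) has_vector_derivative A (S t z)) (at t within {0..})"
    unfolding Az
    by (intro bounded_linear.has_vector_derivative[OF bounded_linear_scaleR_right]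
        has_vector_derivative_diff vector_derivative_shift J_deriv) (use hx assms in auto)
  then show "((\<lambda>t. S t z) has_vector_derivative A (S t z)) (at t within {0..})"
    by (rule has_vector_derivative_transform[rotated 2]) (use assms Sz in auto)
qed

lemma smooth_vectors_D: "z \<in> smooth_vectors \<Longrightarrow> z \<in> D"
  using smooth_orbit(1)[of z 0] by (simp add: S_0)

text \<open>The velocity \<open>A (S t z)\<close> equals \<open>S t (A z)\<close>, hence is bounded
  on \<open>[0, T]\<close>. This makes linear orbits admissible comparison curves in the energy
  inequality.\<close>

lemma smooth_orbit_lipschitz:
  assumes "z \<in> smooth_vectors"
  shows "\<exists>L. L-lipschitz_on {0..T} (\<lambda>t. S t z)"
proof -
  obtain h x where hx: "h > 0" "z = J h x /\<^sub>R h" using assms(1) by (auto simp: smooth_vectors_def)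
  have A: "A (S t z) = S t (A z)" if "t \<ge> 0" for t
    by (rule generator_bounded_linear_image(2)[OF S_bounded_linear[OF that] _ smooth_vectors_D[OF assms]])
      (simp add: S_add[symmetric] that add.commute)
  obtain M where M: "M \<ge> 1" "\<And>s y. 0 \<le> s \<Longrightarrow> s \<le> T \<Longrightarrow> norm (S s y) \<le> M * norm y"
    using S_bounded_on_interval[of T] by auto
  have "(M * norm (A z))-lipschitz_on {0..T} (\<lambda>t. S t z)"
  proof (rule vector_derivative_bound_imp_lipschitz)
    show "((\<lambda>t. S t z) has_vector_derivative A (S t z)) (at t within {0..T})" if "t \<in> {0..T}" for t
      by (rule has_vector_derivative_within_subset[OF smooth_orbit(2)[OF assms]]) (use that in auto)
  qed (use M A in auto)
  then show ?thesis by blast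
qed

text \<open>The weight \<open>exp (- 2 * \<omega> * t)\<close> turns quasi-dissipativity of
  \<open>A\<close> into monotonicity of the squared norm; \<open>S_norm\<close> then follows by
  density.\<close>

lemma S_norm_smooth:
  assumes z: "z \<in> smooth_vectors" and t: "t \<ge> 0"
  shows "norm (S t z) \<le> exp (\<omega> * t) * norm z"
proof -
  define f where "f = (\<lambda>t. exp (- 2 * \<omega> * t) * inner (S t z) (S t z))"
  have "f t \<le> f 0"
  proof (rule DERIV_nonpos_imp_decreasing_open[OF t])
    fix s assume s: "0 < s" "s < t"
    have "at s within {0..} = at s"
      using s by (intro at_within_interior) auto
    then have d: "((\<lambda>t. S t z) has_vector_derivative A (S s z)) (at s)"
      using smooth_orbit(2)[OF z, of s] s by simp
    have "(f has_real_derivative exp (- 2 * \<omega> * s) * (inner (S s z) (A (S s z)) + inner (A (S s z)) (S s z))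
        + (exp (- 2 * \<omega> * s) * (- 2 * \<omega>)) * inner (S s z) (S s z)) (at s)"
      unfolding f_def has_real_derivative_iff_has_vector_derivative
      by (rule has_vector_derivative_mult[OF _ bounded_bilinear.has_vector_derivative[OF bounded_bilinear_inner d d]])
        (auto intro!: derivative_eq_intros simp flip: has_real_derivative_iff_has_vector_derivative)
    moreover have "exp (- 2 * \<omega> * s) * (inner (S s z) (A (S s z)) + inner (A (S s z)) (S s z))
        + (exp (- 2 * \<omega> * s) * (- 2 * \<omega>)) * inner (S s z) (S s z)
        = exp (- 2 * \<omega> * s) * (2 * (inner (A (S s z)) (S s z) - \<omega> * (norm (S s z))\<^sup>2))"
      by (simp add: inner_commute power2_norm_eq_inner algebra_simps)
    moreover have "\<dots> \<le> 0"
      using quasi_contractive[OF smooth_orbit(1)[OF z, of s]] s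
      by (intro mult_nonneg_nonpos) auto
    ultimately show "\<exists>y. (f has_real_derivative y) (at s) \<and> y \<le> 0" by auto
  next
    show "continuous_on {0..t} f"
      unfolding f_def by (intro continuous_intros continuous_on_subset[OF S_continuous]) auto
  qed
  then have "exp (- 2 * \<omega> * t) * (norm (S t z))\<^sup>2 \<le> (norm z)\<^sup>2"
    by (simp add: f_def S_0 power2_norm_eq_inner)
  then have "exp (2 * \<omega> * t) * (exp (- 2 * \<omega> * t) * (norm (S t z))\<^sup>2) \<le> exp (2 * \<omega> * t) * (norm z)\<^sup>2"
    by (intro mult_left_mono) auto
  also have "exp (2 * \<omega> * t) * (exp (- 2 * \<omega> * t) * (norm (S t z))\<^sup>2) = (norm (S t z))\<^sup>2"
    by (simp add: mult.assoc[symmetric] exp_add[symmetric])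
  also have "exp (2 * \<omega> * t) * (norm z)\<^sup>2 = (exp (\<omega> * t) * norm z)\<^sup>2"
    by (simp add: power_mult_distrib power2_eq_square exp_add[symmetric])
  finally show ?thesis by (rule power2_le_imp_le) simp
qed

lemma S_norm:
  assumes t: "t \<ge> 0"
  shows "norm (S t x) \<le> exp (\<omega> * t) * norm x"
proof -
  obtain z where z: "\<And>n. z n \<in> smooth_vectors" and zx: "z \<longlonglongrightarrow> x"
    using smooth_vectors_dense_sequence by blast
  show ?thesis
  proof (rule LIMSEQ_le)
    show "(\<lambda>n. norm (S t (z n))) \<longlonglongrightarrow> norm (S t x)"
      by (intro tendsto_norm bounded_linear.tendsto[OF S_bounded_linear[OF t]] zx)
    show "(\<lambda>n. exp (\<omega> * t) * norm (z n)) \<longlonglongrightarrow> exp (\<omega> * t) * norm x"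
      by (intro tendsto_intros zx)
    show "\<exists>N. \<forall>n\<ge>N. norm (S t (z n)) \<le> exp (\<omega> * t) * norm (z n)"
      using S_norm_smooth[OF z t] by blast
  qed
qed

lemma J_lipschitz:
  assumes "t \<ge> 0"
  shows "(exp (\<omega> * t) * norm x)-lipschitz_on {0..t} (\<lambda>t. J t x)"
proof (rule vector_derivative_bound_imp_lipschitz)
  show "((\<lambda>t. J t x) has_vector_derivative S s x) (at s within {0..t})" if "s \<in> {0..t}" for s
    by (rule has_vector_derivative_within_subset[OF J_deriv]) (use that in auto)
  show "norm (S s x) \<le> exp (\<omega> * t) * norm x" if "s \<in> {0..t}" for s
  proof -
    have "norm (S s x) \<le> exp (\<omega> * s) * norm x" by (rule S_norm) (use that in auto)
    also have "\<dots> \<le> exp (\<omega> * t) * norm x"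
      using that \<omega>_nonneg by (intro mult_right_mono) (auto intro: mult_left_mono)
    finally show ?thesis .
  qed
qed auto

lemma J_norm: "t \<ge> 0 \<Longrightarrow> norm (J t x) \<le> exp (\<omega> * t) * norm x * t"
  using lipschitz_onD[OF J_lipschitz, of t t 0 x] by (simp add: J_0)

end

section \<open>Integral inequalities\<close>

text \<open>Reduces the vector-valued forcing to one real integrable function. Norms of the simple
  functions are measurable, so their limit is; where convergence fails, and outside
  \<open>(0, T)\<close>, \<open>g\<close> is 0.\<close>

lemma L1_fun_integrable_norm:
  fixes f :: "real \<Rightarrow> 'a::real_normed_vector"
  assumes f: "L1_fun T f"
  obtains g N where "negligible N" "\<And>t. t \<in> {0<..<T} - N \<Longrightarrow> g t = norm (f t)"
    "\<And>t. g t \<ge> 0" "(g has_integral enn2real (L1_norm T f)) UNIV"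
proof -
  obtain s where s: "\<And>n. simple_function lebesgue (s n)"
      "AE t in lebesgue. t \<in> {0<..<T} \<longrightarrow> (\<lambda>n::nat. s n t) \<longlonglongrightarrow> f t"
    and fin: "L1_norm T f < \<infinity>"
    using f unfolding L1_fun_def by blast
  obtain N where N: "N \<in> null_sets lebesgue" "\<And>t. t \<in> {0<..<T} - N \<Longrightarrow> (\<lambda>n. s n t) \<longlonglongrightarrow> f t"
    using s(2) unfolding eventually_ae_filter by auto
  define X where "X = {0<..<T} - N"
  have X: "X \<in> sets lebesgue" using N(1) by (auto simp: X_def)
  define g where "g = (\<lambda>t. indicator X t * norm (f t))"
  have "(\<lambda>t. indicator X t * norm (s n t)) \<in> borel_measurable lebesgue" for n
  proof -
    have "(\<lambda>t. norm (s n t)) \<in> borel_measurable lebesgue"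
      using simple_function_compose1[OF s(1)[of n], of norm] by (rule borel_measurable_simple_function)
    then show ?thesis using X by (intro borel_measurable_times borel_measurable_indicator)
  qed
  then have "g \<in> borel_measurable lebesgue"
  proof (rule borel_measurable_LIMSEQ_real[rotated])
    show "(\<lambda>n. indicator X t * norm (s n t)) \<longlonglongrightarrow> g t" for t
      unfolding g_def
      by (cases "t \<in> X") (auto intro!: tendsto_norm N(2) simp: X_def)
  qed
  moreover have "(\<integral>\<^sup>+ t. ennreal (g t) \<partial>lebesgue) = L1_norm T f"
    unfolding L1_norm_def
    by (rule nn_integral_cong_AE, rule AE_I'[OF N(1)])
      (auto simp: g_def X_def indicator_def)
  ultimately have "(g has_integral enn2real (L1_norm T f)) UNIV"
    using fin by (subst has_integral_iff_nn_integral_lebesgue) (auto simp: g_def)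
  then show thesis
    using N(1) by (intro that[of N g]) (auto simp: g_def X_def negligible_iff_null_sets)
qed

text \<open>Absolute continuity is available only on compact parts of the open interval, so the
  bound is proved on \<open>[r, u]\<close> with \<open>a < r\<close> and \<open>u < T\<close>, and
  continuity carries it to the end points. Two forcing terms are allowed because two perturbed
  solutions will be compared.\<close>

lemma L1_differential_inequality:
  fixes h :: "real \<Rightarrow> real" and f1 f2 :: "real \<Rightarrow> 'a::real_normed_vector"
  assumes a: "0 \<le> a" and cont: "continuous_on {a..T} h"
    and ac: "\<And>r u. a < r \<Longrightarrow> r \<le> u \<Longrightarrow> u < T \<Longrightarrow> abs_continuous_on {r..u} h"
    and der: "AE t in lebesgue. t \<in> {a<..<T} \<longrightarrow>
      (\<exists>d. (h has_real_derivative d) (at t) \<and> d \<le> C * (norm (f1 t) + norm (f2 t)) + k)"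
    and f: "L1_fun T f1" "L1_fun T f2" and C: "C \<ge> 0" and st: "a \<le> s" "s \<le> t" "t \<le> T"
  shows "h t - h s \<le> C * (enn2real (L1_norm T f1) + enn2real (L1_norm T f2)) + k * (t - s)"
proof -
  define I where "I = C * (enn2real (L1_norm T f1) + enn2real (L1_norm T f2))"
  obtain g1 N1 where g1: "negligible N1" "\<And>t. t \<in> {0<..<T} - N1 \<Longrightarrow> g1 t = norm (f1 t)"
    "\<And>t. g1 t \<ge> 0" "(g1 has_integral enn2real (L1_norm T f1)) UNIV"
    using L1_fun_integrable_norm[OF f(1)] by metis
  obtain g2 N2 where g2: "negligible N2" "\<And>t. t \<in> {0<..<T} - N2 \<Longrightarrow> g2 t = norm (f2 t)"
    "\<And>t. g2 t \<ge> 0" "(g2 has_integral enn2real (L1_norm T f2)) UNIV"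
    using L1_fun_integrable_norm[OF f(2)] by metis
  obtain N3 where N3: "N3 \<in> null_sets lebesgue" "\<And>t. t \<in> {a<..<T} - N3 \<Longrightarrow>
      (\<exists>d. (h has_real_derivative d) (at t) \<and> d \<le> C * (norm (f1 t) + norm (f2 t)) + k)"
  proof -
    obtain N where "N \<in> null_sets lebesgue" "{t \<in> space lebesgue. \<not> (t \<in> {a<..<T} \<longrightarrow>
      (\<exists>d. (h has_real_derivative d) (at t) \<and> d \<le> C * (norm (f1 t) + norm (f2 t)) + k))} \<subseteq> N"
      using der unfolding eventually_ae_filter by blast
    then show thesis by (intro that[of N]) auto
  qed
  have inner_bound: "h u - h r - k * (u - r) \<le> I" if "a < r" "r \<le> u" "u < T" for r u
  proof -
    define g where "g = (\<lambda>t. C * (g1 t + g2 t) + k)"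
    have i1: "g1 integrable_on {r..u}" and i2: "g2 integrable_on {r..u}"
      using integrable_on_subcbox[of _ UNIV r u] g1(4) g2(4) by (auto simp: integrable_on_def)
    have l1: "integral {r..u} g1 \<le> enn2real (L1_norm T f1)"
      using integral_subset_le[of "{r..u}" UNIV g1] i1 g1(3,4)
      by (auto simp: integral_unique integrable_on_def)
    have l2: "integral {r..u} g2 \<le> enn2real (L1_norm T f2)"
      using integral_subset_le[of "{r..u}" UNIV g2] i2 g2(3,4)
      by (auto simp: integral_unique integrable_on_def)
    have "(g has_integral C * (integral {r..u} g1 + integral {r..u} g2) + k * (u - r)) {r..u}"
      unfolding g_def
      using has_integral_add[OF has_integral_mult_right[OF has_integral_add[OF
            integrable_integral[OF i1] integrable_integral[OF i2]], of C]
          has_integral_const_real[of k r u]] that(2)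
      by (simp add: mult.commute)
    then have g: "g integrable_on {r..u}"
      "integral {r..u} g = C * (integral {r..u} g1 + integral {r..u} g2) + k * (u - r)"
      by (auto simp: integrable_on_def integral_unique)
    have "h u - h r \<le> integral {r..u} g"
    proof (rule abs_continuous_on_FTC_le[OF that(2) ac[OF that] _ _ g(1)])
      show "negligible (N1 \<union> N2 \<union> N3)"
        using g1(1) g2(1) N3(1) by (auto simp: negligible_iff_null_sets)
      show "\<exists>d. (h has_real_derivative d) (at t within {r..u}) \<and> d \<le> g t"
        if "t \<in> {r..u} - (N1 \<union> N2 \<union> N3)" for t
      proof -
        have t: "t \<in> {a<..<T} - N3" "t \<in> {0<..<T} - N1" "t \<in> {0<..<T} - N2"
          using that \<open>a < r\<close> \<open>u < T\<close> a by auto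
        obtain d where d: "(h has_real_derivative d) (at t)" "d \<le> C * (norm (f1 t) + norm (f2 t)) + k"
          using N3(2)[OF t(1)] by blast
        show ?thesis
          using d g1(2)[OF t(2)] g2(2)[OF t(3)]
          by (intro exI[of _ d]) (auto simp: g_def intro: has_field_derivative_at_within)
      qed
    qed
    also have "\<dots> \<le> I + k * (u - r)"
      unfolding g(2) I_def using l1 l2 C by (auto intro!: mult_left_mono)
    finally show ?thesis by simp
  qed
  show ?thesis
  proof (cases "s = t")
    case True
    then show ?thesis using C by (simp add: I_def)
  next
    case False
    \<comment> \<open>The interval shrinks by \<open>\<eta> n\<close> at each end; starting from
      half the length keeps \<open>s + \<eta> n \<le> t - \<eta> n\<close>.\<close>
    define \<eta> where "\<eta> = (\<lambda>n. (t - s) / 2 * inverse (real (Suc n)))"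
    have \<eta>: "\<eta> n > 0" "2 * \<eta> n \<le> t - s" for n
    proof -
      show "\<eta> n > 0" using False st(2) by (simp add: \<eta>_def)
      have "inverse (real (Suc n)) \<le> 1" by (simp add: inverse_le_1_iff)
      then show "2 * \<eta> n \<le> t - s"
        using st(2) mult_left_le[of "inverse (real (Suc n))" "(t - s) / 2"] by (simp add: \<eta>_def)
    qed
    have lim: "\<eta> \<longlonglongrightarrow> 0"
      using tendsto_mult_right_zero[OF LIMSEQ_inverse_real_of_nat] unfolding \<eta>_def by blast
    have mem: "a \<le> t - \<eta> n" "t - \<eta> n \<le> T" "a \<le> s + \<eta> n" "s + \<eta> n \<le> T" for n
    proof -
      show "a \<le> t - \<eta> n" "t - \<eta> n \<le> T" "a \<le> s + \<eta> n" "s + \<eta> n \<le> T"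
        using \<eta>[of n] st by - (linarith+)
    qed
    have "(\<lambda>n. h (t - \<eta> n)) \<longlonglongrightarrow> h t"
    proof (rule continuous_on_tendsto_compose[OF cont])
      show "(\<lambda>n. t - \<eta> n) \<longlonglongrightarrow> t" using tendsto_diff[OF tendsto_const lim, of t] by simp
    qed (use st mem in \<open>auto intro!: always_eventually\<close>)
    moreover have "(\<lambda>n. h (s + \<eta> n)) \<longlonglongrightarrow> h s"
    proof (rule continuous_on_tendsto_compose[OF cont])
      show "(\<lambda>n. s + \<eta> n) \<longlonglongrightarrow> s" using tendsto_add[OF tendsto_const lim, of s] by simp
    qed (use st mem in \<open>auto intro!: always_eventually\<close>)
    ultimately have "(\<lambda>n. h (t - \<eta> n) - h (s + \<eta> n) - k * ((t - \<eta> n) - (s + \<eta> n)))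
        \<longlonglongrightarrow> h t - h s - k * ((t - 0) - (s + 0))"
      by (intro tendsto_intros lim)
    then have "h t - h s - k * ((t - 0) - (s + 0)) \<le> I"
    proof (rule LIMSEQ_le_const2)
      have "h (t - \<eta> n) - h (s + \<eta> n) - k * ((t - \<eta> n) - (s + \<eta> n)) \<le> I" for n
        by (rule inner_bound) (use \<eta>[of n] st in linarith)+
      then show "\<exists>N. \<forall>n\<ge>N. h (t - \<eta> n) - h (s + \<eta> n) - k * ((t - \<eta> n) - (s + \<eta> n)) \<le> I"
        by blast
    qed
    then show ?thesis by (simp add: I_def)
  qed
qed

lemma L1_energy_inequality:
  fixes v f1 f2 :: "real \<Rightarrow> 'a::real_inner"
  assumes s: "0 \<le> s" "s \<le> t" "t \<le> T" and cont: "continuous_on {s..T} v"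
    and ac: "\<And>r u. s < r \<Longrightarrow> r \<le> u \<Longrightarrow> u < T \<Longrightarrow> abs_continuous_on {r..u} v"
    and der: "AE t in lebesgue. t \<in> {s<..<T} \<longrightarrow> (\<exists>d. (v has_vector_derivative d) (at t) \<and>
      inner d (v t) \<le> c * (norm (v t))\<^sup>2 + C * (norm (f1 t) + norm (f2 t)) + k)"
    and f: "L1_fun T f1" "L1_fun T f2" and C: "C \<ge> 0" "c \<ge> 0" "k \<ge> 0"
  shows "(norm (v t))\<^sup>2 \<le> exp (2 * c * (t - s)) * ((norm (v s))\<^sup>2 +
           2 * C * (enn2real (L1_norm T f1) + enn2real (L1_norm T f2)) + 2 * k * (t - s))"
proof -
  define h where "h = (\<lambda>r. exp (- 2 * c * (r - s)) * inner (v r) (v r))"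
  have exp_le: "exp (- 2 * c * (r - s)) \<le> 1" if "r \<ge> s" for r
    using that C(2) by simp
  have "compact (v ` {s..T})" by (intro compact_continuous_image cont compact_Icc)
  then obtain M where M: "M > 0" "\<And>r. r \<in> {s..T} \<Longrightarrow> norm (v r) \<le> M"
    using compact_imp_bounded bounded_pos by (metis imageI)
  have h_cont: "continuous_on {s..T} h"
    unfolding h_def by (intro continuous_intros cont)
  have h_ac: "abs_continuous_on {r..u} h" if ru: "s < r" "r \<le> u" "u < T" for r u
  proof (rule abs_continuous_on_dominated[OF ac[OF ru]])
    show "abs_continuous_on {r..u} (\<lambda>x. x)"
      by (rule lipschitz_imp_abs_continuous_on[where L = 1]) (auto simp: lipschitz_on_def)
    fix p q assume pq: "p \<in> {r..u}" "q \<in> {r..u}"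
    have e_lip: "(2 * c)-lipschitz_on {s..} (\<lambda>r. exp (- 2 * c * (r - s)))"
    proof (rule vector_derivative_bound_imp_lipschitz)
      show "((\<lambda>r. exp (- 2 * c * (r - s))) has_vector_derivative exp (- 2 * c * (x - s)) * (- 2 * c)) (at x within {s..})" for x
        by (auto intro!: derivative_eq_intros simp flip: has_real_derivative_iff_has_vector_derivative)
      show "norm (exp (- 2 * c * (x - s)) * (- 2 * c)) \<le> 2 * c" if "x \<in> {s..}" for x
        using exp_le[of x] that C(2) mult_right_mono[of "exp (- 2 * c * (x - s))" 1 "2 * c"] by (simp add: abs_mult)
    qed (use C in auto)
    have "norm (h q - h p) = \<bar>exp (- 2 * c * (q - s)) * (inner (v q) (v q) - inner (v p) (v p))
        + (exp (- 2 * c * (q - s)) - exp (- 2 * c * (p - s))) * inner (v p) (v p)\<bar>"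
      by (simp add: h_def algebra_simps)
    also have "\<dots> \<le> exp (- 2 * c * (q - s)) * \<bar>inner (v q) (v q) - inner (v p) (v p)\<bar>
        + \<bar>exp (- 2 * c * (q - s)) - exp (- 2 * c * (p - s))\<bar> * \<bar>inner (v p) (v p)\<bar>"
      by (rule order_trans[OF abs_triangle_ineq]) (simp add: abs_mult)
    also have "\<dots> \<le> 1 * (2 * M * norm (v q - v p)) + (2 * c * \<bar>q - p\<bar>) * M\<^sup>2"
    proof (intro add_mono mult_mono)
      show "exp (- 2 * c * (q - s)) \<le> 1" using exp_le[of q] pq ru by auto
      have "inner (v q) (v q) - inner (v p) (v p) = inner (v q - v p) (v q + v p)"
        by (simp add: inner_simps inner_commute)
      also have "\<bar>\<dots>\<bar> \<le> norm (v q - v p) * norm (v q + v p)" by (rule Cauchy_Schwarz_ineq2)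
      also have "\<dots> \<le> norm (v q - v p) * (M + M)"
        using M(2)[of p] M(2)[of q] pq ru
        by (intro mult_left_mono order_trans[OF norm_triangle_ineq] add_mono) auto
      finally show "\<bar>inner (v q) (v q) - inner (v p) (v p)\<bar> \<le> 2 * M * norm (v q - v p)"
        by (simp add: mult.commute)
      show "\<bar>exp (- 2 * c * (q - s)) - exp (- 2 * c * (p - s))\<bar> \<le> 2 * c * \<bar>q - p\<bar>"
        using lipschitz_onD[OF e_lip, of q p] pq ru by (auto simp: dist_real_def)
      show "\<bar>inner (v p) (v p)\<bar> \<le> M\<^sup>2"
        using M(2)[of p] pq ru by (auto simp: power_mono simp flip: power2_norm_eq_inner)
    qed (use C in auto)
    also have "\<dots> \<le> (2 * M + 2 * c * M\<^sup>2) * (norm (v q - v p) + norm (q - p))"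
      using M(1) C by (simp add: algebra_simps)
    finally show "norm (h q - h p) \<le> (2 * M + 2 * c * M\<^sup>2) * (norm (v q - v p) + norm (q - p))" .
  qed
  have h_der: "AE t in lebesgue. t \<in> {s<..<T} \<longrightarrow> (\<exists>d. (h has_real_derivative d) (at t) \<and>
      d \<le> (2 * C) * (norm (f1 t) + norm (f2 t)) + 2 * k)"
  proof (rule eventually_mono[OF der], intro impI)
    fix r assume *: "r \<in> {s<..<T} \<longrightarrow> (\<exists>d. (v has_vector_derivative d) (at r) \<and>
      inner d (v r) \<le> c * (norm (v r))\<^sup>2 + C * (norm (f1 r) + norm (f2 r)) + k)" "r \<in> {s<..<T}"
    then obtain d where d: "(v has_vector_derivative d) (at r)"
      "inner d (v r) \<le> c * (norm (v r))\<^sup>2 + C * (norm (f1 r) + norm (f2 r)) + k" by blast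
    let ?E = "exp (- 2 * c * (r - s)) * (inner (v r) d + inner d (v r))
        + (exp (- 2 * c * (r - s)) * (- 2 * c)) * inner (v r) (v r)"
    have "(h has_real_derivative ?E) (at r)"
      unfolding h_def has_real_derivative_iff_has_vector_derivative
      by (rule has_vector_derivative_mult[OF _ bounded_bilinear.has_vector_derivative[OF bounded_bilinear_inner d(1) d(1)]])
        (auto intro!: derivative_eq_intros simp flip: has_real_derivative_iff_has_vector_derivative)
    moreover have "?E \<le> (2 * C) * (norm (f1 r) + norm (f2 r)) + 2 * k"
    proof -
      have "?E = exp (- 2 * c * (r - s)) * (2 * (inner d (v r) - c * (norm (v r))\<^sup>2))"
        by (simp add: inner_commute power2_norm_eq_inner algebra_simps)
      also have "\<dots> \<le> exp (- 2 * c * (r - s)) * (2 * (C * (norm (f1 r) + norm (f2 r)) + k))"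
        using d(2) by (intro mult_left_mono) auto
      also have "\<dots> \<le> 1 * (2 * (C * (norm (f1 r) + norm (f2 r)) + k))"
        using *(2) C exp_le[of r] by (intro mult_right_mono) auto
      also have "\<dots> = (2 * C) * (norm (f1 r) + norm (f2 r)) + 2 * k" by simp
      finally show ?thesis .
    qed
    ultimately show "\<exists>d. (h has_real_derivative d) (at r) \<and> d \<le> (2 * C) * (norm (f1 r) + norm (f2 r)) + 2 * k"
      by blast
  qed
  have "h t - h s \<le> 2 * C * (enn2real (L1_norm T f1) + enn2real (L1_norm T f2)) + 2 * k * (t - s)"
    by (rule L1_differential_inequality[OF s(1) h_cont h_ac h_der f]) (use C s in auto)
  then have "exp (- 2 * c * (t - s)) * (norm (v t))\<^sup>2 \<le> (norm (v s))\<^sup>2 +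
           2 * C * (enn2real (L1_norm T f1) + enn2real (L1_norm T f2)) + 2 * k * (t - s)"
    by (simp add: h_def power2_norm_eq_inner)
  then have "exp (2 * c * (t - s)) * (exp (- 2 * c * (t - s)) * (norm (v t))\<^sup>2) \<le> exp (2 * c * (t - s)) * ((norm (v s))\<^sup>2 +
           2 * C * (enn2real (L1_norm T f1) + enn2real (L1_norm T f2)) + 2 * k * (t - s))"
    by (intro mult_left_mono) auto
  also have "exp (2 * c * (t - s)) * (exp (- 2 * c * (t - s)) * (norm (v t))\<^sup>2) = (norm (v t))\<^sup>2"
    by (simp add: mult.assoc[symmetric] exp_add[symmetric])
  finally show ?thesis .
qed

section \<open>The closed-loop system\<close>

locale positive_operator =
  fixes B :: "'a::real_inner \<Rightarrow> 'a"
  assumes B_bounded: "bounded_linear B"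
    and B_selfadjoint: "inner (B x) y = inner x (B y)"
    and B_positive: "inner (B x) x \<ge> 0"
begin

lemmas B_add = linear_add[OF bounded_linear.linear[OF B_bounded]]
  and B_diff = linear_diff[OF bounded_linear.linear[OF B_bounded]]
  and B_scaleR = linear_scale[OF bounded_linear.linear[OF B_bounded]]
  and B_zero = linear_0[OF bounded_linear.linear[OF B_bounded]]

text \<open>\<open>p x\<close> is the norm of the square root of \<open>B\<close> applied to
  \<open>x\<close>, and \<open>b\<close> is the operator norm of that root; neither needs the root
  itself.\<close>

definition p :: "'a \<Rightarrow> real" where "p x = sqrt (inner (B x) x)"

definition b :: real where "b = sqrt (onorm B)"

lemma p_nonneg: "p x \<ge> 0" by (simp add: p_def B_positive)

lemma b_nonneg: "b \<ge> 0" by (simp add: b_def onorm_pos_le[OF B_bounded])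

lemma p_square: "(p x)\<^sup>2 = inner (B x) x" by (simp add: p_def B_positive)

lemma form_Cauchy_Schwarz: "\<bar>inner (B x) y\<bar> \<le> p x * p y"
proof -
  have nonneg: "0 \<le> inner (B x) x + 2 * t * inner (B x) y + t\<^sup>2 * inner (B y) y" for t
  proof -
    have "0 \<le> inner (B (x + t *\<^sub>R y)) (x + t *\<^sub>R y)" by (rule B_positive)
    also have "inner (B y) x = inner (B x) y"
      using B_selfadjoint[of y x] by (simp add: inner_commute)
    then have "inner (B (x + t *\<^sub>R y)) (x + t *\<^sub>R y)
        = inner (B x) x + 2 * t * inner (B x) y + t\<^sup>2 * inner (B y) y"
      by (simp add: B_add B_scaleR inner_add_left inner_add_right power2_eq_square algebra_simps)
    finally show ?thesis .
  qed
  have "(inner (B x) y)\<^sup>2 \<le> inner (B x) x * inner (B y) y"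
  proof (cases "inner (B y) y = 0")
    case True
    have "inner (B x) y = 0"
    proof (rule ccontr)
      assume "inner (B x) y \<noteq> 0"
      \<comment> \<open>The form may be degenerate. With this \<open>t\<close> the nonnegative
        expression, affine in \<open>t\<close> here, takes the value -1.\<close>
      then show False using nonneg[of "- (inner (B x) x + 1) / (2 * inner (B x) y)"] True by (auto simp: field_simps)
    qed
    then show ?thesis by (simp add: True)
  next
    case False
    then have pos: "inner (B y) y > 0" using B_positive[of y] by simp
    have "0 \<le> inner (B x) x - (inner (B x) y)\<^sup>2 / inner (B y) y"
      using nonneg[of "- inner (B x) y / inner (B y) y"] pos
      by (simp add: power2_eq_square field_simps)
    then show ?thesis using pos by (simp add: field_simps)
  qed
  then have "\<bar>inner (B x) y\<bar> \<le> sqrt (inner (B x) x * inner (B y) y)"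
    by (metis real_sqrt_abs real_sqrt_le_iff)
  then show ?thesis by (simp add: p_def real_sqrt_mult)
qed

lemma p_triangle: "p (x + y) \<le> p x + p y"
proof -
  have "(p (x + y))\<^sup>2 = (p x)\<^sup>2 + 2 * inner (B x) y + (p y)\<^sup>2"
    using B_selfadjoint[of y x]
    by (simp add: p_square B_add inner_add_left inner_add_right inner_commute)
  also have "\<dots> \<le> (p x + p y)\<^sup>2"
    using form_Cauchy_Schwarz[of x y] by (simp add: power2_eq_square algebra_simps)
  finally show ?thesis by (rule power2_le_imp_le) (simp add: p_nonneg)
qed

lemma p_minus_commute: "p (x - y) = p (y - x)"
  by (simp add: p_def B_diff inner_diff_left inner_diff_right)

lemma p_diff: "\<bar>p x - p y\<bar> \<le> p (x - y)"
  using p_triangle[of "x - y" y] p_triangle[of "y - x" x] p_minus_commute[of x y] by simp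

lemma p_le: "p x \<le> b * norm x"
proof -
  have "inner (B x) x \<le> norm (B x) * norm x" by (rule norm_cauchy_schwarz)
  also have "\<dots> \<le> (onorm B * norm x) * norm x"
    by (intro mult_right_mono onorm B_bounded) auto
  finally have "p x \<le> sqrt (onorm B * (norm x)\<^sup>2)"
    by (simp add: p_def power2_eq_square mult.assoc)
  then show ?thesis by (simp add: b_def real_sqrt_mult)
qed

text \<open>Cauchy-Schwarz for the form with \<open>B x\<close> itself as second argument.\<close>

lemma B_le: "norm (B x) \<le> b * p x"
proof (cases "B x = 0")
  case False
  have "(norm (B x))\<^sup>2 \<le> p x * p (B x)"
    using form_Cauchy_Schwarz[of x "B x"] by (simp add: power2_norm_eq_inner)
  also have "\<dots> \<le> p x * (b * norm (B x))" by (intro mult_left_mono p_le p_nonneg)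
  finally show ?thesis using False by (simp add: power2_eq_square algebra_simps)
qed (simp add: b_nonneg p_nonneg)

lemma B_eq_0_iff: "B x = 0 \<longleftrightarrow> p x = 0"
  using B_le[of x] by (auto simp: p_def)

end

section \<open>The singular feedback and its truncation\<close>

locale power_feedback = positive_operator +
  fixes \<mu> :: real
  assumes mu: "0 < \<mu>" "\<mu> < 1/2"
begin

definition G :: "'a \<Rightarrow> 'a" where "G x = (inner (B x) x powr (-\<mu>)) *\<^sub>R B x"

text \<open>Equal to \<open>G\<close> where \<open>p x \<ge> \<epsilon>\<close> and linear where
  \<open>p x \<le> \<epsilon>\<close>: the gain is frozen before it blows up.\<close>

definition G_reg :: "real \<Rightarrow> 'a \<Rightarrow> 'a" where
  "G_reg \<epsilon> x = (max (p x) \<epsilon> powr (-2 * \<mu>)) *\<^sub>R B x"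

lemma G_eq: "G x = (p x powr (-2 * \<mu>)) *\<^sub>R B x"
proof -
  have "inner (B x) x powr (-\<mu>) = p x powr (-2 * \<mu>)"
    using p_nonneg[of x] p_square[of x, symmetric]
    by (simp add: powr_powr flip: powr_numeral) 
  then show ?thesis by (simp add: G_def)
qed

lemma powr_mult_self: "r \<ge> 0 \<Longrightarrow> r powr (-2 * \<mu>) * r = r powr (1 - 2 * \<mu>)" for r :: real
  using powr_add[of r 1 "-2 * \<mu>"] by (cases "r = 0") (simp_all add: mult.commute)

lemma G_norm: "norm (G x) \<le> b * p x powr (1 - 2 * \<mu>)"
proof -
  have "norm (G x) \<le> p x powr (-2 * \<mu>) * (b * p x)"
    unfolding G_eq using B_le[of x] by (simp add: mult_left_mono)
  also have "\<dots> = b * p x powr (1 - 2 * \<mu>)"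
    by (simp add: powr_mult_self[symmetric] p_nonneg)
  finally show ?thesis .
qed

text \<open>Cauchy-Schwarz for the form reduces the claim to the scalars \<open>a = p x\<close> and
  \<open>c = p y\<close>, where it says that \<open>r powr (1 - 2 * \<mu>)\<close> is
  increasing.\<close>

lemma G_monotone: "inner (G x - G y) (x - y) \<ge> 0"
proof -
  define a c where "a = p x" and "c = p y"
  have nn: "a \<ge> 0" "c \<ge> 0" by (auto simp: a_def c_def p_nonneg)
  have sym: "inner (B y) x = inner (B x) y"
    using B_selfadjoint[of y x] by (simp add: inner_commute)
  have "inner (G x - G y) (x - y) = a powr (-2 * \<mu>) * a\<^sup>2 + c powr (-2 * \<mu>) * c\<^sup>2
      - (a powr (-2 * \<mu>) + c powr (-2 * \<mu>)) * inner (B x) y"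
    by (simp add: G_eq inner_diff_left inner_diff_right sym a_def c_def p_square algebra_simps)
  also have "\<dots> \<ge> a powr (-2 * \<mu>) * a\<^sup>2 + c powr (-2 * \<mu>) * c\<^sup>2
      - (a powr (-2 * \<mu>) + c powr (-2 * \<mu>)) * (a * c)"
    using form_Cauchy_Schwarz[of x y]
    by (intro diff_left_mono mult_left_mono) (auto simp: a_def c_def)
  also have "a powr (-2 * \<mu>) * a\<^sup>2 + c powr (-2 * \<mu>) * c\<^sup>2
      - (a powr (-2 * \<mu>) + c powr (-2 * \<mu>)) * (a * c)
      = (a powr (-2 * \<mu>) * a - c powr (-2 * \<mu>) * c) * (a - c)"
    by (simp add: power2_eq_square algebra_simps)
  also have "\<dots> = (a powr (1 - 2 * \<mu>) - c powr (1 - 2 * \<mu>)) * (a - c)"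
    using powr_mult_self[OF nn(1)] powr_mult_self[OF nn(2)] by simp
  also have "\<dots> \<ge> 0"
    using nn mu powr_mono2[of "1 - 2 * \<mu>" a c] powr_mono2[of "1 - 2 * \<mu>" c a]
    by (cases "a \<le> c") (auto intro: mult_nonneg_nonneg mult_nonpos_nonpos)
  finally show ?thesis .
qed

text \<open>The factor 2 counts two equal contributions, from the difference of the vectors and from
  the difference of the gains. By symmetry only \<open>p y \<le> p x\<close> is treated, so that the
  gain at \<open>x\<close> is the smaller one.\<close>

lemma G_reg_lipschitz:
  assumes \<epsilon>: "\<epsilon> > 0"
  shows "(2 * b\<^sup>2 * \<epsilon> powr (-2 * \<mu>))-lipschitz_on UNIV (G_reg \<epsilon>)"
proof -
  have *: "norm (G_reg \<epsilon> x - G_reg \<epsilon> y) \<le> 2 * b\<^sup>2 * \<epsilon> powr (-2 * \<mu>) * norm (x - y)" if "p y \<le> p x" for x y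
  proof -
    define a c where "a = max (p x) \<epsilon>" and "c = max (p y) \<epsilon>"
    have ac: "c \<le> a" "\<epsilon> \<le> c" "p y \<le> c" "0 < c" "0 < a" "\<epsilon> \<le> a" using that \<epsilon> by (auto simp: a_def c_def)
    have anti: "a powr (-2 * \<mu>) \<le> c powr (-2 * \<mu>)" "a powr (-2 * \<mu>) \<le> \<epsilon> powr (-2 * \<mu>)"
      using ac \<epsilon> mu by (auto intro: powr_mono2')
    have acx: "a - c \<le> p (x - y)"
      using p_diff[of x y] that p_nonneg[of "x - y"] unfolding a_def c_def by linarith
    have "G_reg \<epsilon> x - G_reg \<epsilon> y = a powr (-2 * \<mu>) *\<^sub>R B (x - y) - (c powr (-2 * \<mu>) - a powr (-2 * \<mu>)) *\<^sub>R B y"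
      by (simp add: G_reg_def a_def c_def B_diff algebra_simps)
    then have "norm (G_reg \<epsilon> x - G_reg \<epsilon> y) \<le> norm (a powr (-2 * \<mu>) *\<^sub>R B (x - y))
        + norm ((c powr (-2 * \<mu>) - a powr (-2 * \<mu>)) *\<^sub>R B y)"
      using norm_triangle_ineq4 by metis
    also have "\<dots> = a powr (-2 * \<mu>) * norm (B (x - y)) + (c powr (-2 * \<mu>) - a powr (-2 * \<mu>)) * norm (B y)"
      using anti by simp
    also have "\<dots> \<le> \<epsilon> powr (-2 * \<mu>) * (b * p (x - y)) + (c powr (-2 * \<mu>) - a powr (-2 * \<mu>)) * (b * c)"
      using anti ac b_nonneg
      by (intro add_mono mult_mono order_trans[OF B_le] B_le) (auto intro: mult_left_mono simp: p_nonneg)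
    also have "(c powr (-2 * \<mu>) - a powr (-2 * \<mu>)) * (b * c) = b * (c powr (1 - 2 * \<mu>) - a powr (-2 * \<mu>) * c)"
      using powr_mult_self[of c] ac by (simp add: algebra_simps)
    \<comment> \<open>Raising \<open>c\<close> to \<open>a\<close> in the increasing power makes the
      factor \<open>a - c\<close> appear, and the difference of gains is bounded with no derivative
      of a power.\<close>
    also have "\<dots> \<le> b * (a powr (1 - 2 * \<mu>) - a powr (-2 * \<mu>) * c)"
      using ac mu b_nonneg by (intro mult_left_mono diff_right_mono powr_mono2) auto
    also have "\<dots> = b * (a powr (-2 * \<mu>) * (a - c))"
      using powr_mult_self[of a] ac by (simp add: algebra_simps)
    also have "\<dots> \<le> b * (\<epsilon> powr (-2 * \<mu>) * p (x - y))"
      using anti ac acx b_nonneg by (intro mult_left_mono mult_mono) auto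
    also have "\<epsilon> powr (-2 * \<mu>) * (b * p (x - y)) + b * (\<epsilon> powr (-2 * \<mu>) * p (x - y))
        = (2 * b * \<epsilon> powr (-2 * \<mu>)) * p (x - y)"
      by (simp add: algebra_simps)
    also have "\<dots> \<le> (2 * b * \<epsilon> powr (-2 * \<mu>)) * (b * norm (x - y))"
      using b_nonneg by (intro mult_left_mono p_le) auto
    finally show ?thesis by (simp add: power2_eq_square algebra_simps)
  qed
  show ?thesis
  proof (rule lipschitz_onI)
    show "dist (G_reg \<epsilon> x) (G_reg \<epsilon> y) \<le> 2 * b\<^sup>2 * \<epsilon> powr (-2 * \<mu>) * dist x y" for x y
      using *[of x y] *[of y x] by (cases "p y \<le> p x") (auto simp: dist_norm norm_minus_commute)
  qed simp
qed

text \<open>The maps differ only where \<open>p x < \<epsilon>\<close>, and there each has norm at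
  most \<open>b * \<epsilon> powr (1 - 2 * \<mu>)\<close>. This tends to 0 precisely because
  \<open>\<mu> < 1/2\<close>.\<close>

lemma G_reg_close:
  assumes \<epsilon>: "\<epsilon> > 0"
  shows "norm (G x - G_reg \<epsilon> x) \<le> 2 * b * \<epsilon> powr (1 - 2 * \<mu>)"
proof (cases "p x \<ge> \<epsilon>")
  case True
  then show ?thesis by (simp add: G_eq G_reg_def b_nonneg)
next
  case False
  have "norm (G x - G_reg \<epsilon> x) \<le> norm (G x) + norm (G_reg \<epsilon> x)" by (rule norm_triangle_ineq4)
  also have "\<dots> \<le> b * p x powr (1 - 2 * \<mu>) + \<epsilon> powr (-2 * \<mu>) * (b * \<epsilon>)"
  proof (rule add_mono[OF G_norm])
    have "norm (G_reg \<epsilon> x) = \<epsilon> powr (-2 * \<mu>) * norm (B x)" using False by (simp add: G_reg_def)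
    also have "\<dots> \<le> \<epsilon> powr (-2 * \<mu>) * (b * \<epsilon>)"
      using False b_nonneg by (intro mult_left_mono order_trans[OF B_le]) auto
    finally show "norm (G_reg \<epsilon> x) \<le> \<epsilon> powr (-2 * \<mu>) * (b * \<epsilon>)" .
  qed
  also have "b * p x powr (1 - 2 * \<mu>) \<le> b * \<epsilon> powr (1 - 2 * \<mu>)"
    using False mu b_nonneg p_nonneg by (intro mult_left_mono powr_mono2) auto
  also have "\<epsilon> powr (-2 * \<mu>) * (b * \<epsilon>) = b * \<epsilon> powr (1 - 2 * \<mu>)"
    using powr_mult_self[of \<epsilon>] \<epsilon> by (simp add: algebra_simps)
  finally show ?thesis by simp
qed

end

text \<open>A Lipschitz extension \<open>Y\<close> with its constant \<open>L\<close> is fixed as a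
  parameter, so that the feedback can be replaced by a map on the whole space.\<close>

locale closed_loop =
  quasi_contractive_semigroup D A S \<omega> + power_feedback B \<mu>
  for D :: "'a::{real_inner, complete_space} set" and A S \<omega> and B :: "'a \<Rightarrow> 'a" and \<mu> +
  fixes P :: "'a \<Rightarrow> 'a" and W :: "'a set" and \<phi> :: "'a \<Rightarrow> real" and Y :: "'a \<Rightarrow> 'a"
    and L \<gamma> \<delta> :: real
  assumes W: "W = {x. \<forall>t\<ge>0. B (S t x) = 0}"
    and P: "P = orth_proj (W\<^sup>\<bottom>)"
    and W_perp_invariant: "t \<ge> 0 \<Longrightarrow> x \<in> W\<^sup>\<bottom> \<Longrightarrow> S t x \<in> W\<^sup>\<bottom>"
    and \<phi>_nonneg: "y \<in> W\<^sup>\<bottom> \<Longrightarrow> y \<in> D \<Longrightarrow> \<phi> y \<ge> 0"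
    and \<phi>_bound: "y \<in> W\<^sup>\<bottom> \<Longrightarrow> y \<in> D \<Longrightarrow> inner (A y) (B y) \<le> \<phi> y * (norm (B y))\<^sup>2"
    and Y_lipschitz: "L-lipschitz_on (W\<^sup>\<bottom>) Y"
    and Y_eq: "y \<in> W\<^sup>\<bottom> \<Longrightarrow> y \<in> D \<Longrightarrow> Y y = \<phi> y *\<^sub>R B y"
    and \<gamma>_pos: "\<gamma> > 0"
    and gap: "x \<in> W\<^sup>\<bottom> \<Longrightarrow> \<gamma> * inner (B x) x \<le> (norm (B x))\<^sup>2"
    and nilpotent: "t \<ge> \<delta> \<Longrightarrow> x \<in> W \<Longrightarrow> S t x = 0"
    and \<delta>_nonneg: "\<delta> \<ge> 0"
begin

section \<open>The decomposition of the space along W\<close>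

lemma W_perp_iff: "x \<in> W\<^sup>\<bottom> \<longleftrightarrow> (\<forall>w\<in>W. inner w x = 0)"
  by (simp add: orthogonal_comp_def orthogonal_def)

lemma W_subspace: "subspace W"
  using linear_0[OF S_linear] linear_add[OF S_linear] linear_scale[OF S_linear]
  by (auto simp: W subspace_def B_zero B_add B_scaleR)

lemma W_closed: "closed W"
proof -
  have "W = (\<Inter>t\<in>{0..}. {x. B (S t x) = 0})" by (auto simp: W)
  moreover have "closed {x. B (S t x) = 0}" if "t \<ge> 0" for t
    using bounded_linear_compose[OF B_bounded S_bounded_linear[OF that]]
    by (intro closed_Collect_eq linear_continuous_on continuous_on_const) (auto simp: o_def)
  ultimately show ?thesis by (auto intro: closed_INT)
qed

lemma W_invariant: "t \<ge> 0 \<Longrightarrow> x \<in> W \<Longrightarrow> S t x \<in> W"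
  by (auto simp: W S_add[symmetric])

lemma B_W: "x \<in> W \<Longrightarrow> B x = 0"
  using S_0[of x] by (auto simp: W dest: spec[of _ 0])

text \<open>By definition the residual of \<open>P\<close> lies in the double complement of
  \<open>W\<close>. A residual in \<open>W\<close> is a special case, and uniqueness holds because a
  vector in \<open>W\<^sup>\<bottom>\<close> that is orthogonal to \<open>W\<^sup>\<bottom>\<close>
  is 0.\<close>

lemma P_decomposition:
  assumes "x - z \<in> W" "z \<in> W\<^sup>\<bottom>"
  shows "P x = z"
proof -
  have "z \<in> W\<^sup>\<bottom> \<and> x - z \<in> W\<^sup>\<bottom>\<^sup>\<bottom>"
    using assms orthogonal_comp_subset by blast
  moreover have "y = z" if "y \<in> W\<^sup>\<bottom> \<and> x - y \<in> W\<^sup>\<bottom>\<^sup>\<bottom>" for y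
  proof -
    have "y - z \<in> W\<^sup>\<bottom>" using that assms by (simp add: subspace_diff subspace_orthogonal_comp)
    moreover have "(x - z) - (x - y) \<in> W\<^sup>\<bottom>\<^sup>\<bottom>"
      by (rule subspace_diff[OF subspace_orthogonal_comp])
        (use that assms orthogonal_comp_subset[of W] in blast)+
    ultimately have "inner (y - z) (y - z) = 0"
      unfolding orthogonal_comp_def[of "W\<^sup>\<bottom>"] by (auto simp: orthogonal_def)
    then show ?thesis by simp
  qed
  ultimately show ?thesis unfolding P orth_proj_def by (rule the_equality)
qed

lemma P_perp: "P x \<in> W\<^sup>\<bottom>" and P_diff_W: "x - P x \<in> W"
proof -
  obtain w where w: "w \<in> W" "\<And>m. m \<in> W \<Longrightarrow> inner (x - w) m = 0"
    using closed_subspace_projection[OF W_subspace W_closed] by metis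
  then have "x - w \<in> W\<^sup>\<bottom>" by (simp add: W_perp_iff inner_commute)
  moreover from this have "P x = x - w" using w by (intro P_decomposition) auto
  ultimately show "P x \<in> W\<^sup>\<bottom>" "x - P x \<in> W" using w by auto
qed

lemma P_id: "x \<in> W\<^sup>\<bottom> \<Longrightarrow> P x = x"
  by (rule P_decomposition) (auto simp: subspace_0 W_subspace)

lemma P_norm: "norm (P x) \<le> norm x"
proof -
  have "inner (x - P x) (P x) = 0" using P_perp[of x] P_diff_W[of x] by (simp add: W_perp_iff)
  then have "(norm (P x))\<^sup>2 + (norm (x - P x))\<^sup>2 = (norm x)\<^sup>2"
    by (simp add: power2_norm_eq_inner inner_diff_left inner_diff_right inner_commute)
  then show ?thesis by (smt (verit) norm_ge_zero power2_le_imp_le zero_le_power2)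
qed

lemma P_bounded_linear: "bounded_linear P"
proof (rule bounded_linear_intro[of _ 1])
  show "P (x + y) = P x + P y" for x y
  proof (rule P_decomposition)
    have "(x - P x) + (y - P y) \<in> W" by (intro subspace_add W_subspace P_diff_W)
    then show "x + y - (P x + P y) \<in> W" by (simp add: algebra_simps)
  qed (intro subspace_add subspace_orthogonal_comp P_perp)
  show "P (c *\<^sub>R x) = c *\<^sub>R P x" for c x
  proof (rule P_decomposition)
    have "c *\<^sub>R (x - P x) \<in> W" by (intro subspace_mul W_subspace P_diff_W)
    then show "c *\<^sub>R x - c *\<^sub>R P x \<in> W" by (simp add: algebra_simps)
  qed (intro subspace_mul subspace_orthogonal_comp P_perp)
qed (simp add: P_norm)

lemmas P_diff = linear_diff[OF bounded_linear.linear[OF P_bounded_linear]]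

text \<open>Both summands are invariant: \<open>W\<close> because its definition is stable under a
  shift in time, its complement by \<open>W_perp_invariant\<close>.\<close>

lemma P_S: "t \<ge> 0 \<Longrightarrow> S t (P x) = P (S t x)"
proof -
  assume t: "t \<ge> 0"
  have "S t x - S t (P x) \<in> W"
    using W_invariant[OF t P_diff_W[of x]] linear_diff[OF S_linear[OF t]] by simp
  then show ?thesis using P_decomposition W_perp_invariant[OF t P_perp] by metis
qed

lemma P_D: "x \<in> D \<Longrightarrow> P x \<in> D" "x \<in> D \<Longrightarrow> A (P x) = P (A x)"
  using generator_bounded_linear_image[OF P_bounded_linear P_S] by auto

lemma B_P: "B (P x) = B x"
  using B_W[OF P_diff_W[of x]] by (simp add: B_diff)

text \<open>The range of a self-adjoint operator is orthogonal to its kernel, which contains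
  \<open>W\<close>.\<close>

lemma B_perp: "B x \<in> W\<^sup>\<bottom>"
  using B_W B_selfadjoint by (simp add: W_perp_iff flip: B_selfadjoint)

lemma form_P: "inner (B (P x)) (P x) = inner (B x) x"
proof -
  have "inner (x - P x) (B x) = 0" using B_perp[of x] P_diff_W[of x] by (simp add: W_perp_iff)
  then have "inner (P x) (B x) = inner x (B x)" by (simp add: inner_diff_left)
  then show ?thesis by (metis B_P inner_commute)
qed

section \<open>The Lipschitz part of the feedback\<close>

lemma L_nonneg: "L \<ge> 0"
  using Y_lipschitz lipschitz_on_nonneg by blast

lemma Y_continuous: "continuous_on (W\<^sup>\<bottom>) Y"
  using Y_lipschitz by (rule lipschitz_on_continuous_on)

lemma Y_tendsto:
  assumes "u \<longlonglongrightarrow> x" "x \<in> W\<^sup>\<bottom>" "\<And>n. u n \<in> W\<^sup>\<bottom>"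
  shows "(\<lambda>n. Y (u n)) \<longlonglongrightarrow> Y x"
  using continuous_on_tendsto_compose[OF Y_continuous assms(1,2)] assms(3) by simp

text \<open>On \<open>D\<close> the vector \<open>Y x\<close> is a nonnegative multiple of
  \<open>B x\<close>. Equality in Cauchy-Schwarz expresses this without the gain
  \<open>\<phi>\<close>, which need not have limits, and is preserved when \<open>D\<close> is left
  by continuity.\<close>

lemma Y_parallel:
  assumes x: "x \<in> W\<^sup>\<bottom>"
  shows "inner (Y x) (B x) = norm (Y x) * norm (B x)"
proof -
  obtain z where z: "\<And>n. z n \<in> smooth_vectors" "z \<longlonglongrightarrow> x" using smooth_vectors_dense_sequence by blast
  have Pz: "(\<lambda>n. P (z n)) \<longlonglongrightarrow> x"
    using bounded_linear.tendsto[OF P_bounded_linear z(2)] P_id[OF x] by simp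
  note lim = Y_tendsto[OF Pz x P_perp] bounded_linear.tendsto[OF B_bounded Pz]
  have "inner (Y (P (z n))) (B (P (z n))) = norm (Y (P (z n))) * norm (B (P (z n)))" for n
  proof -
    have "P (z n) \<in> D" using P_D(1) smooth_vectors_D z(1) by blast
    then show ?thesis
      using Y_eq[OF P_perp] \<phi>_nonneg[OF P_perp] by (simp add: norm_mult power2_norm_eq_inner flip: power2_eq_square)
  qed
  then have "(\<lambda>n. norm (Y (P (z n))) * norm (B (P (z n)))) \<longlonglongrightarrow> inner (Y x) (B x)"
    using tendsto_inner[OF lim] by simp
  moreover have "(\<lambda>n. norm (Y (P (z n))) * norm (B (P (z n)))) \<longlonglongrightarrow> norm (Y x) * norm (B x)"
    by (intro tendsto_intros lim)
  ultimately show ?thesis using LIMSEQ_unique by blast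
qed

text \<open>On the kernel of \<open>B\<close> the gain \<open>\<phi>\<close> may be unbounded. Approaching a point of the
  kernel along a direction \<open>r\<close> and along \<open>-r\<close> forces \<open>Y\<close> to be parallel to
  both \<open>B r\<close> and \<open>- B r\<close>.\<close>

lemma Y_kernel:
  assumes z: "z \<in> W\<^sup>\<bottom>" "B z = 0"
  shows "Y z = 0"
proof (cases "\<exists>r\<in>W\<^sup>\<bottom>. B r \<noteq> 0")
  case True
  then obtain r where r: "r \<in> W\<^sup>\<bottom>" "B r \<noteq> 0" by blast
  have dir: "inner (Y z) (B s) = norm (Y z) * norm (B s)" if s: "s \<in> W\<^sup>\<bottom>" for s
  proof -
    define \<epsilon> where "\<epsilon> = (\<lambda>n. inverse (real (Suc n)))"
    have \<epsilon>: "\<epsilon> n > 0" "\<epsilon> \<longlonglongrightarrow> 0" for n using LIMSEQ_inverse_real_of_nat by (auto simp: \<epsilon>_def)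
    have mem: "z + \<epsilon> n *\<^sub>R s \<in> W\<^sup>\<bottom>" for n
      using z(1) s by (intro subspace_add subspace_mul subspace_orthogonal_comp)
    have "(\<lambda>n. z + \<epsilon> n *\<^sub>R s) \<longlonglongrightarrow> z + 0 *\<^sub>R s" by (intro tendsto_intros \<epsilon>)
    then have "(\<lambda>n. z + \<epsilon> n *\<^sub>R s) \<longlonglongrightarrow> z" by simp
    note lim = Y_tendsto[OF this z(1) mem]
    have "inner (Y (z + \<epsilon> n *\<^sub>R s)) (B s) = norm (Y (z + \<epsilon> n *\<^sub>R s)) * norm (B s)" for n
      using Y_parallel[OF mem[of n]] z(2) \<epsilon>(1)[of n] by (simp add: B_add B_scaleR)
    then have "(\<lambda>n. norm (Y (z + \<epsilon> n *\<^sub>R s)) * norm (B s)) \<longlonglongrightarrow> inner (Y z) (B s)"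
      using tendsto_inner[OF lim tendsto_const[of "B s"]] by simp
    moreover have "(\<lambda>n. norm (Y (z + \<epsilon> n *\<^sub>R s)) * norm (B s)) \<longlonglongrightarrow> norm (Y z) * norm (B s)"
      by (intro tendsto_intros lim)
    ultimately show ?thesis using LIMSEQ_unique by blast
  qed
  have "- r \<in> W\<^sup>\<bottom>" using r(1) by (simp add: subspace_neg subspace_orthogonal_comp)
  from dir[OF this] dir[OF r(1)] have "norm (Y z) * norm (B r) = 0"
    using linear_neg[OF bounded_linear.linear[OF B_bounded], of r] by simp
  then show ?thesis using r(2) by simp
next
  case False
  \<comment> \<open>If \<open>B\<close> vanishes on all of \<open>W\<^sup>\<bottom>\<close>, no
    direction \<open>r\<close> exists, but then \<open>Y\<close> is already 0 on a dense
    set.\<close>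
  obtain x where x: "\<And>n. x n \<in> smooth_vectors" "x \<longlonglongrightarrow> z" using smooth_vectors_dense_sequence by blast
  have "(\<lambda>n. P (x n)) \<longlonglongrightarrow> z"
    using bounded_linear.tendsto[OF P_bounded_linear x(2)] P_id[OF z(1)] by simp
  then have "(\<lambda>n. Y (P (x n))) \<longlonglongrightarrow> Y z"
    by (rule Y_tendsto[OF _ z(1) P_perp])
  moreover have "Y (P (x n)) = 0" for n
    using Y_eq[OF P_perp] P_D(1) smooth_vectors_D x(1) False P_perp by auto
  ultimately show ?thesis by (simp add: LIMSEQ_const_iff)
qed

definition F :: "'a \<Rightarrow> 'a" where "F x = G x + Y (P x)"

lemma feedback_term_eq:
  assumes "y \<in> D"
  shows "feedback_term B P \<phi> \<mu> y = F y"
proof -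
  have "Y (P y) = \<phi> (P y) *\<^sub>R B y"
    using Y_eq[OF P_perp P_D(1)[OF assms]] by (simp add: B_P)
  then show ?thesis
    by (auto simp: feedback_term_def F_def G_def form_P[unfolded B_P] B_P)
qed

lemma F_dissipative: "- inner (F x - F y) (x - y) \<le> L * (norm (x - y))\<^sup>2"
proof -
  have "\<bar>inner (Y (P x) - Y (P y)) (x - y)\<bar> \<le> norm (Y (P x) - Y (P y)) * norm (x - y)"
    by (rule Cauchy_Schwarz_ineq2)
  also have "norm (Y (P x) - Y (P y)) \<le> L * norm (P x - P y)"
    using lipschitz_onD[OF Y_lipschitz P_perp P_perp] by (simp add: dist_norm)
  also have "\<dots> \<le> L * norm (x - y)"
    using L_nonneg P_norm[of "x - y"] by (simp add: P_diff mult_left_mono)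
  finally have "\<bar>inner (Y (P x) - Y (P y)) (x - y)\<bar> \<le> L * (norm (x - y))\<^sup>2"
    by (simp add: power2_eq_square mult_right_mono)
  moreover have "inner (F x - F y) (x - y) = inner (G x - G y) (x - y) + inner (Y (P x) - Y (P y)) (x - y)"
    by (simp add: F_def inner_add_left inner_diff_left)
  ultimately show ?thesis using G_monotone[of x y] by linarith
qed

end

section \<open>Approximate solutions\<close>

text \<open>The cap \<open>N\<close> makes the range finite. With \<open>N\<close> the rounded-up
  quotient of \<open>T\<close> and \<open>h\<close> it has no effect at times up to
  \<open>T\<close>, by \<open>grid_index_le\<close>.\<close>

lemma simple_function_grid: "simple_function lebesgue (\<lambda>t::real. v (min N (nat \<lfloor>t / h\<rfloor>)))"
proof (rule simple_function_compose1[where g = v])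
  have "(\<lambda>t::real. t / h) \<in> borel_measurable lborel" by simp
  then have "(\<lambda>t::real. t / h) \<in> borel_measurable lebesgue" by (rule measurable_completion)
  from measurable_compose[OF measurable_compose[OF this measurable_real_floor] measurable_count_space[of "\<lambda>i. min N (nat i)"]]
  have "(\<lambda>t::real. min N (nat \<lfloor>t / h\<rfloor>)) \<in> lebesgue \<rightarrow>\<^sub>M count_space UNIV" by simp
  moreover have "finite ((\<lambda>t::real. min N (nat \<lfloor>t / h\<rfloor>)) ` space lebesgue)"
    by (rule finite_subset[of _ "{..N}"]) auto
  ultimately show "simple_function lebesgue (\<lambda>t::real. min N (nat \<lfloor>t / h\<rfloor>))"
    by (simp add: simple_function_eq_measurable)
qed

lemma grid_cell:
  assumes "h > 0" "t \<ge> 0"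
  shows "real (nat \<lfloor>t / h\<rfloor>) * h \<le> t" "t < (real (nat \<lfloor>t / h\<rfloor>) + 1) * h"
proof -
  have "real (nat \<lfloor>t / h\<rfloor>) = of_int \<lfloor>t / h\<rfloor>" using assms by simp
  then show "real (nat \<lfloor>t / h\<rfloor>) * h \<le> t" "t < (real (nat \<lfloor>t / h\<rfloor>) + 1) * h"
    using floor_divide_lower[OF assms(1), of t] floor_divide_upper[OF assms(1), of t] by simp_all
qed

lemma grid_index_eqI:
  assumes "h > 0" "real k * h \<le> t" "t < (real k + 1) * h"
  shows "nat \<lfloor>t / h\<rfloor> = k"
proof -
  have "\<lfloor>t / h\<rfloor> = int k"
    using assms by (intro floor_unique) (simp_all add: field_simps)
  then show ?thesis by simp
qed

lemma grid_index_le: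
  fixes h t T :: real
  assumes "h > 0" "t \<le> T"
  shows "nat \<lfloor>t / h\<rfloor> \<le> nat \<lceil>T / h\<rceil>"
proof -
  have "t / h \<le> T / h" using assms by (simp add: divide_right_mono)
  then have "real_of_int \<lfloor>t / h\<rfloor> \<le> real_of_int \<lceil>T / h\<rceil>"
    using of_int_floor_le[of "t / h"] le_of_int_ceiling[of "T / h"] by linarith
  then have "\<lfloor>t / h\<rfloor> \<le> \<lceil>T / h\<rceil>" by (simp only: of_int_le_iff)
  then show ?thesis by (rule nat_mono)
qed

text \<open>The simple functions sample \<open>u\<close> at the last grid point not after
  \<open>t\<close>, on grids of mesh tending to 0.\<close>

lemma continuous_imp_strongly_measurable:
  fixes u :: "real \<Rightarrow> 'b::real_normed_vector"
  assumes "continuous_on {0..T} u"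
  obtains s where "\<And>n::nat. simple_function lebesgue (s n)" "\<And>t. t \<in> {0<..<T} \<Longrightarrow> (\<lambda>n. s n t) \<longlonglongrightarrow> u t"
proof -
  define h where "h = (\<lambda>n. inverse (real (Suc n)))"
  have h: "h n > 0" "h \<longlonglongrightarrow> 0" for n using LIMSEQ_inverse_real_of_nat by (auto simp: h_def)
  define s where "s = (\<lambda>n t. (\<lambda>k. u (real k * h n)) (min (nat \<lceil>T / h n\<rceil>) (nat \<lfloor>t / h n\<rfloor>)))"
  have "simple_function lebesgue (s n)" for n unfolding s_def by (rule simple_function_grid)
  moreover have "(\<lambda>n. s n t) \<longlonglongrightarrow> u t" if t: "t \<in> {0<..<T}" for t
  proof -
    define r where "r = (\<lambda>n. real (nat \<lfloor>t / h n\<rfloor>) * h n)"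
    have r: "r n \<le> t" "t < r n + h n" "r n \<ge> 0" for n
      using grid_cell[OF h(1), of t n] t h(1)[of n] by (auto simp: r_def algebra_simps)
    have "(\<lambda>n. t - h n) \<longlonglongrightarrow> t" using tendsto_diff[OF tendsto_const h(2), of t] by simp
    then have "r \<longlonglongrightarrow> t"
    proof (rule tendsto_sandwich[OF _ _ _ tendsto_const, rotated 2])
      have "t - h n \<le> r n" for n using r(2)[of n] by simp
      then show "\<forall>\<^sub>F n in sequentially. t - h n \<le> r n" by simp
    qed (simp add: r)
    then have "(\<lambda>n. u (r n)) \<longlonglongrightarrow> u t"
      by (rule continuous_on_tendsto_compose[OF assms])
        (use t order_trans[OF r(1), of T] r(3) in auto)
    moreover have "s n t = u (r n)" for n
      using grid_index_le[OF h(1), of t T n] t by (simp add: s_def r_def min_absorb2)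
    ultimately show ?thesis by simp
  qed
  ultimately show thesis by (rule that)
qed

lemma L1_norm_le_const:
  assumes "\<And>t. t \<in> {0<..<T} \<Longrightarrow> norm (f t) \<le> \<eta>" "T \<ge> 0" "\<eta> \<ge> 0"
  shows "L1_norm T f \<le> ennreal (\<eta> * T)"
proof -
  have "L1_norm T f \<le> (\<integral>\<^sup>+ t. ennreal \<eta> * indicator {0<..<T} t \<partial>lebesgue)"
    unfolding L1_norm_def using assms(1)
    by (intro nn_integral_mono) (auto simp: indicator_def ennreal_leI)
  also have "\<dots> = ennreal \<eta> * emeasure lebesgue {0<..<T}"
    by (rule nn_integral_cmult_indicator) auto
  also have "\<dots> = ennreal (\<eta> * T)"
    using assms(2,3) by (simp add: ennreal_mult)
  finally show ?thesis .
qed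

lemma L1_norm_mono: "T' \<le> T \<Longrightarrow> L1_norm T' f \<le> L1_norm T f"
  unfolding L1_norm_def by (intro nn_integral_mono) (auto simp: indicator_def)

lemma L1_fun_mono:
  assumes "L1_fun T f" "T' \<le> T"
  shows "L1_fun T' f"
proof -
  obtain s where s: "\<forall>n. simple_function lebesgue (s n)"
      "AE t in lebesgue. t \<in> {0<..<T} \<longrightarrow> (\<lambda>n::nat. s n t) \<longlonglongrightarrow> f t"
    and fin: "L1_norm T f < \<infinity>"
    using assms(1) unfolding L1_fun_def by blast
  have "AE t in lebesgue. t \<in> {0<..<T'} \<longrightarrow> (\<lambda>n::nat. s n t) \<longlonglongrightarrow> f t"
    by (rule eventually_mono[OF s(2)]) (use assms(2) in auto)
  moreover have "L1_norm T' f < \<infinity>"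
    using L1_norm_mono[OF assms(2)] fin by (rule le_less_trans)
  ultimately show ?thesis using s(1) unfolding L1_fun_def by blast
qed

lemma strong_solution_mono: "strong_solution D A F T f y \<Longrightarrow> T' \<le> T \<Longrightarrow> strong_solution D A F T' f y"
proof -
  assume *: "strong_solution D A F T f y" "T' \<le> T"
  then have "AE t in lebesgue. t \<in> {0<..<T} \<longrightarrow>
        y t \<in> D \<and> (y has_vector_derivative (A (y t) - F (y t) + f t)) (at t)"
    by (simp add: strong_solution_def)
  then have "AE t in lebesgue. t \<in> {0<..<T'} \<longrightarrow>
        y t \<in> D \<and> (y has_vector_derivative (A (y t) - F (y t) + f t)) (at t)"
    by (rule eventually_mono) (use *(2) in auto)
  moreover have "continuous_on {0..T'} y"
    using * by (auto simp: strong_solution_def intro: continuous_on_subset)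
  moreover have "abs_continuous_on K y" if "compact K" "K \<subseteq> {0<..<T'}" for K
  proof -
    have "K \<subseteq> {0<..<T}" using that(2) *(2) by auto
    then show ?thesis using * that(1) by (simp add: strong_solution_def)
  qed
  ultimately show ?thesis by (simp add: strong_solution_def)
qed

section \<open>The exponential Euler scheme\<close>

context quasi_contractive_semigroup
begin

text \<open>The exponential Euler scheme \<open>z \<mapsto> z + J h (A z - \<Phi> z)\<close>. The defect
  \<open>A z - \<Phi> z\<close> grows by at most the factor \<open>exp ((\<omega> + \<Lambda>) * h)\<close> per step, which bounds the
  speed of the polygon uniformly in the step size \<open>h\<close>.\<close>

lemma Euler_approximation:
  assumes \<Phi>: "\<Lambda>-lipschitz_on UNIV \<Phi>" and x: "x \<in> D" and T: "T > 0" and \<eta>: "\<eta> > 0"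
  obtains y g where "y 0 = x" "\<exists>M. M-lipschitz_on {0..T} y" "simple_function lebesgue g"
    "AE t in lebesgue. t \<in> {0<..<T} \<longrightarrow> y t \<in> D \<and> (y has_vector_derivative A (y t) - g t) (at t)"
    "\<And>t. t \<in> {0..T} \<Longrightarrow> norm (g t - \<Phi> (y t)) \<le> \<eta>"
proof -
  have \<Lambda>: "\<Lambda> \<ge> 0" using \<Phi> lipschitz_on_nonneg by blast
  have \<Phi>_le: "norm (\<Phi> a - \<Phi> c) \<le> \<Lambda> * norm (a - c)" for a c
    using lipschitz_onD[OF \<Phi>, of a c] by (simp add: dist_norm)
  define w where "w = (\<lambda>z. A z - \<Phi> z)"
  \<comment> \<open>The outer \<open>exp \<omega>\<close> covers growth inside one cell, of length
    at most 1; the inner factor covers growth of the defect over \<open>[0, T]\<close>.\<close>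
  define M where "M = exp \<omega> * (exp ((\<omega> + \<Lambda>) * T) * norm (w x))"
  have M: "M \<ge> 0" by (simp add: M_def)
  \<comment> \<open>Within a cell the curve moves by at most \<open>M * h\<close>, hence
    \<open>\<Phi>\<close> by at most \<open>\<Lambda> * M * h\<close>, which is to stay below
    \<open>\<eta>\<close>; the added 1 avoids division by 0.\<close>
  define h where "h = min 1 (\<eta> / (\<Lambda> * M + 1))"
  have h: "h > 0" "h \<le> 1" "\<Lambda> * M * h \<le> \<eta>"
  proof -
    have pos: "\<Lambda> * M + 1 > 0" using \<Lambda> M by (simp add: add_nonneg_pos)
    then show "h > 0" using \<eta> by (simp add: h_def)
    show "h \<le> 1" by (simp add: h_def)
    have "\<Lambda> * M * h \<le> (\<Lambda> * M + 1) * h" using \<open>h > 0\<close> by (simp add: algebra_simps)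
    also have "\<dots> \<le> (\<Lambda> * M + 1) * (\<eta> / (\<Lambda> * M + 1))"
      using pos by (intro mult_left_mono) (auto simp: h_def)
    finally show "\<Lambda> * M * h \<le> \<eta>" using pos by simp
  qed
  define e where "e = rec_nat x (\<lambda>_ z. z + J h (w z))"
  have e_0: "e 0 = x" and e_Suc: "e (Suc k) = e k + J h (w (e k))" for k by (simp_all add: e_def)
  have e_D: "e k \<in> D" for k
  proof (induction k)
    case (Suc k)
    then show ?case using h(1) by (simp add: e_Suc D_add J_in_D)
  qed (simp add: e_0 x)
  have w_Suc: "w (e (Suc k)) = S h (w (e k)) + (\<Phi> (e k) - \<Phi> (e (Suc k)))" for k
  proof -
    have "A (e (Suc k)) = A (e k) + (S h (w (e k)) - w (e k))"
      using h(1) by (simp add: e_Suc D_add J_in_D e_D)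
    then show ?thesis by (simp add: w_def)
  qed
  have w_bound: "norm (w (e k)) \<le> exp ((\<omega> + \<Lambda>) * h * real k) * norm (w x)" for k
  proof (induction k)
    case (Suc k)
    have "norm (w (e (Suc k))) \<le> norm (S h (w (e k))) + norm (\<Phi> (e k) - \<Phi> (e (Suc k)))"
      unfolding w_Suc by (rule norm_triangle_ineq)
    also have "\<dots> \<le> exp (\<omega> * h) * norm (w (e k)) + \<Lambda> * (exp (\<omega> * h) * norm (w (e k)) * h)"
    proof (intro add_mono S_norm)
      have "norm (\<Phi> (e k) - \<Phi> (e (Suc k))) \<le> \<Lambda> * norm (J h (w (e k)))"
        using \<Phi>_le[of "e k" "e (Suc k)"] by (simp add: e_Suc)
      also have "\<dots> \<le> \<Lambda> * (exp (\<omega> * h) * norm (w (e k)) * h)"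
        using h(1) \<Lambda> by (intro mult_left_mono J_norm) auto
      finally show "norm (\<Phi> (e k) - \<Phi> (e (Suc k))) \<le> \<Lambda> * (exp (\<omega> * h) * norm (w (e k)) * h)" .
    qed (use h in simp)
    also have "\<dots> = (1 + \<Lambda> * h) * (exp (\<omega> * h) * norm (w (e k)))" by (simp add: algebra_simps)
    also have "\<dots> \<le> exp (\<Lambda> * h) * (exp (\<omega> * h) * norm (w (e k)))"
      by (intro mult_right_mono exp_ge_add_one_self) auto
    also have "\<dots> \<le> exp (\<Lambda> * h) * (exp (\<omega> * h) * (exp ((\<omega> + \<Lambda>) * h * real k) * norm (w x)))"
      by (intro mult_left_mono Suc) auto
    also have "\<dots> = exp ((\<omega> + \<Lambda>) * h * real (Suc k)) * norm (w x)"
      by (simp add: mult.assoc[symmetric] exp_add[symmetric]) (simp add: algebra_simps)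
    finally show ?case .
  qed (simp add: e_0)
  have speed: "exp (\<omega> * h) * norm (w (e k)) \<le> M" if "real k * h \<le> T" for k
  proof -
    have "norm (w (e k)) \<le> exp ((\<omega> + \<Lambda>) * T) * norm (w x)"
    proof (rule order_trans[OF w_bound mult_right_mono])
      have "(\<omega> + \<Lambda>) * (real k * h) \<le> (\<omega> + \<Lambda>) * T"
        using that \<Lambda> \<omega>_nonneg by (intro mult_left_mono) auto
      then show "exp ((\<omega> + \<Lambda>) * h * real k) \<le> exp ((\<omega> + \<Lambda>) * T)" by (simp add: mult_ac)
    qed simp
    moreover have "exp (\<omega> * h) \<le> exp \<omega>"
      using h(2) \<omega>_nonneg by (simp add: mult_left_le)
    ultimately show ?thesis unfolding M_def by (intro mult_mono) auto
  qed
  define y where "y = (\<lambda>t. let k = nat \<lfloor>t / h\<rfloor> in e k + J (t - real k * h) (w (e k)))"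
  \<comment> \<open>The formula holds on the closed cell, since at the right end it agrees with the
    start of the next one; closed cells allow the Lipschitz bounds to be glued.\<close>
  have y_cell: "y t = e k + J (t - real k * h) (w (e k))"
    if "real k * h \<le> t" "t \<le> (real k + 1) * h" for t k
  proof (cases "t < (real k + 1) * h")
    case True
    then show ?thesis using grid_index_eqI[OF h(1) that(1)] by (simp add: y_def)
  next
    case False
    with that have t: "t = real (Suc k) * h" by (simp add: add.commute)
    then have "nat \<lfloor>t / h\<rfloor> = Suc k" using h(1) by (intro grid_index_eqI) (auto simp: algebra_simps)
    then have "y t = e (Suc k)" by (simp add: y_def t J_0)
    moreover have "t - real k * h = h" by (simp add: t algebra_simps)
    ultimately show ?thesis by (simp add: e_Suc)
  qed
  define N where "N = nat \<lceil>T / h\<rceil>"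
  define g where "g = (\<lambda>t. (\<lambda>k. \<Phi> (e k)) (min N (nat \<lfloor>t / h\<rfloor>)))"
  have g_eq: "g t = \<Phi> (e (nat \<lfloor>t / h\<rfloor>))" if "t \<le> T" for t
    using grid_index_le[OF h(1) that] by (simp add: g_def N_def min_absorb2)
  have "y 0 = x" using y_cell[of 0 0] h(1) by (simp add: e_0 J_0)
  moreover have "M-lipschitz_on {0..T} y"
  proof (rule lipschitz_on_closed_Union[where I = "{k. real k * h \<le> T}" and U = "\<lambda>k. {real k * h..(real k + 1) * h}"])
    show "{0..T} \<subseteq> (\<Union>k\<in>{k. real k * h \<le> T}. {real k * h..(real k + 1) * h})"
    proof
      fix t assume "t \<in> {0..T}"
      then show "t \<in> (\<Union>k\<in>{k. real k * h \<le> T}. {real k * h..(real k + 1) * h})"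
        using grid_cell[OF h(1), of t] by (intro UN_I[of "nat \<lfloor>t / h\<rfloor>"]) auto
    qed
    have "{k. real k * h \<le> T} \<subseteq> {..N}"
    proof
      fix k assume "k \<in> {k. real k * h \<le> T}"
      then have "real k \<le> T / h" using h(1) by (simp add: field_simps)
      then show "k \<in> {..N}" by (auto simp: N_def le_nat_iff) linarith
    qed
    then show "finite {k. real k * h \<le> T}" by (rule finite_subset) simp
    show "M-lipschitz_on {real k * h..(real k + 1) * h} y" if k: "k \<in> {k. real k * h \<le> T}" for k
    proof (rule lipschitz_onI)
      fix s t assume st: "s \<in> {real k * h..(real k + 1) * h}" "t \<in> {real k * h..(real k + 1) * h}"
      then have "dist (y s) (y t) = dist (J (s - real k * h) (w (e k))) (J (t - real k * h) (w (e k)))"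
        using y_cell[of k s] y_cell[of k t] by (simp add: dist_norm)
      also have "\<dots> \<le> (exp (\<omega> * h) * norm (w (e k))) * dist (s - real k * h) (t - real k * h)"
        using st h(1) by (intro lipschitz_onD[OF J_lipschitz]) (auto simp: algebra_simps)
      also have "\<dots> \<le> M * dist (s - real k * h) (t - real k * h)"
        using speed k by (intro mult_right_mono) auto
      finally show "dist (y s) (y t) \<le> M * dist s t" by (simp add: dist_real_def)
    qed fact
  qed (use M in auto)
  moreover have "simple_function lebesgue g" unfolding g_def by (rule simple_function_grid)
  moreover have "AE t in lebesgue. t \<in> {0<..<T} \<longrightarrow> y t \<in> D \<and> (y has_vector_derivative A (y t) - g t) (at t)"
  proof (rule AE_I')
    show "range (\<lambda>k. real k * h) \<in> null_sets lebesgue"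
      by (intro null_sets_completionI countable_imp_null_set_lborel countable_image) simp
    have "y t \<in> D \<and> (y has_vector_derivative A (y t) - g t) (at t)"
      if t: "t \<in> {0<..<T}" "t \<notin> range (\<lambda>k. real k * h)" for t
    proof -
      define k where "k = nat \<lfloor>t / h\<rfloor>"
      have "t \<noteq> real k * h" using t(2) by blast
      then have k: "real k * h < t" "t < (real k + 1) * h"
        using grid_cell[OF h(1), of t] t(1) by (auto simp: k_def)
      define r where "r = t - real k * h"
      have r: "r > 0" using k by (simp add: r_def)
      have yt: "y t = e k + J r (w (e k))" using y_cell[of k t] k by (simp add: r_def)
      have "A (y t) = A (e k) + (S r (w (e k)) - w (e k))"
        using r by (simp add: yt D_add J_in_D e_D)
      then have Ay: "A (y t) - g t = S r (w (e k))"
        using t by (simp add: g_eq k_def[symmetric]) (simp add: w_def)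
      have "at r within {0..} = at r" using r by (intro at_within_interior) auto
      then have "((\<lambda>s. J s (w (e k))) has_vector_derivative S r (w (e k))) (at r)"
        using J_deriv[of r "w (e k)"] r by simp
      then have "((\<lambda>s. J s (w (e k))) \<circ> (\<lambda>s. s - real k * h) has_vector_derivative 1 *\<^sub>R S r (w (e k))) (at t)"
        by (intro vector_diff_chain_at) (auto intro!: derivative_eq_intros simp: r_def)
      then have "((\<lambda>s. e k + J (s - real k * h) (w (e k))) has_vector_derivative S r (w (e k))) (at t)"
        by (auto simp: o_def intro!: derivative_eq_intros)
      then have "(y has_vector_derivative S r (w (e k))) (at t)"
      proof (rule has_vector_derivative_transform_within_open)
        show "open {real k * h<..<(real k + 1) * h}" by simp
        show "t \<in> {real k * h<..<(real k + 1) * h}" using k by simp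
        show "e k + J (s - real k * h) (w (e k)) = y s" if "s \<in> {real k * h<..<(real k + 1) * h}" for s
          using y_cell[of k s] that by simp
      qed
      moreover have "y t \<in> D" using r by (simp add: yt D_add J_in_D e_D)
      ultimately show ?thesis by (simp add: Ay)
    qed
    then show "{t \<in> space lebesgue. \<not> (t \<in> {0<..<T} \<longrightarrow> y t \<in> D \<and> (y has_vector_derivative A (y t) - g t) (at t))}
        \<subseteq> range (\<lambda>k. real k * h)" by blast
  qed
  moreover have "norm (g t - \<Phi> (y t)) \<le> \<eta>" if t: "t \<in> {0..T}" for t
  proof -
    define k where "k = nat \<lfloor>t / h\<rfloor>"
    have k: "real k * h \<le> t" "t < (real k + 1) * h"
      using grid_cell[OF h(1), of t] t by (auto simp: k_def)
    define r where "r = t - real k * h"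
    have r: "0 \<le> r" "r \<le> h" using k by (auto simp: r_def algebra_simps)
    have "norm (g t - \<Phi> (y t)) \<le> \<Lambda> * norm (e k - y t)"
      using \<Phi>_le g_eq[of t] t by (simp add: k_def)
    also have "norm (e k - y t) = norm (J r (w (e k)))"
      using y_cell[of k t] k by (simp add: r_def)
    also have "\<dots> \<le> exp (\<omega> * r) * norm (w (e k)) * r" by (rule J_norm[OF r(1)])
    also have "\<dots> \<le> exp (\<omega> * h) * norm (w (e k)) * h"
      using r \<omega>_nonneg by (intro mult_mono) (auto intro: mult_left_mono)
    also have "\<dots> \<le> M * h" using speed[of k] k t h(1) by (intro mult_right_mono) auto
    finally have "norm (g t - \<Phi> (y t)) \<le> \<Lambda> * (M * h)" using \<Lambda> by (simp add: mult_left_mono)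
    then show ?thesis using h(3) by (simp add: mult.assoc)
  qed
  ultimately show thesis using that by blast
qed

end

section \<open>Approximation of the closed-loop feedback\<close>

context closed_loop
begin

definition F_reg :: "real \<Rightarrow> 'a \<Rightarrow> 'a" where "F_reg \<epsilon> x = G_reg \<epsilon> x + Y (P x)"

lemma F_reg_lipschitz:
  assumes "\<epsilon> > 0"
  shows "(2 * b\<^sup>2 * \<epsilon> powr (-2 * \<mu>) + L)-lipschitz_on UNIV (F_reg \<epsilon>)"
  unfolding F_reg_def
proof (rule lipschitz_on_add[OF G_reg_lipschitz[OF assms]])
  show "L-lipschitz_on UNIV (\<lambda>x. Y (P x))"
  proof (rule lipschitz_onI[OF _ L_nonneg])
    fix x y
    have "dist (Y (P x)) (Y (P y)) \<le> L * dist (P x) (P y)"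
      by (rule lipschitz_onD[OF Y_lipschitz P_perp P_perp])
    also have "\<dots> \<le> L * dist x y"
      using P_norm[of "x - y"] L_nonneg by (simp add: dist_norm P_diff mult_left_mono)
    finally show "dist (Y (P x)) (Y (P y)) \<le> L * dist x y" .
  qed
qed

lemma F_reg_close_uniformly: "\<eta> > 0 \<Longrightarrow> \<exists>\<epsilon>>0. \<forall>x. norm (F x - F_reg \<epsilon> x) \<le> \<eta>"
proof -
  assume \<eta>: "\<eta> > 0"
  have "((\<lambda>\<epsilon>. 2 * b * \<epsilon> powr (1 - 2 * \<mu>)) \<longlongrightarrow> 2 * b * 0 powr (1 - 2 * \<mu>)) (at_right 0)"
    using mu by (intro tendsto_intros tendsto_powr') (auto simp: eventually_at_right_field intro!: exI[of _ 1])
  then have "\<forall>\<^sub>F \<epsilon> in at_right 0. 2 * b * \<epsilon> powr (1 - 2 * \<mu>) < \<eta>"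
    using \<eta> mu by (intro order_tendstoD(2)) auto
  then obtain d where d: "d > 0" "\<And>\<epsilon>. 0 < \<epsilon> \<Longrightarrow> \<epsilon> < d \<Longrightarrow> 2 * b * \<epsilon> powr (1 - 2 * \<mu>) < \<eta>"
    by (auto simp: eventually_at_right_field)
  have "norm (F x - F_reg (d/2) x) \<le> \<eta>" for x
    using G_reg_close[of "d/2" x] d(2)[of "d/2"] d(1) by (simp add: F_def F_reg_def)
  then show ?thesis using d(1) by (intro exI[of _ "d/2"]) auto
qed

text \<open>A uniform limit of Lipschitz maps. Uniformity is what lets uniform convergence of
  approximants pass through \<open>F\<close> on a whole time interval in one step.\<close>

lemma F_uniformly_continuous: "e > 0 \<Longrightarrow> \<exists>d>0. \<forall>x z. norm (x - z) < d \<longrightarrow> norm (F x - F z) < e"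
proof -
  assume e: "e > 0"
  then obtain \<epsilon> where \<epsilon>: "\<epsilon> > 0" "\<And>x. norm (F x - F_reg \<epsilon> x) \<le> e / 4"
    using F_reg_close_uniformly[of "e / 4"] by auto
  define \<Lambda> where "\<Lambda> = 2 * b\<^sup>2 * \<epsilon> powr (-2 * \<mu>) + L"
  have lip: "\<Lambda>-lipschitz_on UNIV (F_reg \<epsilon>)" unfolding \<Lambda>_def by (rule F_reg_lipschitz[OF \<epsilon>(1)])
  have \<Lambda>: "\<Lambda> \<ge> 0" using lip lipschitz_on_nonneg by blast
  have "norm (F x - F z) < e" if "norm (x - z) < e / (4 * (\<Lambda> + 1))" for x z
  proof -
    have "norm (F_reg \<epsilon> x - F_reg \<epsilon> z) \<le> \<Lambda> * norm (x - z)"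
      using lipschitz_onD[OF lip, of x z] by (simp add: dist_norm)
    also have "\<dots> \<le> (\<Lambda> + 1) * (e / (4 * (\<Lambda> + 1)))"
      using that \<Lambda> by (intro mult_mono) auto
    also have "(\<Lambda> + 1) * (e / (4 * (\<Lambda> + 1))) = e / 4"
    proof -
      have "c * (e / (4 * c)) = e / 4" if "c \<noteq> 0" for c :: real using that by simp
      moreover have "\<Lambda> + 1 \<noteq> 0" using \<Lambda> by linarith
      ultimately show ?thesis by blast
    qed
    finally have 1: "norm (F_reg \<epsilon> x - F_reg \<epsilon> z) \<le> e / 4" .
    have "norm (F x - F z) \<le> norm (F x - F_reg \<epsilon> x) + norm (F_reg \<epsilon> x - F z)"
      using norm_triangle_ineq[of "F x - F_reg \<epsilon> x" "F_reg \<epsilon> x - F z"] by simp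
    moreover have "norm (F_reg \<epsilon> x - F z) \<le> norm (F_reg \<epsilon> x - F_reg \<epsilon> z) + norm (F z - F_reg \<epsilon> z)"
      using norm_triangle_ineq4[of "F_reg \<epsilon> x - F_reg \<epsilon> z" "F z - F_reg \<epsilon> z"] by simp
    ultimately show ?thesis using 1 \<epsilon>(2)[of x] \<epsilon>(2)[of z] e by linarith
  qed
  moreover have "e / (4 * (\<Lambda> + 1)) > 0" using e \<Lambda> by simp
  ultimately show ?thesis by blast
qed

lemma F_continuous: "continuous_on UNIV F"
  unfolding continuous_on_iff dist_norm using F_uniformly_continuous by blast

abbreviation strong where "strong T f y \<equiv> strong_solution D A (feedback_term B P \<phi> \<mu>) T f y"

abbreviation weak where "weak y0 y \<equiv> weak_solution D A (feedback_term B P \<phi> \<mu>) y0 y"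

text \<open>An Euler polygon for \<open>F_reg\<close> solves the original equation with forcing
  \<open>F (y t) - g t\<close>; half of \<open>\<eta>\<close> pays for the regularisation and half
  for the scheme. The forcing is strongly measurable as a continuous function minus a simple
  one.\<close>

lemma near_strong_solution:
  assumes T: "T > 0" and \<eta>: "\<eta> > 0"
  shows "\<exists>y f. norm (y 0 - x0) \<le> \<eta> \<and> L1_fun T f \<and> strong T f y \<and> (\<forall>t\<in>{0..T}. norm (f t) \<le> \<eta>)"
proof -
  obtain x where x: "x \<in> smooth_vectors" "norm (x - x0) < \<eta>"
    using smooth_vectors_dense[OF \<eta>] by blast
  obtain \<epsilon> where \<epsilon>: "\<epsilon> > 0" "\<And>x. norm (F x - F_reg \<epsilon> x) \<le> \<eta> / 2"
    using F_reg_close_uniformly[of "\<eta> / 2"] \<eta> by auto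
  obtain y g where y: "y 0 = x" "\<exists>M. M-lipschitz_on {0..T} y" and g: "simple_function lebesgue g"
    and ode: "AE t in lebesgue. t \<in> {0<..<T} \<longrightarrow> y t \<in> D \<and> (y has_vector_derivative A (y t) - g t) (at t)"
    and gF: "\<And>t. t \<in> {0..T} \<Longrightarrow> norm (g t - F_reg \<epsilon> (y t)) \<le> \<eta> / 2"
    using Euler_approximation[OF F_reg_lipschitz[OF \<epsilon>(1)] smooth_vectors_D[OF x(1)] T half_gt_zero[OF \<eta>]]
    by blast
  define f where "f = (\<lambda>t. F (y t) - g t)"
  have f_le: "norm (f t) \<le> \<eta>" if "t \<in> {0..T}" for t
  proof -
    have "f t = (F (y t) - F_reg \<epsilon> (y t)) - (g t - F_reg \<epsilon> (y t))" by (simp add: f_def)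
    then have "norm (f t) \<le> norm (F (y t) - F_reg \<epsilon> (y t)) + norm (g t - F_reg \<epsilon> (y t))"
      by (metis norm_triangle_ineq4)
    then show ?thesis using gF[OF that] \<epsilon>(2)[of "y t"] by simp
  qed
  obtain M where M: "M-lipschitz_on {0..T} y" using y(2) by blast
  have y_cont: "continuous_on {0..T} y" by (rule lipschitz_on_continuous_on[OF M])
  have "continuous_on {0..T} (\<lambda>t. F (y t))"
    by (rule continuous_on_compose2[OF F_continuous y_cont]) auto
  then obtain s where s: "\<And>n::nat. simple_function lebesgue (s n)"
    "\<And>t. t \<in> {0<..<T} \<Longrightarrow> (\<lambda>n. s n t) \<longlonglongrightarrow> F (y t)"
    using continuous_imp_strongly_measurable by blast
  have "L1_fun T f"
    unfolding L1_fun_def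
  proof (intro conjI exI[of _ "\<lambda>n t. s n t - g t"] allI)
    show "simple_function lebesgue (\<lambda>t. s n t - g t)" for n
      by (rule simple_function_compose2[OF s(1) g])
    show "AE t in lebesgue. t \<in> {0<..<T} \<longrightarrow> (\<lambda>n. s n t - g t) \<longlonglongrightarrow> f t"
      unfolding f_def by (intro always_eventually allI impI tendsto_diff s(2) tendsto_const)
    have "L1_norm T f \<le> ennreal (\<eta> * T)"
      by (rule L1_norm_le_const) (use f_le T \<eta> in auto)
    then show "L1_norm T f < \<infinity>" using ennreal_less_top le_less_trans by (metis infinity_ennreal_def)
  qed
  moreover have "strong T f y"
    unfolding strong_solution_def
  proof (intro conjI allI impI)
    show "abs_continuous_on K y" if "compact K \<and> K \<subseteq> {0<..<T}" for K
      by (rule abs_continuous_on_subset[OF lipschitz_imp_abs_continuous_on[OF M]]) (use that in force)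
    show "AE t in lebesgue. t \<in> {0<..<T} \<longrightarrow>
        y t \<in> D \<and> (y has_vector_derivative (A (y t) - feedback_term B P \<phi> \<mu> (y t) + f t)) (at t)"
      by (rule eventually_mono[OF ode]) (auto simp: feedback_term_eq f_def)
  qed (rule y_cont)
  ultimately show ?thesis
    using x(2) y(1) f_le by (intro exI[of _ y] exI[of _ f]) auto
qed

end

section \<open>Well-posedness\<close>

lemma L1_fun_zero: "L1_fun T (\<lambda>_. 0)" "L1_norm T (\<lambda>_. 0) = 0"
  unfolding L1_fun_def L1_norm_def by (auto intro!: exI[of _ "\<lambda>_ _. 0"])

lemma L1_norm_enn2real_tendsto:
  assumes "(\<lambda>n. L1_norm T (f n)) \<longlonglongrightarrow> 0"
  shows "(\<lambda>n. enn2real (L1_norm T (f n))) \<longlonglongrightarrow> 0"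
  by (rule tendsto_enn2real) (use assms in simp_all)

lemma strong_solution_abs_continuous:
  assumes "strong_solution D A F T f y" "0 < r" "r \<le> u" "u < T"
  shows "abs_continuous_on {r..u} y"
proof -
  have "compact {r..u} \<and> {r..u} \<subseteq> {0<..<T}" using assms by auto
  then show ?thesis using assms(1) unfolding strong_solution_def by blast
qed

section \<open>Comparison of strong solutions and existence of weak ones\<close>

context closed_loop
begin

text \<open>The product of forcing and distance is left unsplit, because the two comparison lemmas
  below estimate it differently.\<close>

lemma strong_difference:
  assumes "strong T f y" "strong T g z"
  shows "AE t in lebesgue. t \<in> {0<..<T} \<longrightarrow> (\<exists>d. ((\<lambda>t. y t - z t) has_vector_derivative d) (at t) \<and>
     inner d (y t - z t) \<le> (\<omega> + L) * (norm (y t - z t))\<^sup>2 + (norm (f t) + norm (g t)) * norm (y t - z t))"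
proof -
  have "AE t in lebesgue. t \<in> {0<..<T} \<longrightarrow>
        y t \<in> D \<and> (y has_vector_derivative (A (y t) - feedback_term B P \<phi> \<mu> (y t) + f t)) (at t)"
    "AE t in lebesgue. t \<in> {0<..<T} \<longrightarrow>
        z t \<in> D \<and> (z has_vector_derivative (A (z t) - feedback_term B P \<phi> \<mu> (z t) + g t)) (at t)"
    using assms by (auto simp: strong_solution_def)
  then show ?thesis
  proof eventually_elim
    case (elim t)
    show ?case
    proof
      assume t: "t \<in> {0<..<T}"
      with elim have D: "y t \<in> D" "z t \<in> D" by auto
      let ?d = "(A (y t) - F (y t) + f t) - (A (z t) - F (z t) + g t)"
      have "((\<lambda>t. y t - z t) has_vector_derivative ?d) (at t)"
        using elim t D by (auto simp: feedback_term_eq intro!: has_vector_derivative_diff)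
      moreover have "inner ?d (y t - z t) = inner (A (y t - z t)) (y t - z t)
          - inner (F (y t) - F (z t)) (y t - z t) + inner (f t - g t) (y t - z t)"
        by (simp add: D_diff D inner_diff_left inner_add_left)
      moreover have "inner (A (y t - z t)) (y t - z t) \<le> \<omega> * (norm (y t - z t))\<^sup>2"
        by (intro quasi_contractive D_diff D)
      moreover have "inner (f t - g t) (y t - z t) \<le> (norm (f t) + norm (g t)) * norm (y t - z t)"
        by (rule order_trans[OF norm_cauchy_schwarz]) (intro mult_right_mono norm_triangle_ineq4 norm_ge_zero)
      ultimately show "\<exists>d. ((\<lambda>t. y t - z t) has_vector_derivative d) (at t) \<and>
        inner d (y t - z t) \<le> (\<omega> + L) * (norm (y t - z t))\<^sup>2 + (norm (f t) + norm (g t)) * norm (y t - z t)"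
        using F_dissipative[of "y t" "z t"] by (intro exI[of _ ?d]) (simp add: algebra_simps)
    qed
  qed
qed

lemma strong_difference_regularity:
  assumes "strong T f y" "strong T g z"
  shows "continuous_on {0..T} (\<lambda>t. y t - z t)"
    "0 < r \<Longrightarrow> r \<le> u \<Longrightarrow> u < T \<Longrightarrow> abs_continuous_on {r..u} (\<lambda>t. y t - z t)"
proof -
  show "continuous_on {0..T} (\<lambda>t. y t - z t)"
    using assms by (auto simp: strong_solution_def intro: continuous_on_diff)
  show "abs_continuous_on {r..u} (\<lambda>t. y t - z t)" if "0 < r" "r \<le> u" "u < T"
  proof (rule abs_continuous_on_dominated[OF strong_solution_abs_continuous[OF assms(1) that]
        strong_solution_abs_continuous[OF assms(2) that], where L = 1])
    show "norm (y t - z t - (y s - z s)) \<le> 1 * (norm (y t - y s) + norm (z t - z s))" for s t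
      using norm_triangle_ineq4[of "y t - y s" "z t - z s"] by (simp add: algebra_simps)
  qed
qed

text \<open>Forcing that is small only in the mean requires an a priori bound \<open>M\<close> on
  the distance. For approximants of given weak solutions it comes from uniform convergence.\<close>

lemma strong_compare_L1:
  assumes s: "strong T f y" "strong T g z" and L1: "L1_fun T f" "L1_fun T g"
    and M: "\<And>r. r \<in> {0..T} \<Longrightarrow> norm (y r - z r) \<le> M" and t: "0 \<le> t" "t \<le> T"
  shows "(norm (y t - z t))\<^sup>2 \<le> exp (2 * (\<omega> + L) * t) * ((norm (y 0 - z 0))\<^sup>2 +
    2 * M * (enn2real (L1_norm T f) + enn2real (L1_norm T g)))"
proof -
  have M0: "M \<ge> 0" using order_trans[OF norm_ge_zero M[of 0]] t by simp
  have "(norm (y t - z t))\<^sup>2 \<le> exp (2 * (\<omega> + L) * (t - 0)) * ((norm (y 0 - z 0))\<^sup>2 +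
    2 * M * (enn2real (L1_norm T f) + enn2real (L1_norm T g)) + 2 * 0 * (t - 0))"
  proof (rule L1_energy_inequality[OF _ t strong_difference_regularity[OF s]])
    show "AE t in lebesgue. t \<in> {0<..<T} \<longrightarrow> (\<exists>d. ((\<lambda>t. y t - z t) has_vector_derivative d) (at t) \<and>
     inner d (y t - z t) \<le> (\<omega> + L) * (norm (y t - z t))\<^sup>2 + M * (norm (f t) + norm (g t)) + 0)"
      using strong_difference[OF s]
    proof eventually_elim
      case (elim t)
      have "(norm (f t) + norm (g t)) * norm (y t - z t) \<le> M * (norm (f t) + norm (g t))" if "t \<in> {0<..<T}"
        using M[of t] that by (subst mult.commute) (intro mult_right_mono, auto)
      then show ?case using elim by fastforce
    qed
  qed (use L1 M0 \<omega>_nonneg L_nonneg in auto)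
  then show ?thesis by simp
qed

text \<open>While solutions are being constructed no bound on the distance is known, but the forcing
  is uniformly small. Young's inequality then splits the product, at the price of the additional 1
  in the exponent.\<close>

lemma strong_compare_uniform:
  assumes s: "strong T f y" "strong T g z"
    and \<eta>: "\<And>r. r \<in> {0..T} \<Longrightarrow> norm (f r) \<le> \<eta>" "\<And>r. r \<in> {0..T} \<Longrightarrow> norm (g r) \<le> \<theta>"
    and t: "0 \<le> t" "t \<le> T"
  shows "(norm (y t - z t))\<^sup>2 \<le> exp (2 * (\<omega> + L + 1) * t) * ((norm (y 0 - z 0))\<^sup>2 + 2 * (\<eta> + \<theta>)\<^sup>2 * t)"
proof -
  have "(norm (y t - z t))\<^sup>2 \<le> exp (2 * (\<omega> + L + 1) * (t - 0)) * ((norm (y 0 - z 0))\<^sup>2 +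
    2 * 0 * (enn2real (L1_norm T (\<lambda>_. 0::'a)) + enn2real (L1_norm T (\<lambda>_. 0::'a))) + 2 * (\<eta> + \<theta>)\<^sup>2 * (t - 0))"
  proof (rule L1_energy_inequality[OF _ t strong_difference_regularity[OF s]])
    show "AE t in lebesgue. t \<in> {0<..<T} \<longrightarrow> (\<exists>d. ((\<lambda>t. y t - z t) has_vector_derivative d) (at t) \<and>
     inner d (y t - z t) \<le> (\<omega> + L + 1) * (norm (y t - z t))\<^sup>2 + 0 * (norm (0::'a) + norm (0::'a)) + (\<eta> + \<theta>)\<^sup>2)"
      using strong_difference[OF s]
    proof eventually_elim
      case (elim t)
      have "(norm (f t) + norm (g t)) * norm (y t - z t) \<le> (norm (y t - z t))\<^sup>2 + (\<eta> + \<theta>)\<^sup>2" if "t \<in> {0<..<T}"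
      proof -
        have "(norm (f t) + norm (g t)) * norm (y t - z t) \<le> (\<eta> + \<theta>) * norm (y t - z t)"
          using \<eta>[of t] that by (intro mult_right_mono add_mono) auto
        moreover have "2 * ((\<eta> + \<theta>) * norm (y t - z t)) \<le> (norm (y t - z t))\<^sup>2 + (\<eta> + \<theta>)\<^sup>2"
          using zero_le_power2[of "\<eta> + \<theta> - norm (y t - z t)"] 
          unfolding power2_diff by (simp only: mult.assoc)
        moreover have "0 \<le> (norm (y t - z t))\<^sup>2 + (\<eta> + \<theta>)\<^sup>2" by simp
        ultimately show ?thesis by linarith
      qed
      then show ?case using elim by (fastforce simp: algebra_simps)
    qed
  qed (use \<omega>_nonneg L_nonneg L1_fun_zero in auto)
  then show ?thesis by simp
qed

lemma weak_solution_exists: "\<exists>y. weak y0 y"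
proof -
  define \<eta> where "\<eta> = (\<lambda>n. inverse (real (Suc n)))"
  have \<eta>: "\<eta> n > 0" "\<eta> \<longlonglongrightarrow> 0" for n using LIMSEQ_inverse_real_of_nat by (auto simp: \<eta>_def)
  have \<eta>_anti: "\<eta> n \<le> \<eta> m" if "m \<le> n" for m n using that by (simp add: \<eta>_def)
  \<comment> \<open>The \<open>n\<close>-th approximant lives on \<open>[0, n + 1]\<close>, so a
    single sequence, with a single pointwise limit, serves every horizon \<open>T\<close>.\<close>
  have "\<exists>y f. norm (y 0 - y0) \<le> \<eta> n \<and> L1_fun (real (Suc n)) f \<and> strong (real (Suc n)) f y \<and>
      (\<forall>t\<in>{0..real (Suc n)}. norm (f t) \<le> \<eta> n)" for n
    by (rule near_strong_solution) (use \<eta> in auto)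
  then obtain yn fn where yn: "\<And>n. norm (yn n 0 - y0) \<le> \<eta> n" "\<And>n. L1_fun (real (Suc n)) (fn n)"
    "\<And>n. strong (real (Suc n)) (fn n) (yn n)" "\<And>n t. t \<in> {0..real (Suc n)} \<Longrightarrow> norm (fn n t) \<le> \<eta> n"
    by metis
  define y where "y = (\<lambda>t. lim (\<lambda>n. yn n t))"
  have unif: "uniform_limit {0..T} yn y sequentially" if T: "T > 0" for T
  proof -
    have "uniformly_Cauchy_on {0..T} yn"
    proof (rule uniformly_Cauchy_onI)
      fix e :: real assume e: "e > 0"
      define E where "E = exp (2 * (\<omega> + L + 1) * T)"
      have "(\<lambda>N. E * ((2 * \<eta> N)\<^sup>2 + 2 * (2 * \<eta> N)\<^sup>2 * T)) \<longlonglongrightarrow> E * ((2 * 0)\<^sup>2 + 2 * (2 * 0)\<^sup>2 * T)"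
        by (intro tendsto_intros \<eta>)
      then have 1: "\<forall>\<^sub>F N in sequentially. E * ((2 * \<eta> N)\<^sup>2 + 2 * (2 * \<eta> N)\<^sup>2 * T) < e\<^sup>2"
        using e by (intro order_tendstoD(2)) auto
      have 2: "\<forall>\<^sub>F N in sequentially. real N \<ge> T"
        using filterlim_real_sequentially by (simp add: filterlim_at_top)
      obtain N where N: "E * ((2 * \<eta> N)\<^sup>2 + 2 * (2 * \<eta> N)\<^sup>2 * T) < e\<^sup>2" "real N \<ge> T"
        using eventually_happens'[OF sequentially_bot eventually_conj[OF 1 2]] by blast
      have "dist (yn m t) (yn n t) < e" if "t \<in> {0..T}" "m \<ge> N" "n \<ge> N" for t m n
      proof -
        have TT: "T \<le> real (Suc m)" "T \<le> real (Suc n)" using N(2) that by auto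
        have "(norm (yn m t - yn n t))\<^sup>2 \<le> exp (2 * (\<omega> + L + 1) * t) *
            ((norm (yn m 0 - yn n 0))\<^sup>2 + 2 * (\<eta> m + \<eta> n)\<^sup>2 * t)"
          by (rule strong_compare_uniform[OF strong_solution_mono[OF yn(3) TT(1)] strong_solution_mono[OF yn(3) TT(2)]])
            (use yn(4) that TT in auto)
        also have "\<dots> \<le> E * ((2 * \<eta> N)\<^sup>2 + 2 * (2 * \<eta> N)\<^sup>2 * T)"
        proof (intro mult_mono add_mono)
          show "exp (2 * (\<omega> + L + 1) * t) \<le> E"
            using that \<omega>_nonneg L_nonneg by (simp add: E_def mult_left_mono)
          have "norm (yn m 0 - yn n 0) \<le> norm (yn m 0 - y0) + norm (yn n 0 - y0)"
            by (metis norm_minus_commute norm_triangle_sub norm_diff_triangle_le order_refl)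
          also have "\<dots> \<le> 2 * \<eta> N"
            using yn(1)[of m] yn(1)[of n] \<eta>_anti[OF that(2)] \<eta>_anti[OF that(3)] by linarith
          finally show "(norm (yn m 0 - yn n 0))\<^sup>2 \<le> (2 * \<eta> N)\<^sup>2" by (intro power_mono) auto
          have "\<eta> m + \<eta> n \<le> 2 * \<eta> N" "0 \<le> \<eta> m + \<eta> n"
            using \<eta>(1)[of m] \<eta>(1)[of n] \<eta>_anti[OF that(2)] \<eta>_anti[OF that(3)] by linarith+
          then show "(\<eta> m + \<eta> n)\<^sup>2 \<le> (2 * \<eta> N)\<^sup>2" by (intro power_mono) auto
        qed (use that E_def in auto)
        also have "\<dots> < e\<^sup>2" by (rule N)
        finally show ?thesis using e by (simp add: dist_norm power_less_imp_less_base)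
      qed
      then show "\<exists>M. \<forall>t\<in>{0..T}. \<forall>m\<ge>M. \<forall>n\<ge>M. dist (yn m t) (yn n t) < e" by blast
    qed
    then show ?thesis
      using Cauchy_uniformly_convergent uniformly_convergent_uniform_limit_iff unfolding y_def by blast
  qed
  have y_cont: "continuous_on {0..T} y" if T: "T > 0" for T
  proof (rule uniform_limit_theorem[OF _ unif[OF T]])
    have "\<forall>\<^sub>F N in sequentially. real N \<ge> T"
      using filterlim_real_sequentially by (simp add: filterlim_at_top)
    then show "\<forall>\<^sub>F n in sequentially. continuous_on {0..T} (yn n)"
    proof eventually_elim
      case (elim n)
      have "strong T (fn n) (yn n)" by (rule strong_solution_mono[OF yn(3)]) (use elim in simp)
      then show ?case by (simp add: strong_solution_def)
    qed
  qed simp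
  have "weak y0 y"
    unfolding weak_solution_def
  proof (intro conjI allI impI)
    show "continuous_on {0..} y"
      unfolding continuous_on_eq_continuous_within
    proof
      fix t :: real assume "t \<in> {0..}"
      then have "continuous (at t within {0..t + 1}) y"
        using y_cont[of "t + 1"] by (simp add: continuous_on_eq_continuous_within)
      moreover have "at t within {0..} = at t within {0..t + 1}"
        by (rule at_within_nhd[of _ "{t-1<..<t+1}"]) auto
      ultimately show "continuous (at t within {0..}) y" by (simp add: continuous_within)
    qed
    have "(\<lambda>n. yn n 0) \<longlonglongrightarrow> y 0"
      by (rule tendsto_uniform_limitI[OF unif[of 1]]) auto
    moreover have "(\<lambda>n. yn n 0) \<longlonglongrightarrow> y0"
      by (rule LIM_zero_cancel, rule Lim_null_comparison[OF _ \<eta>(2)]) (simp add: yn(1))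
    ultimately show "y 0 = y0" by (rule LIMSEQ_unique)
    fix T :: real assume T: "T > 0"
    obtain N where N: "real N \<ge> T" using real_arch_simple by blast
    \<comment> \<open>Discarding the first \<open>N\<close> approximants leaves only those defined
      on all of \<open>[0, T]\<close>.\<close>
    have TT: "T \<le> real (Suc (n + N))" for n using N by simp
    show "\<exists>yn fn. (\<forall>n. L1_fun T (fn n) \<and> strong T (fn n) (yn n)) \<and>
        (\<lambda>n. L1_norm T (fn n)) \<longlonglongrightarrow> 0 \<and> uniform_limit {0..T} yn y sequentially"
    proof (rule exI[of _ "\<lambda>n. yn (n + N)"], rule exI[of _ "\<lambda>n. fn (n + N)"], intro conjI allI)
      show "L1_fun T (fn (n + N))" "strong T (fn (n + N)) (yn (n + N))" for n
        by (rule L1_fun_mono[OF yn(2) TT] strong_solution_mono[OF yn(3) TT])+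
      have le: "L1_norm T (fn (n + N)) \<le> ennreal (\<eta> (n + N) * T)" for n
        by (rule L1_norm_le_const) (use yn(4)[of _ "n + N"] TT[of n] T \<eta>(1)[of "n + N"] in auto)
      have "(\<lambda>n. ennreal (\<eta> (n + N) * T)) \<longlonglongrightarrow> 0"
        using tendsto_ennrealI[OF tendsto_mult[OF LIMSEQ_ignore_initial_segment[OF \<eta>(2), of N] tendsto_const[of T]]]
        by simp
      then show "(\<lambda>n. L1_norm T (fn (n + N))) \<longlonglongrightarrow> 0"
        by (rule tendsto_sandwich[OF _ _ tendsto_const, rotated 2]) (use le in simp_all)
      show "uniform_limit {0..T} (\<lambda>n. yn (n + N)) y sequentially"
        using filterlim_compose[OF unif[OF T] filterlim_add_const_nat_at_top[of N]] .
    qed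
  qed
  then show ?thesis by blast
qed

section \<open>Comparison and uniqueness of weak solutions\<close>

lemma weak_solution_approximation:
  assumes "weak y0 y" "T > 0"
  obtains yn fn where "\<And>n. L1_fun T (fn n)" "\<And>n. strong T (fn n) (yn n)"
    "(\<lambda>n. enn2real (L1_norm T (fn n))) \<longlonglongrightarrow> 0" "uniform_limit {0..T} yn y sequentially"
proof -
  obtain yn fn where "\<forall>n. L1_fun T (fn n) \<and> strong T (fn n) (yn n)"
    "(\<lambda>n. L1_norm T (fn n)) \<longlonglongrightarrow> 0" "uniform_limit {0..T} yn y sequentially"
    using assms unfolding weak_solution_def by blast
  then show thesis using that L1_norm_enn2real_tendsto by blast
qed

lemma weak_continuous: "weak y0 y \<Longrightarrow> a \<ge> 0 \<Longrightarrow> continuous_on {a..T} y"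
  unfolding weak_solution_def by (auto intro: continuous_on_subset)

text \<open>The forcing disappears in the limit of the comparison for approximants. Besides
  uniqueness, the case \<open>z = 0\<close> supplies the bound for bounded times in Lyapunov
  stability.\<close>

lemma weak_compare:
  assumes y: "weak y0 y" and z: "weak z0 z" and t: "t \<ge> 0"
  shows "norm (y t - z t) \<le> exp ((\<omega> + L) * t) * norm (y0 - z0)"
proof -
  define T where "T = t + 1"
  have T: "T > 0" "t \<le> T" using t by (auto simp: T_def)
  obtain yn fn where yn: "\<And>n. L1_fun T (fn n)" "\<And>n. strong T (fn n) (yn n)"
    "(\<lambda>n. enn2real (L1_norm T (fn n))) \<longlonglongrightarrow> 0" "uniform_limit {0..T} yn y sequentially"
    using weak_solution_approximation[OF y T(1)] by metis
  obtain zn gn where zn: "\<And>n. L1_fun T (gn n)" "\<And>n. strong T (gn n) (zn n)"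
    "(\<lambda>n. enn2real (L1_norm T (gn n))) \<longlonglongrightarrow> 0" "uniform_limit {0..T} zn z sequentially"
    using weak_solution_approximation[OF z T(1)] by metis
  have lim: "uniform_limit {0..T} (\<lambda>n r. yn n r - zn n r) (\<lambda>r. y r - z r) sequentially"
    by (intro uniform_limit_intros yn zn)
  have "compact ((\<lambda>r. y r - z r) ` {0..T})"
    by (intro compact_continuous_image continuous_on_diff weak_continuous[OF y] weak_continuous[OF z]) auto
  then obtain M where M: "\<And>r. r \<in> {0..T} \<Longrightarrow> norm (y r - z r) \<le> M"
    using compact_imp_bounded by (fastforce simp: bounded_iff)
  have "\<forall>\<^sub>F n in sequentially. \<forall>r\<in>{0..T}. dist (yn n r - zn n r) (y r - z r) < 1"
    by (rule uniform_limitD[OF lim]) simp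
  then have ev: "\<forall>\<^sub>F n in sequentially. (norm (yn n t - zn n t))\<^sup>2 \<le> exp (2 * (\<omega> + L) * t) * ((norm (yn n 0 - zn n 0))\<^sup>2 +
    2 * (M + 1) * (enn2real (L1_norm T (fn n)) + enn2real (L1_norm T (gn n))))"
  proof eventually_elim
    case (elim n)
    show ?case
    proof (rule strong_compare_L1[OF yn(2) zn(2) yn(1) zn(1) _ t T(2)])
      fix r assume r: "r \<in> {0..T}"
      have "norm (yn n r - zn n r) \<le> norm (y r - z r) + norm ((yn n r - zn n r) - (y r - z r))"
        by (rule norm_triangle_sub)
      then show "norm (yn n r - zn n r) \<le> M + 1"
        using M[OF r] elim r by (force simp: dist_norm)
    qed
  qed
  have "(norm (y t - z t))\<^sup>2 \<le> exp (2 * (\<omega> + L) * t) * ((norm (y 0 - z 0))\<^sup>2 + 2 * (M + 1) * (0 + 0))"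
  proof (rule tendsto_le[OF sequentially_bot _ _ ev])
    show "(\<lambda>n. (norm (yn n t - zn n t))\<^sup>2) \<longlonglongrightarrow> (norm (y t - z t))\<^sup>2"
      using tendsto_uniform_limitI[OF lim, of t] t T by (intro tendsto_power tendsto_norm) auto
    show "(\<lambda>n. exp (2 * (\<omega> + L) * t) * ((norm (yn n 0 - zn n 0))\<^sup>2 +
      2 * (M + 1) * (enn2real (L1_norm T (fn n)) + enn2real (L1_norm T (gn n)))))
      \<longlonglongrightarrow> exp (2 * (\<omega> + L) * t) * ((norm (y 0 - z 0))\<^sup>2 + 2 * (M + 1) * (0 + 0))"
      using tendsto_uniform_limitI[OF lim, of 0] T
      by (intro tendsto_mult tendsto_add tendsto_const tendsto_power tendsto_norm yn zn) auto
  qed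
  also have "\<dots> = (exp ((\<omega> + L) * t) * norm (y0 - z0))\<^sup>2"
    using y z by (simp add: weak_solution_def power_mult_distrib power2_eq_square exp_add[symmetric])
  finally show ?thesis by (rule power2_le_imp_le) simp
qed

lemma D_zero: "0 \<in> D" "A 0 = 0"
proof -
  obtain x where "x \<in> smooth_vectors" using smooth_vectors_dense[of 1] by auto
  then have "x \<in> D" by (rule smooth_vectors_D)
  then show "0 \<in> D" "A 0 = 0" using D_diff[of x x] by auto
qed

lemma weak_zero: "weak 0 (\<lambda>_. 0)"
proof -
  have "strong T (\<lambda>_. 0) (\<lambda>_. 0)" for T
    unfolding strong_solution_def
    by (auto simp: D_zero feedback_term_def B_P B_zero
        intro!: lipschitz_imp_abs_continuous_on[where L = 0] lipschitz_onI)
  then show ?thesis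
    unfolding weak_solution_def
    by (auto simp: L1_fun_zero intro!: exI[of _ "\<lambda>_ _. 0"] uniform_limit_const)
qed

lemma globally_well_posed: "globally_well_posed (weak_solution D A (feedback_term B P \<phi> \<mu>))"
  unfolding globally_well_posed_def
proof
  fix y0
  obtain y where y: "weak y0 y" using weak_solution_exists by blast
  have "z t = y t" if "weak y0 z" "t \<ge> 0" for z t
    using weak_compare[OF that(1) y that(2)] by simp
  with y show "\<exists>y. weak y0 y \<and> (\<forall>z. weak y0 z \<longrightarrow> (\<forall>t\<ge>0. z t = y t))" by blast
qed

end

section \<open>Finite-time stability\<close>

context closed_loop
begin

definition V :: "'a \<Rightarrow> real" where "V x = inner (B x) x"

lemma V_nonneg: "V x \<ge> 0" by (simp add: V_def B_positive)

lemma V_continuous: "continuous_on UNIV V"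
  unfolding V_def by (intro continuous_on_inner linear_continuous_on B_bounded continuous_on_id)

lemma V_tendsto: "(u \<longlongrightarrow> x) net \<Longrightarrow> ((\<lambda>n. V (u n)) \<longlongrightarrow> V x) net"
  unfolding V_def by (intro tendsto_inner bounded_linear.tendsto[OF B_bounded])

lemma V_eq_0_iff: "V x = 0 \<longleftrightarrow> B x = 0"
  by (simp add: V_def B_eq_0_iff p_def)

lemma B_norm: "norm (B x) \<le> onorm B * norm x"
  by (rule onorm[OF B_bounded])

lemma V_diff_le:
  assumes "norm x \<le> M" "norm z \<le> M"
  shows "\<bar>V x - V z\<bar> \<le> onorm B * (2 * M) * norm (x - z)"
proof -
  have "V x - V z = inner (B (x - z)) (x + z)"
    using B_selfadjoint[of x z]
    by (simp add: V_def B_diff inner_diff_left inner_diff_right inner_add_right inner_commute)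
  also have "\<bar>\<dots>\<bar> \<le> norm (B (x - z)) * norm (x + z)" by (rule Cauchy_Schwarz_ineq2)
  also have "\<dots> \<le> (onorm B * norm (x - z)) * (M + M)"
    using assms onorm_pos_le[OF B_bounded]
    by (intro mult_mono B_norm order_trans[OF norm_triangle_ineq] add_mono) auto
  finally show ?thesis by (simp add: mult_ac)
qed

text \<open>The \<open>\<phi>\<close> part of the feedback cancels the bound
  \<open>\<phi>_bound\<close> on the drift, and the power part together with \<open>gap\<close>
  leaves the decay. The \<open>W\<close> component of \<open>A y\<close> does not contribute, being
  orthogonal to \<open>B y\<close>.\<close>

lemma V_dissipation:
  assumes y: "y \<in> D"
  shows "inner (B y) (A y - F y + f) \<le> - \<gamma> * V y powr (1 - \<mu>) + norm (B y) * norm f"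
proof -
  have "inner (A y - A (P y)) (B y) = 0"
  proof -
    have "A y - A (P y) \<in> W" using P_diff_W P_D(2)[OF y] by simp
    then show ?thesis using B_perp by (simp add: W_perp_iff)
  qed
  then have "inner (A y) (B y) = inner (A (P y)) (B y)" by (simp add: inner_diff_left)
  then have "inner (B y) (A y) = inner (A (P y)) (B (P y))" by (metis B_P inner_commute)
  also have "\<dots> \<le> \<phi> (P y) * (norm (B y))\<^sup>2"
    using \<phi>_bound[OF P_perp P_D(1)[OF y]] by (simp add: B_P)
  finally have 1: "inner (B y) (A y) \<le> \<phi> (P y) * (norm (B y))\<^sup>2" .
  have "F y = (V y powr (-\<mu>)) *\<^sub>R B y + \<phi> (P y) *\<^sub>R B y"
    using Y_eq[OF P_perp P_D(1)[OF y]] by (simp add: F_def G_def V_def B_P)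
  then have 2: "inner (B y) (F y) = V y powr (-\<mu>) * (norm (B y))\<^sup>2 + \<phi> (P y) * (norm (B y))\<^sup>2"
    by (simp add: inner_add_right power2_norm_eq_inner)
  have "\<gamma> * V y \<le> (norm (B y))\<^sup>2"
    using gap[OF P_perp[of y]] by (simp add: form_P V_def B_P[of y] form_P[unfolded B_P])
  then have "V y powr (-\<mu>) * (\<gamma> * V y) \<le> V y powr (-\<mu>) * (norm (B y))\<^sup>2"
    by (intro mult_left_mono) auto
  moreover have "V y powr (-\<mu>) * V y = V y powr (1 - \<mu>)"
    using powr_add[of "V y" 1 "-\<mu>"] V_nonneg[of y] by (cases "V y = 0") (simp_all add: mult.commute)
  ultimately have 3: "\<gamma> * V y powr (1 - \<mu>) \<le> V y powr (-\<mu>) * (norm (B y))\<^sup>2"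
    by (simp add: mult.left_commute)
  have "inner (B y) f \<le> norm (B y) * norm f" by (rule norm_cauchy_schwarz)
  then show ?thesis using 1 2 3 by (simp add: inner_diff_right inner_add_right)
qed

text \<open>Two instances matter: \<open>\<psi> = id\<close>, \<open>m = 0\<close>, \<open>k = 0\<close> gives monotonicity of \<open>V\<close>, and
  \<open>\<psi> r = r powr \<mu>\<close>, \<open>k = -2 \<gamma> \<mu>\<close> gives the linear decay of \<open>V powr \<mu>\<close> as long as
  \<open>V\<close> is bounded away from \<open>0\<close>.\<close>

lemma strong_decay:
  assumes st: "strong T f y" "L1_fun T f" and M: "\<And>r. r \<in> {0..T} \<Longrightarrow> norm (y r) \<le> M"
    and m: "\<And>r. r \<in> {0..T} \<Longrightarrow> V (y r) \<ge> m"
    and \<psi>: "\<And>r. r \<ge> m \<Longrightarrow> r \<ge> 0 \<Longrightarrow> (\<psi> has_real_derivative \<psi>' r) (at r)"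
    and \<psi>': "\<And>r. r \<ge> m \<Longrightarrow> r \<ge> 0 \<Longrightarrow> 0 \<le> \<psi>' r \<and> \<psi>' r \<le> Q"
    and k: "\<And>r. r \<ge> m \<Longrightarrow> r \<ge> 0 \<Longrightarrow> - 2 * \<gamma> * (\<psi>' r * r powr (1 - \<mu>)) \<le> k"
    and t: "0 \<le> s" "s \<le> t" "t \<le> T"
  shows "\<psi> (V (y t)) - \<psi> (V (y s)) \<le> 2 * Q * (onorm B * M) * enn2real (L1_norm T f) + k * (t - s)"
proof -
  have M0: "M \<ge> 0" using order_trans[OF norm_ge_zero M[of t]] t by simp
  have mT: "V (y t) \<ge> m" using m[of t] t by simp
  have Q0: "Q \<ge> 0" using \<psi>'[OF mT V_nonneg] by linarith
  have y_cont: "continuous_on {0..T} y" using st(1) by (simp add: strong_solution_def)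
  have Q_lip: "Q-lipschitz_on {max m 0..} \<psi>"
  proof (rule vector_derivative_bound_imp_lipschitz)
    show "(\<psi> has_vector_derivative \<psi>' r) (at r within {max m 0..})" if "r \<in> {max m 0..}" for r
      using \<psi>[of r] that
      by (auto simp: has_real_derivative_iff_has_vector_derivative intro: has_vector_derivative_at_within)
    show "norm (\<psi>' r) \<le> Q" if "r \<in> {max m 0..}" for r using \<psi>'[of r] that by simp
  qed (use Q0 in auto)
  have "\<psi> (V (y t)) - \<psi> (V (y s)) \<le> (2 * Q * (onorm B * M)) *
      (enn2real (L1_norm T f) + enn2real (L1_norm T (\<lambda>_. 0::'a))) + k * (t - s)"
  proof (rule L1_differential_inequality[where a = 0, OF order_refl _ _ _ st(2) L1_fun_zero(1)])
    have "continuous_on {0..T} (\<lambda>r. V (y r))"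
      by (rule continuous_on_compose2[OF V_continuous y_cont]) auto
    then show "continuous_on {0..T} (\<lambda>r. \<psi> (V (y r)))"
      by (rule continuous_on_compose2[OF lipschitz_on_continuous_on[OF Q_lip]])
        (use m V_nonneg in auto)
    show "abs_continuous_on {r..u} (\<lambda>r. \<psi> (V (y r)))" if ru: "0 < r" "r \<le> u" "u < T" for r u
    proof (rule abs_continuous_on_dominated[OF strong_solution_abs_continuous[OF st(1) ru]
          strong_solution_abs_continuous[OF st(1) ru], where L = "Q * (onorm B * (2 * M))"])
      fix p q assume pq: "p \<in> {r..u}" "q \<in> {r..u}"
      have "norm (\<psi> (V (y q)) - \<psi> (V (y p))) \<le> Q * \<bar>V (y q) - V (y p)\<bar>"
        using lipschitz_onD[OF Q_lip, of "V (y q)" "V (y p)"] m V_nonneg pq ru by (simp add: dist_real_def)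
      also have "\<dots> \<le> Q * (onorm B * (2 * M) * norm (y q - y p))"
        using pq ru Q0 by (intro mult_left_mono V_diff_le M) auto
      also have "\<dots> = Q * (onorm B * (2 * M)) * norm (y q - y p)" by simp
      also have "\<dots> \<le> Q * (onorm B * (2 * M)) * (norm (y q - y p) + norm (y q - y p))"
        using Q0 M0 onorm_pos_le[OF B_bounded] by (intro mult_left_mono) auto
      finally show "norm (\<psi> (V (y q)) - \<psi> (V (y p))) \<le> Q * (onorm B * (2 * M)) * (norm (y q - y p) + norm (y q - y p))" .
    qed
    have "AE t in lebesgue. t \<in> {0<..<T} \<longrightarrow>
        y t \<in> D \<and> (y has_vector_derivative (A (y t) - feedback_term B P \<phi> \<mu> (y t) + f t)) (at t)"
      using st(1) by (simp add: strong_solution_def)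
    then show "AE t in lebesgue. t \<in> {0<..<T} \<longrightarrow> (\<exists>d. ((\<lambda>r. \<psi> (V (y r))) has_real_derivative d) (at t) \<and>
       d \<le> 2 * Q * (onorm B * M) * (norm (f t) + norm (0::'a)) + k)"
    proof eventually_elim
      case (elim t)
      show ?case
      proof
        assume t: "t \<in> {0<..<T}"
        let ?d = "A (y t) - F (y t) + f t"
        from elim t have yt: "y t \<in> D" and "(y has_vector_derivative ?d) (at t)"
          by (auto simp: feedback_term_eq)
        then have "((\<lambda>r. V (y r)) has_vector_derivative (inner (B (y t)) ?d + inner (B ?d) (y t))) (at t)"
          unfolding V_def
          by (intro bounded_bilinear.has_vector_derivative[OF bounded_bilinear_inner]
              bounded_linear.has_vector_derivative[OF B_bounded])
        moreover have "inner (B ?d) (y t) = inner (B (y t)) ?d"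
          using B_selfadjoint[of ?d "y t"] by (simp only: inner_commute)
        ultimately have V': "((\<lambda>r. V (y r)) has_real_derivative (2 * inner (B (y t)) ?d)) (at t)"
          by (simp add: has_real_derivative_iff_has_vector_derivative)
        define v where "v = V (y t)"
        have v: "v \<ge> m" "v \<ge> 0" using m[of t] t V_nonneg by (auto simp: v_def)
        have "((\<lambda>r. \<psi> (V (y r))) has_real_derivative (\<psi>' v * (2 * inner (B (y t)) ?d))) (at t)"
          using DERIV_chain2[OF \<psi>[OF v, unfolded v_def] V'] by (simp add: v_def)
        moreover have "\<psi>' v * (2 * inner (B (y t)) ?d) \<le> 2 * Q * (onorm B * M) * (norm (f t) + norm (0::'a)) + k"
        proof -
          have "\<psi>' v * (2 * inner (B (y t)) ?d) \<le> \<psi>' v * (2 * (- \<gamma> * v powr (1 - \<mu>) + norm (B (y t)) * norm (f t)))"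
            using V_dissipation[OF yt, of "f t"] \<psi>'[OF v] by (intro mult_left_mono) (auto simp: v_def)
          also have "\<dots> = - 2 * \<gamma> * (\<psi>' v * v powr (1 - \<mu>)) + \<psi>' v * (2 * (norm (B (y t)) * norm (f t)))"
            by (simp add: algebra_simps)
          also have "\<dots> \<le> k + Q * (2 * ((onorm B * M) * norm (f t)))"
          proof (intro add_mono k v mult_mono mult_left_mono mult_right_mono)
            show "norm (B (y t)) \<le> onorm B * M"
              using M[of t] t by (intro order_trans[OF B_norm] mult_left_mono onorm_pos_le[OF B_bounded]) auto
          qed (use \<psi>'[OF v] Q0 M0 onorm_pos_le[OF B_bounded] in auto)
          finally show ?thesis by simp
        qed
        ultimately show "\<exists>d. ((\<lambda>r. \<psi> (V (y r))) has_real_derivative d) (at t) \<and>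
            d \<le> 2 * Q * (onorm B * M) * (norm (f t) + norm (0::'a)) + k" by blast
      qed
    qed
  qed (use t Q0 M0 onorm_pos_le[OF B_bounded] in auto)
  then show ?thesis by (simp add: L1_fun_zero)
qed

lemma weak_norm_bound:
  assumes "weak y0 y" "0 \<le> a"
  obtains M where "M \<ge> 0" "\<And>r. r \<in> {a..T} \<Longrightarrow> norm (y r) \<le> M"
proof -
  have "bounded (y ` {a..T})"
    by (intro compact_imp_bounded compact_continuous_image weak_continuous[OF assms]) auto
  then obtain M where "\<forall>x\<in>y ` {a..T}. norm x \<le> M"
    by (auto simp: bounded_iff)
  then show thesis by (intro that[of "max M 0"]) (auto simp: le_max_iff_disj)
qed

text \<open>The lower bound on \<open>V\<close> is asked with \<open>2 * m\<close> along the weak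
  solution so that approximants, close only up to a uniform error, still satisfy it with
  \<open>m\<close>. For \<open>m = 0\<close> nonnegativity of \<open>V\<close> suffices.\<close>

lemma weak_decay:
  assumes y: "weak y0 y" and T: "T > 0"
    and m: "m = 0 \<or> m > 0 \<and> (\<forall>r\<in>{0..T}. V (y r) \<ge> 2 * m)"
    and \<psi>: "\<And>r. r \<ge> m \<Longrightarrow> (\<psi> has_real_derivative \<psi>' r) (at r)"
    and \<psi>': "\<And>r. r \<ge> m \<Longrightarrow> 0 \<le> \<psi>' r \<and> \<psi>' r \<le> Q"
    and k: "\<And>r. r \<ge> m \<Longrightarrow> - 2 * \<gamma> * (\<psi>' r * r powr (1 - \<mu>)) \<le> k"
    and t: "0 \<le> s" "s \<le> t" "t \<le> T"
  shows "\<psi> (V (y t)) - \<psi> (V (y s)) \<le> k * (t - s)"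
proof -
  obtain yn fn where yn: "\<And>n. L1_fun T (fn n)" "\<And>n. strong T (fn n) (yn n)"
    "(\<lambda>n. enn2real (L1_norm T (fn n))) \<longlonglongrightarrow> 0" "uniform_limit {0..T} yn y sequentially"
    using weak_solution_approximation[OF y T] by metis
  obtain M where M: "M \<ge> 0" "\<And>r. r \<in> {0..T} \<Longrightarrow> norm (y r) \<le> M"
    using weak_norm_bound[OF y order_refl, of T] by blast
  define K where "K = onorm B * (2 * (M + 1))"
  have K: "K \<ge> 0" using M onorm_pos_le[OF B_bounded] by (simp add: K_def)
  \<comment> \<open>Approximants within distance 1 of \<open>y\<close> stay in the ball of radius
    \<open>M + 1\<close>, where \<open>K\<close> is a Lipschitz constant of \<open>V\<close>; within
    distance \<open>e\<close> they therefore change \<open>V\<close> by at most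
    \<open>m\<close>.\<close>
  define e where "e = (if m = 0 then 1 else min 1 (m / (K + 1)))"
  have e: "e > 0" "e \<le> 1" using m K by (auto simp: e_def)
  have Ke: "K * e \<le> m" if "m > 0"
  proof -
    have "K * e \<le> (K + 1) * (m / (K + 1))"
      using that K by (intro mult_mono) (auto simp: e_def)
    then show ?thesis using K by simp
  qed
  have "\<forall>\<^sub>F n in sequentially. \<forall>r\<in>{0..T}. dist (yn n r) (y r) < e"
    by (rule uniform_limitD[OF yn(4) e(1)])
  then have ev: "\<forall>\<^sub>F n in sequentially. \<psi> (V (yn n t)) - \<psi> (V (yn n s))
      \<le> 2 * Q * (onorm B * (M + 1)) * enn2real (L1_norm T (fn n)) + k * (t - s)"
  proof eventually_elim
    case (elim n)
    have bound: "norm (yn n r) \<le> M + 1" if "r \<in> {0..T}" for r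
    proof -
      have "norm (yn n r) \<le> norm (y r) + norm (yn n r - y r)" by (rule norm_triangle_sub)
      moreover have "norm (yn n r - y r) < e" using elim that by (simp add: dist_norm)
      ultimately show ?thesis using M(2)[OF that] e(2) by linarith
    qed
    have "V (yn n r) \<ge> m" if r: "r \<in> {0..T}" for r
    proof (cases "m = 0")
      case False
      with m have mm: "m > 0" "V (y r) \<ge> 2 * m" using r by auto
      have "\<bar>V (yn n r) - V (y r)\<bar> \<le> K * norm (yn n r - y r)"
        unfolding K_def using bound[OF r] M(2)[OF r] by (intro V_diff_le) auto
      also have "\<dots> \<le> K * e" using elim r K by (intro mult_left_mono) (auto simp: dist_norm less_imp_le)
      also have "\<dots> \<le> m" by (rule Ke[OF mm(1)])
      finally show ?thesis using mm(2) by linarith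
    qed (simp add: V_nonneg)
    then show ?case
      using strong_decay[OF yn(2) yn(1) bound _ \<psi> \<psi>' k t] by blast
  qed
  have mV: "V (y r) \<ge> m" if "r \<in> {0..T}" for r
    using m that V_nonneg[of "y r"] by fastforce
  have lim: "(\<lambda>n. \<psi> (V (yn n r))) \<longlonglongrightarrow> \<psi> (V (y r))" if "r \<in> {0..T}" for r
    using isCont_tendsto_compose[OF DERIV_isCont[OF \<psi>[OF mV[OF that]]]
        V_tendsto[OF tendsto_uniform_limitI[OF yn(4) that]]] .
  have "\<psi> (V (y t)) - \<psi> (V (y s)) \<le> 2 * Q * (onorm B * (M + 1)) * 0 + k * (t - s)"
  proof (rule tendsto_le[OF sequentially_bot _ _ ev])
    show "(\<lambda>n. 2 * Q * (onorm B * (M + 1)) * enn2real (L1_norm T (fn n)) + k * (t - s))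
        \<longlonglongrightarrow> 2 * Q * (onorm B * (M + 1)) * 0 + k * (t - s)"
      by (intro tendsto_add tendsto_mult tendsto_const yn(3))
    show "(\<lambda>n. \<psi> (V (yn n t)) - \<psi> (V (yn n s))) \<longlonglongrightarrow> \<psi> (V (y t)) - \<psi> (V (y s))"
      using t by (intro tendsto_diff lim) auto
  qed
  then show ?thesis by simp
qed

lemma V_decreasing:
  assumes "weak y0 y" "0 \<le> s" "s \<le> t"
  shows "V (y t) \<le> V (y s)"
proof -
  have "V (y t) - V (y s) \<le> 0 * (t - s)"
    by (rule weak_decay[OF assms(1), of "t + 1" 0 "\<lambda>r. r" "\<lambda>_. 1" 1])
      (use assms \<gamma>_pos in auto)
  then show ?thesis by simp
qed

text \<open>As \<open>V\<close> decreases along \<open>y\<close>, its value at the final time bounds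
  it from below on all of \<open>[0, t]\<close>; half of that value is the threshold
  \<open>m\<close> that \<open>weak_decay\<close> asks for.\<close>

lemma V_powr_decay:
  assumes y: "weak y0 y" and t: "t \<ge> 0" and pos: "V (y t) > 0"
  shows "V (y t) powr \<mu> \<le> V y0 powr \<mu> - 2 * \<gamma> * \<mu> * t"
proof (cases "t = 0")
  case True
  then show ?thesis using y by (simp add: weak_solution_def)
next
  case False
  define m where "m = V (y t) / 2"
  have m: "m > 0" using pos by (simp add: m_def)
  have "V (y t) powr \<mu> - V (y 0) powr \<mu> \<le> (- 2 * \<gamma> * \<mu>) * (t - 0)"
  proof (rule weak_decay[OF y, of t m "\<lambda>r. r powr \<mu>" "\<lambda>r. \<mu> * r powr (\<mu> - 1)" "\<mu> * m powr (\<mu> - 1)"])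
    show "m = 0 \<or> m > 0 \<and> (\<forall>r\<in>{0..t}. V (y r) \<ge> 2 * m)"
      using m V_decreasing[OF y] by (auto simp: m_def)
    fix r assume r: "r \<ge> m"
    then have r0: "r > 0" using m by simp
    show "((\<lambda>r. r powr \<mu>) has_real_derivative \<mu> * r powr (\<mu> - 1)) (at r)"
      using r0 by (rule has_real_derivative_powr)
    show "0 \<le> \<mu> * r powr (\<mu> - 1) \<and> \<mu> * r powr (\<mu> - 1) \<le> \<mu> * m powr (\<mu> - 1)"
      using mu r m by (auto intro!: mult_left_mono powr_mono2')
    have "r powr (\<mu> - 1) * r powr (1 - \<mu>) = 1"
      using r0 by (simp flip: powr_add)
    then show "- 2 * \<gamma> * (\<mu> * r powr (\<mu> - 1) * r powr (1 - \<mu>)) \<le> - 2 * \<gamma> * \<mu>"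
      by (simp add: mult.assoc)
  qed (use False t in auto)
  then show ?thesis using y by (simp add: weak_solution_def)
qed

lemma B_vanishes:
  assumes y: "weak y0 y" and t: "t \<ge> V y0 powr \<mu> / (2 * \<gamma> * \<mu>)"
  shows "B (y t) = 0"
proof -
  have c: "2 * \<gamma> * \<mu> > 0" using \<gamma>_pos mu by simp
  have "V y0 powr \<mu> / (2 * \<gamma> * \<mu>) \<ge> 0" using c by simp
  then have t0: "t \<ge> 0" using t by linarith
  have "V y0 powr \<mu> \<le> 2 * \<gamma> * \<mu> * t" using t c by (simp add: field_simps)
  then have "\<not> V (y t) > 0"
    using V_powr_decay[OF y t0] by (metis diff_le_0_iff_le less_le_not_le order_trans powr_gt_zero)
  then show ?thesis using V_nonneg[of "y t"] V_eq_0_iff by force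
qed

section \<open>Linear evolution of components not reached by the feedback\<close>

lemma Y_perp: "x \<in> W\<^sup>\<bottom> \<Longrightarrow> Y x \<in> W\<^sup>\<bottom>"
proof -
  assume x: "x \<in> W\<^sup>\<bottom>"
  obtain z where z: "\<And>n. z n \<in> smooth_vectors" "z \<longlonglongrightarrow> x" using smooth_vectors_dense_sequence by blast
  have "(\<lambda>n. P (z n)) \<longlonglongrightarrow> x"
    using bounded_linear.tendsto[OF P_bounded_linear z(2)] P_id[OF x] by simp
  then have lim: "(\<lambda>n. Y (P (z n))) \<longlonglongrightarrow> Y x" by (rule Y_tendsto[OF _ x P_perp])
  have "inner w (Y (P (z n))) = 0" if "w \<in> W" for w n
    using Y_eq[OF P_perp P_D(1)[OF smooth_vectors_D[OF z(1)]]] B_perp that by (simp add: W_perp_iff)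
  then have "inner w (Y x) = 0" if "w \<in> W" for w
    using tendsto_inner[OF tendsto_const[of w] lim] that by (simp add: LIMSEQ_const_iff)
  then show ?thesis by (simp add: W_perp_iff)
qed

lemma F_perp: "F x \<in> W\<^sup>\<bottom>"
  unfolding F_def G_def
  by (intro subspace_add subspace_mul subspace_orthogonal_comp B_perp Y_perp P_perp)

lemma F_kernel: "B x = 0 \<Longrightarrow> F x = 0"
  using Y_kernel[OF P_perp, of x] by (simp add: F_def G_def B_P)

text \<open>Used for the identity, after \<open>B y\<close> has vanished, and for
  \<open>x - P x\<close>, from time 0. The approximants are compared with smooth orbits, which can
  be differentiated, and density replaces the smooth initial state by
  \<open>R (y a)\<close>.\<close>

lemma weak_linear_evolution:
  assumes y: "weak y0 y" and R: "bounded_linear R" and comm: "\<And>t x. t \<ge> 0 \<Longrightarrow> S t (R x) = R (S t x)"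
    and RF: "\<And>r. r \<ge> a \<Longrightarrow> R (F (y r)) = 0" and t: "0 \<le> a" "a \<le> t"
  shows "R (y t) = S (t - a) (R (y a))"
proof -
  define T where "T = t + 1"
  have T: "T > 0" "t \<le> T" "a \<le> T" using t by (auto simp: T_def)
  obtain yn fn where yn: "\<And>n. L1_fun T (fn n)" "\<And>n. strong T (fn n) (yn n)"
    "(\<lambda>n. enn2real (L1_norm T (fn n))) \<longlonglongrightarrow> 0" "uniform_limit {0..T} yn y sequentially"
    using weak_solution_approximation[OF y T(1)] by metis
  define K where "K = onorm R"
  have K: "K \<ge> 0" "\<And>x. norm (R x) \<le> K * norm x"
    by (auto simp: K_def onorm_pos_le[OF R] onorm[OF R])
  note R_diff = linear_diff[OF bounded_linear.linear[OF R]]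
  obtain My where My: "My \<ge> 0" "\<And>r. r \<in> {0..T} \<Longrightarrow> norm (y r) \<le> My"
    using weak_norm_bound[OF y order_refl, of T] by blast
  have est: "(norm (R (y t) - S (t - a) z))\<^sup>2 \<le> exp (2 * \<omega> * (t - a)) * (norm (R (y a) - z))\<^sup>2"
    if z: "z \<in> smooth_vectors" for z
  proof -
    obtain Lz where Lz: "Lz-lipschitz_on {0..T} (\<lambda>t. S t z)" using smooth_orbit_lipschitz[OF z] by blast
    have "bounded ((\<lambda>t. S t z) ` {0..T})"
      by (intro compact_imp_bounded compact_continuous_image continuous_on_subset[OF S_continuous]) auto
    then obtain Mz where "\<forall>x\<in>(\<lambda>t. S t z) ` {0..T}. norm x \<le> Mz"
      by (auto simp: bounded_iff)
    then have Mz: "norm (S r z) \<le> Mz" if "r \<in> {0..T}" for r using that by blast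
    \<comment> \<open>A bound on the difference \<open>R (yn n r) - S (r - a) z\<close>, once
      \<open>yn n\<close> is within 1 of \<open>y\<close>.\<close>
    define M where "M = K * (My + 1) + \<bar>Mz\<bar>"
    have M: "M \<ge> 0" using K My by (simp add: M_def)
    \<comment> \<open>Along the approximants \<open>R (F (yn n r))\<close> need not vanish; uniform
      continuity of \<open>F\<close> makes it at most \<open>K * \<kappa>\<close>, and
      \<open>\<kappa>\<close> tends to 0 only after \<open>n\<close> has tended to infinity.\<close>
    have ev: "(norm (R (y t) - S (t - a) z))\<^sup>2 \<le> exp (2 * \<omega> * (t - a)) *
        ((norm (R (y a) - z))\<^sup>2 + 2 * (K * \<kappa> * M) * (t - a))" if \<kappa>: "\<kappa> > 0" for \<kappa>
    proof -
      obtain d where d: "d > 0" "\<And>x z. norm (x - z) < d \<Longrightarrow> norm (F x - F z) < \<kappa>"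
        using F_uniformly_continuous[OF \<kappa>] by blast
      have "\<forall>\<^sub>F n in sequentially. \<forall>r\<in>{0..T}. dist (yn n r) (y r) < min d 1"
        by (rule uniform_limitD[OF yn(4)]) (use d in simp)
      then have *: "\<forall>\<^sub>F n in sequentially. (norm (R (yn n t) - S (t - a) z))\<^sup>2 \<le> exp (2 * \<omega> * (t - a)) *
        ((norm (R (yn n a) - S (a - a) z))\<^sup>2 + 2 * (K * M) * (enn2real (L1_norm T (fn n)) + enn2real (L1_norm T (\<lambda>_. 0::'a)))
          + 2 * (K * \<kappa> * M) * (t - a))"
      proof eventually_elim
        case (elim n)
        show ?case
        proof (rule L1_energy_inequality[OF t T(2) _ _ _ yn(1) L1_fun_zero(1)])
          have "continuous_on {0..T} (yn n)" using yn(2) by (simp add: strong_solution_def)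
          then have "continuous_on {a..T} (\<lambda>r. R (yn n r))"
            using t by (intro bounded_linear.continuous_on[OF R]) (auto intro: continuous_on_subset)
          moreover have "continuous_on {a..T} (\<lambda>r. S (r - a) z)"
            by (rule continuous_on_compose2[OF S_continuous]) (auto intro!: continuous_intros)
          ultimately show "continuous_on {a..T} (\<lambda>r. R (yn n r) - S (r - a) z)"
            by (rule continuous_on_diff)
          show "abs_continuous_on {r..u} (\<lambda>r. R (yn n r) - S (r - a) z)"
            if ru: "a < r" "r \<le> u" "u < T" for r u
          proof (rule abs_continuous_on_dominated[where z = "\<lambda>r. S (r - a) z" and L = "K + 1"])
            show "abs_continuous_on {r..u} (yn n)"
              by (rule strong_solution_abs_continuous[OF yn(2)]) (use ru t in auto)
            have "Lz-lipschitz_on {r..u} (\<lambda>r. S (r - a) z)"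
            proof (rule lipschitz_onI)
              fix p q assume "p \<in> {r..u}" "q \<in> {r..u}"
              then have "p - a \<in> {0..T}" "q - a \<in> {0..T}" using ru t by auto
              from lipschitz_onD[OF Lz this] show "dist (S (p - a) z) (S (q - a) z) \<le> Lz * dist p q"
                by (simp add: dist_real_def)
            qed (use Lz lipschitz_on_nonneg in blast)
            then show "abs_continuous_on {r..u} (\<lambda>r. S (r - a) z)" by (rule lipschitz_imp_abs_continuous_on)
            fix p q
            have "norm (R (yn n q) - S (q - a) z - (R (yn n p) - S (p - a) z))
                = norm (R (yn n q - yn n p) - (S (q - a) z - S (p - a) z))"
              by (simp add: R_diff algebra_simps)
            also have "\<dots> \<le> K * norm (yn n q - yn n p) + norm (S (q - a) z - S (p - a) z)"
              by (rule order_trans[OF norm_triangle_ineq4]) (simp add: K)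
            also have "\<dots> \<le> (K + 1) * (norm (yn n q - yn n p) + norm (S (q - a) z - S (p - a) z))"
              using K(1) by (simp add: algebra_simps)
            finally show "norm (R (yn n q) - S (q - a) z - (R (yn n p) - S (p - a) z))
                \<le> (K + 1) * (norm (yn n q - yn n p) + norm (S (q - a) z - S (p - a) z))" .
          qed
          have "AE r in lebesgue. r \<in> {0<..<T} \<longrightarrow>
              yn n r \<in> D \<and> (yn n has_vector_derivative (A (yn n r) - feedback_term B P \<phi> \<mu> (yn n r) + fn n r)) (at r)"
            using yn(2) by (simp add: strong_solution_def)
          then show "AE r in lebesgue. r \<in> {a<..<T} \<longrightarrow>
              (\<exists>d. ((\<lambda>r. R (yn n r) - S (r - a) z) has_vector_derivative d) (at r) \<and>
              inner d (R (yn n r) - S (r - a) z) \<le> \<omega> * (norm (R (yn n r) - S (r - a) z))\<^sup>2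
                + K * M * (norm (fn n r) + norm (0::'a)) + K * \<kappa> * M)"
          proof (rule eventually_mono, intro impI)
            fix r assume *: "r \<in> {0<..<T} \<longrightarrow> yn n r \<in> D \<and>
              (yn n has_vector_derivative (A (yn n r) - feedback_term B P \<phi> \<mu> (yn n r) + fn n r)) (at r)"
              "r \<in> {a<..<T}"
            then have r: "a < r" "r \<in> {0..T}" "r - a \<in> {0..T}" using t by auto
            let ?d = "A (yn n r) - F (yn n r) + fn n r"
            have D: "yn n r \<in> D" and der: "(yn n has_vector_derivative ?d) (at r)"
              using * t by (auto simp: feedback_term_eq)
            note RD = generator_bounded_linear_image[OF R comm D]
            have "at (r - a) within {0..} = at (r - a)" using r by (intro at_within_interior) auto
            then have "((\<lambda>s. S s z) has_vector_derivative A (S (r - a) z)) (at (r - a))"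
              using smooth_orbit(2)[OF z, of "r - a"] r by simp
            then have "((\<lambda>s. S s z) \<circ> (\<lambda>s. s - a) has_vector_derivative 1 *\<^sub>R A (S (r - a) z)) (at r)"
              by (intro vector_diff_chain_at) (auto intro!: derivative_eq_intros)
            then have Sder: "((\<lambda>s. S (s - a) z) has_vector_derivative A (S (r - a) z)) (at r)"
              by (simp add: o_def)
            define v where "v = R (yn n r) - S (r - a) z"
            have SD: "S (r - a) z \<in> D" by (rule smooth_orbit(1)[OF z]) (use r in simp)
            have yd: "norm (yn n r - y r) < d" "norm (yn n r - y r) < 1"
              using elim r(2) by (auto simp: dist_norm)
            have v_le: "norm v \<le> M"
            proof -
              have "norm (yn n r) \<le> My + 1"
                using norm_triangle_sub[of "yn n r" "y r"] My(2)[OF r(2)] yd(2) by linarith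
              then have "norm (R (yn n r)) \<le> K * (My + 1)"
                by (intro order_trans[OF K(2)] mult_left_mono K(1))
              moreover have "norm v \<le> norm (R (yn n r)) + norm (S (r - a) z)"
                unfolding v_def by (rule norm_triangle_ineq4)
              ultimately show ?thesis using Mz[OF r(3)] by (simp add: M_def)
            qed
            have RF_le: "norm (R (F (yn n r))) \<le> K * \<kappa>"
            proof -
              have "R (F (yn n r)) = R (F (yn n r) - F (y r))" using RF[of r] r(1) by (simp add: R_diff)
              also have "norm \<dots> \<le> K * norm (F (yn n r) - F (y r))" by (rule K)
              also have "\<dots> \<le> K * \<kappa>" using d(2)[OF yd(1)] K(1) by (intro mult_left_mono) auto
              finally show ?thesis .
            qed
            have "inner (R ?d - A (S (r - a) z)) v = inner (A v) v - inner (R (F (yn n r))) v + inner (R (fn n r)) v"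
              using RD SD by (simp add: v_def D_diff R_diff linear_add[OF bounded_linear.linear[OF R]]
                  inner_diff_left inner_add_left)
            moreover have "inner (A v) v \<le> \<omega> * (norm v)\<^sup>2"
              unfolding v_def by (intro quasi_contractive D_diff RD SD)
            moreover have "- inner (R (F (yn n r))) v \<le> K * \<kappa> * M"
            proof -
              have "- inner (R (F (yn n r))) v \<le> norm (R (F (yn n r))) * norm v"
                using Cauchy_Schwarz_ineq2[of "R (F (yn n r))" v] by linarith
              also have "\<dots> \<le> (K * \<kappa>) * M" using RF_le v_le K \<kappa> by (intro mult_mono) auto
              finally show ?thesis .
            qed
            moreover have "inner (R (fn n r)) v \<le> K * M * (norm (fn n r) + norm (0::'a))"
            proof -
              have "inner (R (fn n r)) v \<le> norm (R (fn n r)) * norm v" by (rule norm_cauchy_schwarz)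
              also have "\<dots> \<le> (K * norm (fn n r)) * M" using K v_le by (intro mult_mono) auto
              finally show ?thesis by (simp add: mult_ac)
            qed
            ultimately have "inner (R ?d - A (S (r - a) z)) v
                \<le> \<omega> * (norm v)\<^sup>2 + K * M * (norm (fn n r) + norm (0::'a)) + K * \<kappa> * M" by linarith
            moreover have "((\<lambda>r. R (yn n r) - S (r - a) z) has_vector_derivative (R ?d - A (S (r - a) z))) (at r)"
              by (intro has_vector_derivative_diff bounded_linear.has_vector_derivative[OF R der] Sder)
            ultimately show "\<exists>d. ((\<lambda>r. R (yn n r) - S (r - a) z) has_vector_derivative d) (at r) \<and>
              inner d (R (yn n r) - S (r - a) z) \<le> \<omega> * (norm (R (yn n r) - S (r - a) z))\<^sup>2
                + K * M * (norm (fn n r) + norm (0::'a)) + K * \<kappa> * M"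
              unfolding v_def by blast
          qed
        qed (use K M \<omega>_nonneg \<kappa> in auto)
      qed
      have lim: "(\<lambda>n. R (yn n r)) \<longlonglongrightarrow> R (y r)" if "r \<in> {0..T}" for r
        by (intro bounded_linear.tendsto[OF R] tendsto_uniform_limitI[OF yn(4) that])
      have "(norm (R (y t) - S (t - a) z))\<^sup>2 \<le> exp (2 * \<omega> * (t - a)) *
        ((norm (R (y a) - S (a - a) z))\<^sup>2 + 2 * (K * M) * (0 + enn2real (L1_norm T (\<lambda>_. 0::'a)))
          + 2 * (K * \<kappa> * M) * (t - a))"
      proof (rule tendsto_le[OF sequentially_bot _ _ *])
        show "(\<lambda>n. (norm (R (yn n t) - S (t - a) z))\<^sup>2) \<longlonglongrightarrow> (norm (R (y t) - S (t - a) z))\<^sup>2"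
          using t T by (intro tendsto_power tendsto_norm tendsto_diff tendsto_const lim) auto
      qed (use t T in \<open>intro tendsto_mult tendsto_add tendsto_const tendsto_power tendsto_norm
            tendsto_diff lim yn(3)\<close>, auto)
      then show ?thesis by (simp add: S_0 L1_fun_zero)
    qed
    have "((\<lambda>\<kappa>. exp (2 * \<omega> * (t - a)) * ((norm (R (y a) - z))\<^sup>2 + 2 * (K * \<kappa> * M) * (t - a)))
        \<longlongrightarrow> exp (2 * \<omega> * (t - a)) * ((norm (R (y a) - z))\<^sup>2 + 2 * (K * 0 * M) * (t - a))) (at_right 0)"
      by (intro tendsto_intros)
    from tendsto_lowerbound[OF this, of "(norm (R (y t) - S (t - a) z))\<^sup>2"]
    show ?thesis using ev by (simp add: eventually_at_right_less[THEN eventually_mono])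
  qed
  obtain z where z: "\<And>n. z n \<in> smooth_vectors" "z \<longlonglongrightarrow> R (y a)" using smooth_vectors_dense_sequence by blast
  have "(norm (R (y t) - S (t - a) (R (y a))))\<^sup>2 \<le> exp (2 * \<omega> * (t - a)) * (norm (R (y a) - R (y a)))\<^sup>2"
  proof (rule LIMSEQ_le)
    show "(\<lambda>n. (norm (R (y t) - S (t - a) (z n)))\<^sup>2) \<longlonglongrightarrow> (norm (R (y t) - S (t - a) (R (y a))))\<^sup>2"
      using t by (intro tendsto_power tendsto_norm tendsto_diff tendsto_const
          bounded_linear.tendsto[OF S_bounded_linear] z(2)) auto
    show "(\<lambda>n. exp (2 * \<omega> * (t - a)) * (norm (R (y a) - z n))\<^sup>2) \<longlonglongrightarrow> exp (2 * \<omega> * (t - a)) * (norm (R (y a) - R (y a)))\<^sup>2"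
      by (intro tendsto_mult tendsto_power tendsto_norm tendsto_diff tendsto_const z(2))
  qed (use est z(1) in blast)
  then show ?thesis by simp
qed

text \<open>With the feedback off from \<open>t\<close> on,
  \<open>B (S s (y t)) = B (y (t + s)) = 0\<close> for every \<open>s \<ge> 0\<close>, which is
  membership of \<open>y t\<close> in \<open>W\<close>. So \<open>y t\<close> equals its own
  \<open>W\<close> component.\<close>

lemma weak_vanishes:
  assumes y: "weak y0 y" and t: "t \<ge> V y0 powr \<mu> / (2 * \<gamma> * \<mu>)" "t \<ge> \<delta>"
  shows "y t = 0"
proof -
  have t0: "t \<ge> 0" using t(2) \<delta>_nonneg by linarith
  have B0: "B (y r) = 0" if "r \<ge> t" for r
    using B_vanishes[OF y] t(1) that by (meson order_trans)
  have "y (t + s) = S s (y t)" if "s \<ge> 0" for s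
    using weak_linear_evolution[OF y bounded_linear_ident _ F_kernel[OF B0] t0, of "t + s"] that by simp
  then have "B (S s (y t)) = 0" if "s \<ge> 0" for s
    using B0[of "t + s"] that by simp
  then have "y t \<in> W" by (simp add: W)
  then have "P (y t) = 0"
    by (intro P_decomposition) (auto simp: subspace_0 subspace_orthogonal_comp)
  then have "y t = y t - P (y t)" by simp
  \<comment> \<open>The evolution is started at 0 and not at the time when \<open>B y\<close>
    vanishes, since \<open>F\<close> never has a component in \<open>W\<close>; so nilpotency may
    use the whole span \<open>t\<close>.\<close>
  also have "\<dots> = S (t - 0) (y 0 - P (y 0))"
  proof (rule weak_linear_evolution[OF y, where R = "\<lambda>x. x - P x"])
    show "bounded_linear (\<lambda>x. x - P x)"
      by (intro bounded_linear_sub bounded_linear_ident P_bounded_linear)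
    show "S r (x - P x) = S r x - P (S r x)" if "r \<ge> 0" for r x
      using linear_diff[OF S_linear[OF that]] P_S[OF that] by simp
    show "F (y r) - P (F (y r)) = 0" for r using P_id[OF F_perp] by simp
  qed (use t0 in auto)
  also have "\<dots> = 0" using nilpotent[OF t(2) P_diff_W] by simp
  finally show ?thesis .
qed

text \<open>For initial states of norm below 1, \<open>V y0\<close> is at most the square of
  \<open>b\<close>, so one extinction time \<open>T\<close> serves them all. Up to \<open>T\<close>
  the norm grows by at most the fixed factor \<open>exp ((\<omega> + L) * T)\<close>.\<close>

lemma lyapunov_stable: "lyapunov_stable (weak_solution D A (feedback_term B P \<phi> \<mu>))"
  unfolding lyapunov_stable_def
proof (intro allI impI)
  fix \<epsilon> :: real assume \<epsilon>: "\<epsilon> > 0"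
  define T where "T = max ((b\<^sup>2) powr \<mu> / (2 * \<gamma> * \<mu>)) \<delta>"
  have T: "T \<ge> 0" using \<delta>_nonneg by (simp add: T_def)
  define \<eta> where "\<eta> = min 1 (\<epsilon> / exp ((\<omega> + L) * T))"
  have "norm (y t) < \<epsilon>" if y0: "norm y0 < \<eta>" and y: "weak y0 y" and t: "t \<ge> 0" for y0 y t
  proof (cases "t \<ge> T")
    case True
    have "V y0 = (p y0)\<^sup>2" by (simp add: V_def p_square)
    also have "\<dots> \<le> (b * 1)\<^sup>2"
      using y0 p_nonneg b_nonneg by (intro power_mono order_trans[OF p_le] mult_left_mono) (auto simp: \<eta>_def)
    finally have "V y0 powr \<mu> / (2 * \<gamma> * \<mu>) \<le> (b\<^sup>2) powr \<mu> / (2 * \<gamma> * \<mu>)"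
      using mu \<gamma>_pos V_nonneg by (intro divide_right_mono powr_mono2) auto
    then have "y t = 0" using weak_vanishes[OF y, of t] True by (simp add: T_def)
    then show ?thesis using \<epsilon> by simp
  next
    case False
    have "norm (y t) \<le> exp ((\<omega> + L) * t) * norm y0"
      using weak_compare[OF y weak_zero t] by simp
    also have "\<dots> \<le> exp ((\<omega> + L) * T) * norm y0"
      using False \<omega>_nonneg L_nonneg by (intro mult_right_mono) (auto intro: mult_left_mono)
    also have "\<dots> < exp ((\<omega> + L) * T) * (\<epsilon> / exp ((\<omega> + L) * T))"
      using y0 by (intro mult_strict_left_mono) (auto simp: \<eta>_def)
    finally show ?thesis by simp
  qed
  moreover have "\<eta> > 0" using \<epsilon> by (simp add: \<eta>_def)
  ultimately show "\<exists>\<eta>>0. \<forall>y0 y. norm y0 < \<eta> \<and> weak y0 y \<longrightarrow> (\<forall>t\<ge>0. norm (y t) < \<epsilon>)" by blast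
qed

lemma globally_finite_time_stable:
  "globally_finite_time_stable (weak_solution D A (feedback_term B P \<phi> \<mu>))"
  unfolding globally_finite_time_stable_def
proof (intro conjI lyapunov_stable allI)
  fix y0
  show "\<exists>T\<ge>0. \<forall>y. weak y0 y \<longrightarrow> (\<forall>t\<ge>T. y t = 0)"
    using weak_vanishes[of y0] \<delta>_nonneg
    by (intro exI[of _ "max (V y0 powr \<mu> / (2 * \<gamma> * \<mu>)) \<delta>"]) auto
qed

lemma settling_time_le:
  assumes "weak y0 y"
  shows "settling_time y \<le> max (inner (B (P y0)) (P y0) powr \<mu> / (2 * \<gamma> * \<mu>)) \<delta>"
  unfolding settling_time_def
proof (rule cInf_lower)
  show "max (inner (B (P y0)) (P y0) powr \<mu> / (2 * \<gamma> * \<mu>)) \<delta> \<in> {T. T \<ge> 0 \<and> (\<forall>t\<ge>T. y t = 0)}"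
    using weak_vanishes[OF assms] \<delta>_nonneg unfolding form_P V_def by auto
  show "bdd_below {T. T \<ge> 0 \<and> (\<forall>t\<ge>T. y t = 0)}" by (rule bdd_belowI[of _ 0]) auto
qed

end

text \<open>The stability predicate and the settling bound quantify over all weak solutions;
  well-posedness keeps them from holding vacuously and justifies speaking of the solution.\<close>

theorem theorem3p4:
  fixes A B P :: "'a::{real_inner, complete_space} \<Rightarrow> 'a"
    and D W :: "'a set"
    and S :: "real \<Rightarrow> 'a \<Rightarrow> 'a"
    and \<phi> :: "'a \<Rightarrow> real"
    and \<omega> \<gamma> \<delta> \<mu> :: real
  assumes generator: "generates D A S"
    and quasi_contractive: "\<forall>x\<in>D. inner (A x) x \<le> \<omega> * (norm x)\<^sup>2"
    and B_bounded: "bounded_linear B"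
    and B_selfadjoint: "\<forall>x y. inner (B x) y = inner x (B y)"
    and B_positive: "\<forall>x. inner (B x) x \<ge> 0"
    and W: "W = {x. \<forall>t\<ge>0. B (S t x) = 0}"
    and P: "P = orth_proj (W\<^sup>\<bottom>)"
    and i: "\<forall>t\<ge>0. S t ` (W\<^sup>\<bottom>) \<subseteq> W\<^sup>\<bottom>"
    and ii_nonneg: "\<forall>y \<in> W\<^sup>\<bottom> \<inter> D. \<phi> y \<ge> 0"
    and ii_bound: "\<forall>y \<in> W\<^sup>\<bottom> \<inter> D. inner (A y) (B y) \<le> \<phi> y * (norm (B y))\<^sup>2"
    and ii_lipschitz: "\<exists>Y L. L-lipschitz_on (W\<^sup>\<bottom>) Y \<and> (\<forall>y \<in> W\<^sup>\<bottom> \<inter> D. Y y = \<phi> y *\<^sub>R B y)"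
    and iii: "\<gamma> > 0" "\<forall>x \<in> W\<^sup>\<bottom>. \<gamma> * inner (B x) x \<le> (norm (B x))\<^sup>2"
    and iv: "\<delta> \<ge> 0" "\<forall>t\<ge>\<delta>. \<forall>x\<in>W. S t x = 0"
    and mu: "0 < \<mu>" "\<mu> < 1/2"
  shows "globally_well_posed (weak_solution D A (feedback_term B P \<phi> \<mu>)) \<and>
    globally_finite_time_stable (weak_solution D A (feedback_term B P \<phi> \<mu>)) \<and>
    (\<forall>y0 y. weak_solution D A (feedback_term B P \<phi> \<mu>) y0 y \<longrightarrow>
       settling_time y \<le> max (inner (B (P y0)) (P y0) powr \<mu> / (2 * \<gamma> * \<mu>)) \<delta>)"
proof -
  obtain Y L where Y: "L-lipschitz_on (W\<^sup>\<bottom>) Y" "\<forall>y \<in> W\<^sup>\<bottom> \<inter> D. Y y = \<phi> y *\<^sub>R B y"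
    using ii_lipschitz by blast
  \<comment> \<open>Enlarging the growth rate to a nonnegative one affects neither the conclusion
    nor the settling bound, in which it does not occur.\<close>
  have qc: "inner (A x) x \<le> max \<omega> 0 * (norm x)\<^sup>2" if "x \<in> D" for x
    using quasi_contractive that mult_right_mono[of \<omega> "max \<omega> 0" "(norm x)\<^sup>2"] by force
  interpret closed_loop D A S "max \<omega> 0" B \<mu> P W \<phi> Y L \<gamma> \<delta>
  proof (intro closed_loop.intro quasi_contractive_semigroup.intro power_feedback.intro
      positive_operator.intro power_feedback_axioms.intro closed_loop_axioms.intro)
    show "S t x \<in> W\<^sup>\<bottom>" if "t \<ge> 0" "x \<in> W\<^sup>\<bottom>" for t x using i that by blast
    show "inner (B x) y = inner x (B y)" for x y using B_selfadjoint by blast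
    show "S t x = 0" if "t \<ge> \<delta>" "x \<in> W" for t x using iv(2) that by blast
  qed (fact | simp add: B_positive ii_nonneg ii_bound iii Y qc)+
  show ?thesis
    using globally_well_posed globally_finite_time_stable settling_time_le by blast
qed

end
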